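(* Let $\alpha\in(0,1)$. Let $f\in\mathcal{S}^{1,\alpha}$ and let $\varphi$ be a univalent function with $\varphi(\infty)=\infty$ such that $f$ and $\varphi$ are matching. Put $\psi:=\varphi^{-1}$ and define $$v_0(z):=\frac1z\,\frac{\psi(f(z))}{f'(z)\,\psi'(f(z))},\qquad z\in S^1 .$$ Then the kernel of the linear operator $I_f:\mathrm{Lip}_\alpha(S^1,\mathbb{R})\to\mathrm{Hol}(\mathbb{D})$ is the one-dimensional space $\ker I_f=\mathrm{span}\{v_0\}$. Moreover, $v_0$ is positive on $S^1$ and $$\int_0^{2\pi}\frac{dt}{v_0(e^{it})}=2\pi .$$
   Context: $\mathbb{D}=\{z:|z|<1\}$, $S^1=\partial\mathbb{D}$, $\mathbb{D}^*=\overline{\mathbb{C}}\setminus\overline{\mathbb{D}}$. $\mathcal{S}$ is the class of univalent holomorphic functions $f$ in $\mathbb{D}$ with $f(0)=0$, $f'(0)=1$. For $\alpha\in(0,1)$, $\mathrm{Lip}_\alpha$ denotes Hölder continuous functions of exponent $\alpha$, $C^{1,\alpha}$ the differentiable functions with derivative in $\mathrm{Lip}_\alpha$, and $\mathcal{S}^{1,\alpha}$ is the set of $f\in\mathcal{S}$ mapping $\mathbb{D}$ onto a domain bounded by a $C^{1,\alpha}$-smooth Jordan curve (equivalently, $f$ extends continuously to $S^1$ with $f|_{S^1}\in C^{1,\alpha}$ and $f'|_{S^1}$ nonvanishing). $\mathrm{Lip}_\alpha(S^1,\mathbb{R})$ is the space of real-valued $\mathrm{Lip}_\alpha$ functions on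 $S^1$, and $\mathrm{Hol}(\mathbb{D})$ the space of holomorphic functions on $\mathbb{D}$. A conformal map $f$ of $\mathbb{D}$ onto a Jordan domain $D$ and a conformal map $\varphi$ of $\mathbb{D}^*$ onto a Jordan domain $D^*$ are called matching if $D\cap D^*=\emptyset$ and $\partial D=\partial D^*$. The operator $I_f$ is defined by $$I_f[v](z):=-\frac{1}{2\pi i}\int_{S^1}\left(\frac{s f'(s)}{f(s)}\right)^2\frac{v(s)}{f(s)-f(z)}\frac{ds}{s},\qquad z\in\mathbb{D},$$ where $f'$ on $S^1$ denotes the boundary extension of the derivative; in the formula for $v_0$, $\psi$ and $\psi'$ are the continuous extensions to $\partial D^*$. *)

theory Defs
  imports "HOL-Complex_Analysis.Complex_Analysis"
begin

definition holder_on :: "real \<Rightarrow> 'a::metric_space set \<Rightarrow> ('a \<Rightarrow> 'b::real_normed_vector) \<Rightarrow> bool" where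
  "holder_on a S g \<longleftrightarrow> (\<exists>C. \<forall>x\<in>S. \<forall>y\<in>S. norm (g x - g y) \<le> C * dist x y powr a)"

definition bderiv :: "(complex \<Rightarrow> complex) \<Rightarrow> complex \<Rightarrow> complex" where
  "bderiv f z = Lim (at z within ball 0 1) (deriv f)"

definition S1alpha :: "real \<Rightarrow> (complex \<Rightarrow> complex) \<Rightarrow> bool" where
  "S1alpha a f \<longleftrightarrow>
     f holomorphic_on ball 0 1 \<and> inj_on f (ball 0 1) \<and> f 0 = 0 \<and> deriv f 0 = 1 \<and>
     continuous_on (cball 0 1) f \<and> inj_on f (cball 0 1) \<and>
     (\<exists>g. (\<forall>t. ((\<lambda>t. f (cis t)) has_vector_derivative g t) (at t)) \<and> holder_on a UNIV g) \<and>
     (\<forall>z\<in>sphere 0 1. (deriv f \<longlongrightarrow> bderiv f z) (at z within ball 0 1) \<and> bderiv f z \<noteq> 0)"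

text \<open>The exterior of the closed unit disc (the point at infinity is treated via limits).\<close>
definition ext_disc :: "complex set" where
  "ext_disc = {z. 1 < norm z}"

definition univalent_ext_inf :: "(complex \<Rightarrow> complex) \<Rightarrow> bool" where
  "univalent_ext_inf \<phi> \<longleftrightarrow> \<phi> holomorphic_on ext_disc \<and> inj_on \<phi> ext_disc \<and>
      filterlim \<phi> at_infinity at_infinity"

text \<open>f and phi are matching: D = f(disc) and D* = phi(exterior) (together with infinity) are disjoint
  and have common boundary (the point infinity lies in the interior of D*, so the boundaries
  coincide already in the finite plane).\<close>
definition matching :: "(complex \<Rightarrow> complex) \<Rightarrow> (complex \<Rightarrow> complex) \<Rightarrow> bool" where
  "matching f \<phi> \<longleftrightarrow> f ` ball 0 1 \<inter> \<phi> ` ext_disc = {} \<and>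
      frontier (f ` ball 0 1) = frontier (\<phi> ` ext_disc)"

definition psi_of :: "(complex \<Rightarrow> complex) \<Rightarrow> complex \<Rightarrow> complex" where
  "psi_of \<phi> = inv_into ext_disc \<phi>"

definition psi_bd :: "(complex \<Rightarrow> complex) \<Rightarrow> complex \<Rightarrow> complex" where
  "psi_bd \<phi> w = Lim (at w within \<phi> ` ext_disc) (psi_of \<phi>)"

definition dpsi_bd :: "(complex \<Rightarrow> complex) \<Rightarrow> complex \<Rightarrow> complex" where
  "dpsi_bd \<phi> w = Lim (at w within \<phi> ` ext_disc) (deriv (psi_of \<phi>))"

definition v0 :: "(complex \<Rightarrow> complex) \<Rightarrow> (complex \<Rightarrow> complex) \<Rightarrow> complex \<Rightarrow> complex" where
  "v0 f \<phi> z = (1 / z) * psi_bd \<phi> (f z) / (bderiv f z * dpsi_bd \<phi> (f z))"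

definition I_op :: "(complex \<Rightarrow> complex) \<Rightarrow> (complex \<Rightarrow> real) \<Rightarrow> complex \<Rightarrow> complex" where
  "I_op f v z = - (1 / (2 * pi * \<i>)) *
     contour_integral (circlepath 0 1)
       (\<lambda>s. (s * bderiv f s / f s)\<^sup>2 * of_real (v s) / (f s - f z) / s)"

end

theory Submission
  imports Defs
begin

text \<open>
  The harmonic measure of the exterior domain, seen from infinity and pulled back to the circle by \<open>f\<close>,
  is obtained as a weak limit of the measures carried by the level curves \<open>\<phi> (cis t / r)\<close>.
  With \<open>c z\<close> the integral of \<open>1 / (s - z)\<close> against it, its Poisson integral is \<open>1 + 2 Re (z c z)\<close>. Since no harmonic
  measure lies in the interior domain, \<open>c'\<close> can be written with the kernel
  \<open>1 / (s - z)^2 - f'(z)^2 / (f s - f z)^2 = O(\<bar>s - z\<bar> powr (a - 2))\<close>, which is weakly singular. An absorption argument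
  bounds the Poisson integral, and the Hardy--Littlewood lemma makes the measure absolutely continuous with
  a Hoelder continuous density \<open>p\<close>. By a Plemelj formula \<open>P = \<psi>' / \<psi>\<close> has the boundary values
  \<open>p s / (s f'(s))\<close>, so that \<open>v\<^sub>0 = 1 / p\<close>; a Hopf-type comparison gives \<open>p > 0\<close>, and the normalisation says that
  \<open>p\<close> has average \<open>1\<close>.

  If \<open>I\<^sub>f[v] = 0\<close>, then, again by Plemelj, \<open>s f'(s) v s / f(s)^2\<close> is the boundary value of a Cauchy transform \<open>H\<close> in the
  exterior domain, and \<open>w^2 H(w) P(w)\<close> is holomorphic there, including infinity, with the real boundary
  values \<open>v p\<close>; hence it is constant. Conversely, \<open>I\<^sub>f[1 / p]\<close> at \<open>z\<close> is the integral against the harmonic measure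
  of the boundary values of \<open>1 / (w^2 P(w)^2 (w - f z))\<close>, which vanishes at infinity.
\<close>

subsection \<open>Averages over the circle\<close>

text \<open>The hypotheses say nothing about \<open>\<phi>\<close> near the boundary, yet
  \<open>v0\<close> is written with limits of \<open>psi_of \<phi>\<close> and of its derivative on
  the curve. Their existence, a Kellogg-Warschawski statement for the exterior domain, has to be
  extracted from the smoothness of \<open>f\<close> alone. Harmonic measure serves here because
  \<open>log \<bar>\<psi>\<bar>\<close> is the Green function of the exterior domain with pole at
  infinity, so that the Cauchy transform of the measure is the logarithmic derivative
  \<open>P\<close> of \<open>\<psi>\<close>. A Hoelder continuous density then bounds
  \<open>\<psi>'\<close> up to the curve, and integrating this bound along short paths outside the
  curve gives the limit of \<open>\<psi>\<close> itself, which cancels from \<open>v0\<close>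
  because \<open>\<psi>' = P \<psi>\<close>. The factor \<open>w^2\<close> in the kernel argument
  does two things. Both \<open>H\<close> and \<open>P\<close> decay like \<open>1 / w\<close>, so
  \<open>w^2 H P\<close> stays finite at infinity; on the curve \<open>w^2\<close> cancels the
  \<open>f(s)^2\<close> in the denominator of the operator. The factor \<open>s f'(s)\<close>, which
  is the outer normal, appears once in \<open>H\<close> and once inverted in \<open>P\<close>, and
  what is left is the real number \<open>v p\<close>.\<close>

definition avg :: "(real \<Rightarrow> 'a::euclidean_space) \<Rightarrow> 'a" where
  "avg g = (1 / (2 * pi)) *\<^sub>R integral {0..2*pi} g"

lemma avg_cong: "(\<And>t. t \<in> {0..2*pi} \<Longrightarrow> g t = h t) \<Longrightarrow> avg g = avg h"
  unfolding avg_def by (metis integral_cong)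

lemma avg_const [simp]: "avg (\<lambda>t. c) = c"
  unfolding avg_def using pi_gt_zero by (simp add: field_simps)

lemma cont_integrable: "continuous_on {0..2*pi} g \<Longrightarrow> g integrable_on {0..2*pi::real}"
  for g :: "real \<Rightarrow> 'a::euclidean_space"
  by (rule integrable_continuous_interval)

lemma avg_add: "continuous_on {0..2*pi} g \<Longrightarrow> continuous_on {0..2*pi} h \<Longrightarrow>
    avg (\<lambda>t. g t + h t) = avg g + avg h"
  unfolding avg_def by (simp add: integral_add cont_integrable scaleR_add_right)

lemma avg_diff: "continuous_on {0..2*pi} g \<Longrightarrow> continuous_on {0..2*pi} h \<Longrightarrow>
    avg (\<lambda>t. g t - h t) = avg g - avg h"
  unfolding avg_def by (simp add: integral_diff cont_integrable scaleR_diff_right)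

lemma avg_mult_right: "avg (\<lambda>t. c * g t) = c * avg g" for c :: complex
  unfolding avg_def by simp

lemma avg_mult_right_real: "avg (\<lambda>t. c * g t) = c * avg g" for c :: real
  unfolding avg_def by simp

lemma avg_sum: "finite A \<Longrightarrow> (\<And>k. k \<in> A \<Longrightarrow> continuous_on {0..2*pi} (g k)) \<Longrightarrow>
    avg (\<lambda>t. \<Sum>k\<in>A. g k t) = (\<Sum>k\<in>A. avg (g k))"
  unfolding avg_def by (simp add: integral_sum cont_integrable scaleR_sum_right)

lemma avg_bounded_linear:
  assumes "bounded_linear L" "continuous_on {0..2*pi} g"
  shows "avg (\<lambda>t. L (g t)) = L (avg g)"
proof -
  have "integral {0..2*pi} (L \<circ> g) = L (integral {0..2*pi} g)"
    by (rule integral_linear[OF cont_integrable[OF assms(2)] assms(1)])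
  then show ?thesis
    unfolding avg_def
    by (simp add: o_def linear_simps(5)[OF assms(1)])
qed

lemma avg_Re: "continuous_on {0..2*pi} g \<Longrightarrow> Re (avg g) = avg (\<lambda>t. Re (g t))"
  by (rule avg_bounded_linear[OF bounded_linear_Re, symmetric])

lemma avg_cnj: "continuous_on {0..2*pi} g \<Longrightarrow> cnj (avg g) = avg (\<lambda>t. cnj (g t))"
  by (rule avg_bounded_linear[OF bounded_linear_cnj, symmetric])

lemma avg_mono: "continuous_on {0..2*pi} g \<Longrightarrow> continuous_on {0..2*pi} h \<Longrightarrow>
    (\<And>t. t \<in> {0..2*pi} \<Longrightarrow> g t \<le> h t) \<Longrightarrow> avg g \<le> avg h" for g h :: "real \<Rightarrow> real"
  unfolding avg_def by (auto intro!: divide_right_mono integral_le cont_integrable)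

lemma norm_avg_le: 
  assumes "continuous_on {0..2*pi} g" "continuous_on {0..2*pi} h" 
    "\<And>t. t \<in> {0..2*pi} \<Longrightarrow> norm (g t) \<le> h t"
  shows "norm (avg g) \<le> avg h"
proof -
  have "norm (integral {0..2*pi} g) \<le> integral {0..2*pi} h"
    by (rule integral_norm_bound_integral) (use assms in \<open>auto intro: cont_integrable\<close>)
  then show ?thesis unfolding avg_def by (auto intro: divide_right_mono)
qed

lemma norm_avg_le_const:
  assumes "continuous_on {0..2*pi} g" "\<And>t. t \<in> {0..2*pi} \<Longrightarrow> norm (g t) \<le> B"
  shows "norm (avg g) \<le> B"
  using norm_avg_le[OF assms(1) _ assms(2)] by auto

lemma continuous_on_circle:
  assumes "continuous_on (sphere 0 1) q"
  shows "continuous_on A (\<lambda>t. q (cis t))"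
  by (rule continuous_on_compose2[OF assms]) (auto intro: continuous_intros)

text \<open>On the circle \<open>ds = i s dt\<close>; an average whose integrand ends in a factor
  \<open>cis t\<close> is a contour integral over \<open>2 pi i\<close> in disguise, and this is how
  Cauchy's formulas are applied below.\<close>

lemma has_contour_integral_circle:
  assumes "(q has_contour_integral I) (circlepath 0 r)"
  shows "avg (\<lambda>t. q (r * cis t) * (r * cis t)) = I / (2 * pi * \<i>)"
proof -
  have "((\<lambda>t. q (0 + r * cis t) * r * \<i> * cis t) has_integral I) {0..2*pi}"
    using assms unfolding circlepath_def by (subst (asm) has_contour_integral_part_circlepath_iff) auto
  then have "((\<lambda>t. (1/\<i>) * (q (0 + r * cis t) * r * \<i> * cis t)) has_integral (1/\<i>) * I) {0..2*pi}"
    by (rule has_integral_mult_right)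
  moreover have "(1/\<i>) * (q (0 + r * cis t) * r * \<i> * cis t) = q (r * cis t) * (r * cis t)" for t
    by (simp add: field_simps)
  ultimately have "integral {0..2*pi} (\<lambda>t. q (r * cis t) * (r * cis t)) = (1/\<i>) * I"
    by (simp add: integral_unique)
  then show ?thesis unfolding avg_def by (simp add: scaleR_conv_of_real field_simps)
qed

lemma contour_integral_circle:
  assumes "continuous_on (sphere 0 1) q"
  shows "contour_integral (circlepath 0 1) q = 2 * pi * \<i> * avg (\<lambda>t. q (cis t) * cis t)"
proof -
  have "((\<lambda>t. q (0 + 1 * cis t) * 1 * \<i> * cis t) has_integral (2*pi*\<i> * avg (\<lambda>t. q (cis t) * cis t))) {0..2*pi}"
  proof -
    have "((\<lambda>t. q (cis t) * cis t) has_integral integral {0..2*pi} (\<lambda>t. q (cis t) * cis t)) {0..2*pi}"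
      by (intro integrable_integral cont_integrable continuous_intros continuous_on_circle[OF assms])
    then have "((\<lambda>t. \<i> * (q (cis t) * cis t)) has_integral \<i> * integral {0..2*pi} (\<lambda>t. q (cis t) * cis t)) {0..2*pi}"
      by (rule has_integral_mult_right)
    then show ?thesis
      by (simp add: avg_def scaleR_conv_of_real mult_ac)
  qed
  then have "(q has_contour_integral (2*pi*\<i> * avg (\<lambda>t. q (cis t) * cis t))) (circlepath 0 1)"
    unfolding circlepath_def by (subst has_contour_integral_part_circlepath_iff) auto
  then show ?thesis by (rule contour_integral_unique)
qed

lemma avg_cauchy_formula:
  assumes "continuous_on (cball 0 r) q" "q holomorphic_on ball 0 r" "norm w < r"
  shows "avg (\<lambda>t. q (r * cis t) * (r * cis t) / (r * cis t - w)) = q w"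
  using has_contour_integral_circle[OF Cauchy_integral_circlepath[OF assms(1,2)], of w] assms(3)
  by (simp add: field_simps)

lemma avg_mean_value:
  assumes "continuous_on (cball 0 r) q" "q holomorphic_on ball 0 r" "0 < r"
  shows "avg (\<lambda>t. q (r * cis t)) = q 0"
  using avg_cauchy_formula[OF assms(1,2), of 0] assms(3) by simp

lemma avg_cauchy_theorem:
  assumes "continuous_on (cball 0 1) q" "q holomorphic_on ball 0 1"
  shows "avg (\<lambda>t. q (cis t) * cis t) = 0"
proof -
  have "avg (\<lambda>t. (\<lambda>z. q z * z) (1 * cis t)) = 0"
    using assms by (subst avg_mean_value[where r=1, simplified])
      (auto intro!: continuous_intros holomorphic_intros)
  then show ?thesis by simp
qed

subsection \<open>The Poisson kernel\<close>

definition poisson :: "complex \<Rightarrow> complex \<Rightarrow> real" where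
  "poisson z s = (1 - (norm z)\<^sup>2) / (norm (s - z))\<^sup>2"

lemma poisson_nonneg: "norm z \<le> 1 \<Longrightarrow> 0 \<le> poisson z s"
  unfolding poisson_def by (simp add: power_le_one)

text \<open>The kernel is the real part of the Herglotz kernel \<open>(s + z) / (s - z)\<close>.
  This reduces Poisson integrals to Cauchy integrals of \<open>1 / (s - z)\<close>, which are
  holomorphic in \<open>z\<close>.\<close>

lemma poisson_eq:
  assumes "norm s = 1" "norm z < 1"
  shows "poisson z s = 1 + 2 * Re (z * (1 / (s - z)))"
proof -
  have ne: "s - z \<noteq> 0" using assms by auto
  have "1 + 2 * Re (z * (1 / (s - z))) = ((norm (s - z))\<^sup>2 + 2 * Re (z * cnj (s - z))) / (norm (s-z))\<^sup>2"
    using ne by (simp add: complex_div_cnj[of z] add_divide_distrib)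
  also have "(norm (s - z))\<^sup>2 + 2 * Re (z * cnj (s - z)) = (norm s)\<^sup>2 - (norm z)\<^sup>2"
    unfolding cmod_power2 by (simp add: algebra_simps power2_eq_square)
  finally show ?thesis using assms unfolding poisson_def by simp
qed

text \<open>On the circle the conjugate of \<open>z / (s - z)\<close> agrees with
  \<open>cnj z * w / (1 - cnj z * w)\<close>, which is holomorphic in the disc and vanishes at 0;
  the mean value property removes it.\<close>

lemma avg_poisson:
  assumes "norm z < 1"
  shows "avg (\<lambda>t. poisson z (cis t)) = 1"
proof -
  have 0: "cis t - z \<noteq> 0" for t using assms by (metis eq_iff_diff_eq_0 norm_cis less_irrefl)
  have 1: "1 - cnj z * w \<noteq> 0" if "norm w \<le> 1" for w
  proof
    assume "1 - cnj z * w = 0"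
    then have "norm z * norm w = 1" by (metis complex_mod_cnj norm_mult norm_one right_minus_eq)
    then show False using assms that mult_left_le[of "norm w" "norm z"] by auto
  qed
  have "avg (\<lambda>t. (\<lambda>w. cnj z * w / (1 - cnj z * w)) (1 * cis t)) = 0"
    using 1 by (subst avg_mean_value[where r=1, simplified])
      (auto intro!: continuous_intros holomorphic_intros)
  moreover have "cnj z * cis t / (1 - cnj z * cis t) = cnj (z * (1 / (cis t - z)))" for t
  proof -
    have "cis t * cnj (cis t) = 1" by (simp add: cis_cnj cis_mult)
    then have "1 - cnj z * cis t = cis t * (cnj (cis t - z))" by (simp add: algebra_simps)
    then show ?thesis by simp
  qed
  ultimately have *: "avg (\<lambda>t. cnj (z * (1 / (cis t - z)))) = 0" by simp
  have c: "continuous_on {0..2*pi} (\<lambda>t. z * (1 / (cis t - z)))"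
    using 0 by (auto intro!: continuous_intros)
  have "avg (\<lambda>t. z * (1 / (cis t - z))) = 0"
    using * avg_cnj[OF c] by simp
  then have "avg (\<lambda>t. Re (z * (1 / (cis t - z)))) = 0"
    using avg_Re[OF c] by simp
  moreover have "avg (\<lambda>t. poisson z (cis t)) = avg (\<lambda>t. 1 + 2 * Re (z * (1 / (cis t - z))))"
    using assms by (intro avg_cong poisson_eq) auto
  moreover have "\<dots> = 1 + 2 * avg (\<lambda>t. Re (z * (1 / (cis t - z))))"
    using c by (subst avg_add) (auto intro!: continuous_intros simp: avg_mult_right_real 0)
  ultimately show ?thesis by simp
qed

section \<open>Weakly singular powers and dyadic sums of Poisson kernels\<close>

lemma finite_dyadic:
  fixes \<delta> :: real
  assumes "0 < \<delta>" 
  shows "finite {k::nat. 2^k * \<delta> \<le> 1}"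
proof -
  obtain n where "1 / \<delta> < 2 ^ n" using real_arch_pow[of 2 "1/\<delta>"] by auto
  then have "k < n" if "2^k * \<delta> \<le> 1" for k
  proof -
    have "2 ^ k \<le> 1 / \<delta>" using that assms by (simp add: field_simps)
    then show ?thesis using \<open>1 / \<delta> < 2 ^ n\<close> 
      by (meson le_less_trans one_less_numeral_iff power_less_imp_less_exp semiring_norm(76))
  qed
  then show ?thesis by (meson finite_nat_set_iff_bounded mem_Collect_eq)
qed

text \<open>At distance \<open>x\<close> from \<open>z\<close> use the Poisson kernel at the dyadic height \<open>\<tau> = 2^k \<delta> \<approx> x\<close>:
  there it is at least \<open>1 / (9 \<tau>)\<close>.\<close>

lemma powr_le_dyadic_poisson:
  fixes a \<delta> :: real and s s0 :: complex
  assumes a: "0 < a" "a < 1" and s: "norm s = 1" "norm s0 = 1" and \<delta>: "0 < \<delta>" "\<delta> \<le> 1"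
  defines "A \<equiv> {k::nat. 2^k * \<delta> \<le> 1}"
  shows "norm (s - of_real (1 - \<delta>) * s0) powr (a - 2) \<le>
     1 + 9 * (\<Sum>k\<in>A. (2^k * \<delta>) powr (a - 1) * poisson (of_real (1 - 2^k * \<delta>) * s0) s)"
proof -
  define x where "x = norm (s - of_real (1 - \<delta>) * s0)"
  have nz: "norm (of_real (1-\<tau>) * s0) = 1 - \<tau>" if "0 < \<tau>" "\<tau> \<le> 1" for \<tau>
    using that s by (simp only: norm_mult norm_of_real) simp
  have x: "\<delta> \<le> x"
    using norm_triangle_ineq2[of s "of_real (1 - \<delta>) * s0"] nz[OF \<delta>] s unfolding x_def by simp
  have fin: "finite A" unfolding A_def by (rule finite_dyadic[OF \<delta>(1)])
  have nonneg: "0 \<le> (2^k * \<delta>) powr (a - 1) * poisson (of_real (1 - 2^k * \<delta>) * s0) s" if "k \<in> A" for k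
    using that nz[of "2^k*\<delta>"] \<delta> by (intro mult_nonneg_nonneg poisson_nonneg) (auto simp: A_def)
  show ?thesis
  proof (cases "x \<ge> 1")
    case True
    \<comment> \<open>This case is what the summand 1 of the bound is for.\<close>
    then have "x powr (a - 2) \<le> 1" using a powr_mono[of "a - 2" 0 x] by simp
    moreover have "0 \<le> (\<Sum>k\<in>A. (2^k * \<delta>) powr (a - 1) * poisson (of_real (1 - 2^k * \<delta>) * s0) s)"
      by (intro sum_nonneg nonneg)
    ultimately show ?thesis unfolding x_def by linarith
  next
    case False
    have "\<exists>k. 2^k * \<delta> \<le> x \<and> x < 2^(Suc k) * \<delta>"
    proof -
      define n where "n = (LEAST n. x < 2^n * \<delta>)"
      obtain m where "x / \<delta> < 2 ^ m" using real_arch_pow[of 2 "x/\<delta>"] by auto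
      then have m: "x < 2^m * \<delta>" using \<delta> by (simp add: field_simps)
      have 1: "x < 2^n * \<delta>" unfolding n_def using m by (rule LeastI)
      have "n \<noteq> 0" using 1 x by (metis lambda_one leD power_0)
      then obtain k where k: "n = Suc k" by (cases n) auto
      have "\<not> x < 2^k * \<delta>" using not_less_Least[of k "\<lambda>n. x < 2^n * \<delta>"] k n_def by auto
      then show ?thesis using 1 k by (metis not_less)
    qed
    then obtain k where k: "2^k * \<delta> \<le> x" "x < 2^(Suc k) * \<delta>" by blast
    define \<tau> where "\<tau> = 2^k * \<delta>"
    have \<tau>: "0 < \<tau>" "\<tau> \<le> 1" "\<tau> \<le> x" "x < 2 * \<tau>" "\<delta> \<le> \<tau>" using k \<delta> False by (auto simp: \<tau>_def)
    have kA: "k \<in> A" using \<tau> by (simp add: A_def \<tau>_def)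
    \<comment> \<open>The factor 3 is made of \<open>x < 2 * \<tau>\<close> and of the shift by
      \<open>\<tau> - \<delta>\<close>; its square is the 9 of the statement.\<close>
    have d: "norm (s - of_real (1 - \<tau>) * s0) \<le> 3 * \<tau>"
    proof -
      have "s - of_real (1 - \<tau>) * s0 = (s - of_real (1 - \<delta>) * s0) + of_real (\<tau> - \<delta>) * s0"
        by (simp add: algebra_simps)
      then have "norm (s - of_real (1 - \<tau>) * s0) \<le> x + norm (of_real (\<tau> - \<delta>) * s0)"
        unfolding x_def by (metis norm_triangle_ineq)
      also have "norm (of_real (\<tau> - \<delta>) * s0) = \<tau> - \<delta>" using \<tau> s by (simp only: norm_mult norm_of_real) simp
      finally show ?thesis using \<tau> \<delta> by simp
    qed
    have pos: "0 < norm (s - of_real (1 - \<tau>) * s0)"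
    proof -
      have "s \<noteq> of_real (1 - \<tau>) * s0" using nz[of \<tau>] \<tau> s by force
      then show ?thesis by simp
    qed
    have "1 / (9 * \<tau>) \<le> \<tau> / (3 * \<tau>)\<^sup>2" using \<tau> by (simp add: power2_eq_square field_simps)
    also have "\<dots> \<le> (1 - (1 - \<tau>)\<^sup>2) / (3 * \<tau>)\<^sup>2"
    proof (rule divide_right_mono)
      have "1 - (1 - \<tau>)\<^sup>2 = \<tau> + \<tau> * (1 - \<tau>)" by (simp add: power2_eq_square algebra_simps)
      moreover have "0 \<le> \<tau> * (1 - \<tau>)" using \<tau> by simp
      ultimately show "\<tau> \<le> 1 - (1 - \<tau>)\<^sup>2" by linarith
    qed simp
    also have "\<dots> \<le> (1 - (1 - \<tau>)\<^sup>2) / (norm (s - of_real (1 - \<tau>) * s0))\<^sup>2"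
      using \<tau> d pos by (intro divide_left_mono power_mono) (auto simp: power_le_one)
    also have "\<dots> = poisson (of_real (1 - \<tau>) * s0) s"
      using nz[of \<tau>] \<tau> unfolding poisson_def by simp
    finally have p: "1 / \<tau> \<le> 9 * poisson (of_real (1 - \<tau>) * s0) s" using \<tau> by (simp add: field_simps)
    have "x powr (a - 2) \<le> \<tau> powr (a - 2)"
      using \<tau> a by (intro powr_mono2') auto
    also have "\<dots> = \<tau> powr (a - 1) * (1 / \<tau>)"
      using \<tau> by (simp add: powr_diff powr_realpow field_simps power2_eq_square)
    also have "\<dots> \<le> \<tau> powr (a - 1) * (9 * poisson (of_real (1 - \<tau>) * s0) s)"
      by (intro mult_left_mono p) auto
    also have "\<dots> = 9 * (\<tau> powr (a - 1) * poisson (of_real (1 - \<tau>) * s0) s)" by simp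
    also have "\<tau> powr (a - 1) * poisson (of_real (1 - \<tau>) * s0) s \<le> 
        (\<Sum>k\<in>A. (2^k * \<delta>) powr (a - 1) * poisson (of_real (1 - 2^k * \<delta>) * s0) s)"
      unfolding \<tau>_def using member_le_sum[OF kA _ fin, of "\<lambda>k. (2^k * \<delta>) powr (a - 1) * poisson (of_real (1 - 2^k * \<delta>) * s0) s"]
      nonneg by simp
    finally show ?thesis unfolding x_def by linarith
  qed
qed

text \<open>Since \<open>a < 1\<close>, the terms form a geometric progression with ratio
  \<open>2 powr (a - 1) < 1\<close>, so the lowest height \<open>\<delta>\<close> dominates.\<close>

lemma sum_dyadic_powr_le:
  fixes a \<delta> :: real
  assumes a: "a < 1" and \<delta>: "0 < \<delta>"
  shows "(\<Sum>k | 2^k * \<delta> \<le> 1. (2^k * \<delta>) powr (a - 1)) \<le> \<delta> powr (a - 1) / (1 - 2 powr (a - 1))"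
proof -
  define q where "q = (2::real) powr (a - 1)"
  have q: "0 < q" "q < 1" using a by (auto simp: q_def powr_less_one)
  have "(\<Sum>k | 2^k * \<delta> \<le> 1. (2^k * \<delta>) powr (a - 1)) = \<delta> powr (a - 1) * (\<Sum>k | 2^k * \<delta> \<le> 1. q ^ k)"
    unfolding sum_distrib_left
  proof (rule sum.cong[OF refl])
    fix k
    have "((2::real)^k) powr (a - 1) = q ^ k"
      unfolding q_def by (simp add: powr_realpow[symmetric] powr_powr mult.commute)
    then show "(2^k * \<delta>) powr (a - 1) = \<delta> powr (a - 1) * q ^ k"
      using \<delta> by (simp add: powr_mult)
  qed
  also have "(\<Sum>k | 2^k * \<delta> \<le> 1. q ^ k) \<le> (\<Sum>k. q ^ k)"
    using q by (intro sum_le_suminf finite_dyadic \<delta> summable_geometric) auto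
  also have "\<dots> = 1 / (1 - q)" using q by (intro suminf_geometric) auto
  finally show ?thesis using q_def by (simp add: mult_left_mono)
qed

text \<open>Every Poisson kernel has average 1, so only the geometric sum survives from the dyadic
  bound.\<close>

lemma avg_powr_kernel_le:
  fixes a \<delta> :: real
  assumes a: "0 < a" "a < 1" and s0: "norm s0 = 1" and \<delta>: "0 < \<delta>" "\<delta> \<le> 1"
  shows "avg (\<lambda>t. norm (cis t - of_real (1 - \<delta>) * s0) powr (a - 2)) \<le> (1 + 9 / (1 - 2 powr (a - 1))) * \<delta> powr (a - 1)"
proof -
  define A where "A = {k::nat. 2^k * \<delta> \<le> 1}"
  have nz: "norm (of_real (1-\<tau>) * s0) = 1 - \<tau>" if "0 < \<tau>" "\<tau> \<le> 1" for \<tau>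
    using that s0 by (simp only: norm_mult norm_of_real) simp
  have zk: "norm (of_real (1 - 2^k * \<delta>) * s0) < 1" if "k \<in> A" for k
    using that nz[of "2^k*\<delta>"] \<delta> by (auto simp: A_def)
  have fin: "finite A" unfolding A_def using \<delta> by (rule_tac finite_dyadic)
  have ne: "cis t \<noteq> z" if "norm z < 1" for t z using that by auto
  have cp: "continuous_on {0..2*pi} (\<lambda>t. poisson z (cis t))" if "norm z < 1" for z
    unfolding poisson_def using ne[OF that] by (auto intro!: continuous_intros)
  have "avg (\<lambda>t. norm (cis t - of_real (1 - \<delta>) * s0) powr (a - 2)) \<le> 
     avg (\<lambda>t. 1 + 9 * (\<Sum>k\<in>A. (2^k * \<delta>) powr (a - 1) * poisson (of_real (1 - 2^k * \<delta>) * s0) (cis t)))"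
  proof (rule avg_mono)
    show "continuous_on {0..2*pi} (\<lambda>t. norm (cis t - of_real (1 - \<delta>) * s0) powr (a - 2))"
      using ne[of "of_real (1 - \<delta>) * s0"] nz[OF \<delta>] \<delta> by (intro continuous_intros) auto
    show "continuous_on {0..2*pi} (\<lambda>t. 1 + 9 * (\<Sum>k\<in>A. (2^k * \<delta>) powr (a - 1) * poisson (of_real (1 - 2^k * \<delta>) * s0) (cis t)))"
      by (intro continuous_intros cp zk)
    show "norm (cis t - of_real (1 - \<delta>) * s0) powr (a - 2) \<le> 1 + 9 * (\<Sum>k\<in>A. (2^k * \<delta>) powr (a - 1) * poisson (of_real (1 - 2^k * \<delta>) * s0) (cis t))" for t
      unfolding A_def by (rule powr_le_dyadic_poisson) (use assms in auto)
  qed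
  also have "\<dots> = 1 + 9 * (\<Sum>k\<in>A. (2^k * \<delta>) powr (a - 1))"
  proof -
    have "avg (\<lambda>t. \<Sum>k\<in>A. (2^k * \<delta>) powr (a - 1) * poisson (of_real (1 - 2^k * \<delta>) * s0) (cis t)) = 
       (\<Sum>k\<in>A. (2^k * \<delta>) powr (a - 1))"
      using cp zk fin by (subst avg_sum) (auto intro!: continuous_intros simp: avg_mult_right_real avg_poisson)
    then show ?thesis
      using cp zk by (subst avg_add) (auto intro!: continuous_intros simp: avg_mult_right_real)
  qed
  \<comment> \<open>The lone summand 1 is absorbed, because \<open>\<delta> \<le> 1\<close> and the
    exponent is negative.\<close>
  also have "\<dots> \<le> \<delta> powr (a - 1) + 9 * (\<delta> powr (a - 1) / (1 - 2 powr (a - 1)))"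
  proof -
    have "1 \<le> \<delta> powr (a - 1)" using \<delta> a powr_mono'[of "a - 1" 0 \<delta>] by simp
    then show ?thesis using sum_dyadic_powr_le[OF a(2) \<delta>(1)] unfolding A_def by linarith
  qed
  finally show ?thesis by (simp add: algebra_simps)
qed

subsection \<open>The Hardy--Littlewood lemma\<close>

lemma norm_powr_of_real: "norm (z powr of_real a) = norm z powr a" for z :: complex
  by (cases "z = 0") (auto simp: powr_def)

text \<open>The maximum principle for \<open>(h z - h s) x powr (1 - a) / (x + \<epsilon>)\<close> with \<open>x = 1 - z / s\<close>; the power
  \<open>1 - a\<close> makes this function continuous at \<open>s\<close>.\<close>

lemma holder_at_boundary_point:
  fixes a C :: real and h :: "complex \<Rightarrow> complex"
  assumes cont: "continuous_on (cball 0 1) h" and hol: "h holomorphic_on ball 0 1"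
    and s: "norm s = 1" and a: "a < 1" and C: "0 \<le> C"
    and bd: "\<And>y. norm y = 1 \<Longrightarrow> norm (h y - h s) \<le> C * norm (y - s) powr a"
    and z: "norm z \<le> 1"
  shows "norm (h z - h s) \<le> C * norm (z - s) powr a"
proof (cases "z = s")
  case True then show ?thesis by simp
next
  case False
  define x where "x = (\<lambda>z. 1 - z / s)"
  have s0: "s \<noteq> 0" using s by auto
  have Re_le: "Re (z / s) \<le> norm z" for z
    using complex_Re_le_cmod[of "z/s"] s by (simp add: norm_divide)
  have Rex: "0 \<le> Re (x z)" if "norm z \<le> 1" for z
    using Re_le[of z] that unfolding x_def by simp
  have Rex': "0 < Re (x z)" if "norm z < 1" for z
    using Re_le[of z] that unfolding x_def by simp
  have nx: "norm (x z) = norm (z - s)" for z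
  proof -
    have "x z = (s - z) / s" using s0 by (simp add: x_def field_simps)
    then show ?thesis using s by (simp add: norm_divide norm_minus_commute)
  qed
  have key: "norm (h z - h s) * norm (x z) powr (1 - a) \<le> C * norm (x z + of_real \<epsilon>)" if \<epsilon>: "0 < \<epsilon>" for \<epsilon>
  proof -
    define B where "B = (\<lambda>z. (h z - h s) * x z powr (of_real (1 - a)) / (x z + of_real \<epsilon>))"
    have ne: "x z + of_real \<epsilon> \<noteq> 0" if "norm z \<le> 1" for z
    proof -
      have "Re (x z + of_real \<epsilon>) > 0" using Rex[OF that] \<epsilon> by simp
      then show ?thesis by (metis less_irrefl zero_complex.sel(1))
    qed
    have contx: "continuous_on A x" for A unfolding x_def using s0 by (auto intro!: continuous_intros)
    have holx: "x holomorphic_on A" for A unfolding x_def using s0 by (auto intro!: holomorphic_intros)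
    have "norm (B z) \<le> C"
    proof (rule maximum_modulus_frontier[of B "cball 0 1"])
      have "continuous_on (cball 0 1) B" unfolding B_def
        using Rex ne a
        by (intro continuous_intros contx cont) (auto simp: complex_eq_iff)
      then show "continuous_on (closure (cball 0 1)) B" by simp
      have "B holomorphic_on ball 0 1" unfolding B_def
        using Rex' ne 
        by (intro holomorphic_intros holx hol) (fastforce simp: complex_nonpos_Reals_iff)+
      then show "B holomorphic_on interior (cball 0 1)" by simp
      fix y :: complex assume "y \<in> frontier (cball 0 1)"
      then have y: "norm y = 1" by simp
      \<comment> \<open>As \<open>Re (x y)\<close> is nonnegative, adding \<open>\<epsilon>\<close>
        only moves the denominator away from 0. It keeps \<open>B\<close> defined at
        \<open>s\<close>, and is sent to 0 after the maximum principle has been used.\<close>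
      have "norm (x y) \<le> norm (x y + of_real \<epsilon>)"
        unfolding cmod_def using Rex[of y] y \<epsilon> by (intro real_sqrt_le_mono) (simp add: power_mono)
      moreover have "norm (B y) \<le> C * norm (x y) / norm (x y + of_real \<epsilon>)"
      proof -
        have "norm (B y) = norm (h y - h s) * norm (x y) powr (1 - a) / norm (x y + of_real \<epsilon>)"
          unfolding B_def by (simp only: norm_mult norm_divide norm_powr_of_real)
        also have "\<dots> \<le> (C * norm (x y) powr a) * norm (x y) powr (1 - a) / norm (x y + of_real \<epsilon>)"
          using bd[OF y] nx by (intro divide_right_mono mult_right_mono) auto
        also have "\<dots> = C * norm (x y) / norm (x y + of_real \<epsilon>)"
          by (simp add: powr_add[symmetric])
        finally show ?thesis .
      qed
      ultimately show "norm (B y) \<le> C"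
        using ne[of y] y C mult_left_mono[of "norm (x y)" "norm (x y + of_real \<epsilon>)" C]
        by (smt (verit, best) pos_divide_le_eq zero_less_norm_iff)
    qed (use z in auto)
    then have "norm (h z - h s) * norm (x z) powr (1 - a) / norm (x z + of_real \<epsilon>) \<le> C"
      unfolding B_def by (simp only: norm_mult norm_divide norm_powr_of_real)
    then show ?thesis using ne[OF z] by (simp add: pos_divide_le_eq)
  qed
  have "norm (h z - h s) * norm (x z) powr (1 - a) \<le> C * norm (x z + of_real 0)"
  proof (rule tendsto_lowerbound)
    show "((\<lambda>\<epsilon>. C * norm (x z + of_real \<epsilon>)) \<longlongrightarrow> C * norm (x z + of_real 0)) (at_right 0)"
      by (intro tendsto_intros)
    show "\<forall>\<^sub>F \<epsilon> in at_right 0. norm (h z - h s) * norm (x z) powr (1 - a) \<le> C * norm (x z + of_real \<epsilon>)"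
      using key by (auto simp: eventually_at_right_less intro: eventually_mono[OF eventually_at_right_less])
  qed simp
  also have "\<dots> = C * norm (x z) powr a * norm (x z) powr (1 - a)"
    by (simp add: powr_add[symmetric])
  finally have "norm (h z - h s) \<le> C * norm (x z) powr a"
    using False by (simp add: nx)
  then show ?thesis by (simp add: nx)
qed

text \<open>With \<open>\<delta>\<close> the distance of \<open>z\<close> and \<open>w\<close>, go
  from both points radially to \<open>(1 - \<delta>) z\<close> and \<open>(1 - \<delta>) w\<close>
  and cross there, where \<open>c'\<close> is at most \<open>C * \<delta> powr (a - 1)\<close>. Each
  radial leg integrates to \<open>C / a * \<delta> powr a\<close>, and the crossing adds
  \<open>C * \<delta> powr a\<close>.\<close>

lemma hardy_littlewood_interior:
  fixes c :: "complex \<Rightarrow> complex"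
  assumes hol: "c holomorphic_on ball 0 1" and a: "0 < a" "a < 1" 
    and bd: "\<And>z. norm z < 1 \<Longrightarrow> norm (deriv c z) \<le> C * (1 - norm z) powr (a - 1)"
    and z: "norm z < 1" and w: "norm w < 1"
  shows "norm (c z - c w) \<le> (2 * C / a + C) * norm (z - w) powr a"
proof -
  have C: "0 \<le> C" using order_trans[OF norm_ge_zero bd[of 0]] by simp
  have radial: "norm (c y - c (of_real (1 - \<delta>) * y)) \<le> C / a * \<delta> powr a" if y: "norm y < 1" and \<delta>: "0 < \<delta>" "\<delta> \<le> 1" for y \<delta>
  proof -
    have bnd: "norm (of_real t * y) < 1" if "0 \<le> t" "t \<le> 1" for t
      using that y mult_left_le_one_le[of "norm y" t] by (simp add: norm_mult)
    have der: "((\<lambda>t. c (of_real t * y)) has_vector_derivative deriv c (of_real t * y) * y) (at t)" if "0 \<le> t" "t \<le> 1" for t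
    proof -
      have "(c has_field_derivative deriv c (of_real t * y)) (at (of_real t * y))"
        using holomorphic_derivI[OF hol, of "of_real t * y"] bnd[OF that] by simp
      then have "((\<lambda>w. c (w * y)) has_field_derivative deriv c (of_real t * y) * y) (at (of_real t))"
        by (rule DERIV_chain2) (auto intro!: derivative_eq_intros)
      then show ?thesis by (rule has_vector_derivative_real_field)
    qed
    have "norm ((\<lambda>t. c (of_real t * y)) 1 - (\<lambda>t. c (of_real t * y)) (1 - \<delta>)) \<le> (\<lambda>t. - (C / a) * (1 - t) powr a) 1 - (\<lambda>t. - (C / a) * (1 - t) powr a) (1 - \<delta>)"
    proof (rule differentiable_bound_general)
      show "1 - \<delta> < 1" using \<delta> by simp
      show "continuous_on {1 - \<delta>..1} (\<lambda>t. c (of_real t * y))"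
        using has_vector_derivative_continuous[OF der] \<delta> by (intro continuous_at_imp_continuous_on) auto
      show "continuous_on {1 - \<delta>..1} (\<lambda>t. - (C / a) * (1 - t) powr a)"
        using a by (intro continuous_intros continuous_on_powr') auto
      fix t assume t: "1 - \<delta> < t" "t < 1"
      show "((\<lambda>t. c (of_real t * y)) has_vector_derivative deriv c (of_real t * y) * y) (at t)"
        using der t \<delta> by auto
      show "((\<lambda>t. - (C / a) * (1 - t) powr a) has_vector_derivative C * (1 - t) powr (a - 1)) (at t)"
        unfolding has_real_derivative_iff_has_vector_derivative[symmetric]
        using t a by (auto intro!: derivative_eq_intros)
      have "norm (deriv c (of_real t * y) * y) \<le> norm (deriv c (of_real t * y)) * 1"
        unfolding norm_mult using y by (intro mult_left_mono) auto
      also have "\<dots> \<le> C * (1 - norm (of_real t * y)) powr (a - 1)"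
        using bd[OF bnd[of t]] t \<delta> by simp
      also have "\<dots> \<le> C * (1 - t) powr (a - 1)"
        using t \<delta> y C a mult_left_le[of "norm y" t]
        by (intro mult_left_mono powr_mono2') (auto simp: norm_mult)
      finally show "norm (deriv c (of_real t * y) * y) \<le> C * (1 - t) powr (a - 1)" .
    qed
    then show ?thesis using a by simp
  qed
  define \<delta> where "\<delta> = norm (z - w)"
  show ?thesis
  proof (cases "z = w")
    case True then show ?thesis by simp
  next
    case False
    then have \<delta>0: "0 < \<delta>" by (simp add: \<delta>_def)
    show ?thesis
    proof (cases "\<delta> < 1")
      case True
      define z' w' where "z' = of_real (1 - \<delta>) * z" and "w' = of_real (1 - \<delta>) * w"
      have n1: "norm (of_real (1 - \<delta>) :: complex) = 1 - \<delta>" using True by (simp only: norm_of_real)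
      have z'w': "norm z' \<le> 1 - \<delta>" "norm w' \<le> 1 - \<delta>"
        unfolding z'_def w'_def norm_mult n1 using z w True by (auto intro: mult_left_le)
      have "norm (c z' - c w') \<le> (C * \<delta> powr (a - 1)) * norm (z' - w')"
      proof (rule field_differentiable_bound[of "cball 0 (1 - \<delta>)" c "deriv c"])
        fix y :: complex assume y: "y \<in> cball 0 (1 - \<delta>)"
        then have y1: "norm y < 1" using \<delta>0 by auto
        show "(c has_field_derivative deriv c y) (at y within cball 0 (1 - \<delta>))"
          using holomorphic_derivI[OF hol, of y] y1 by (simp add: has_field_derivative_at_within)
        have "(1 - norm y) powr (a - 1) \<le> \<delta> powr (a - 1)"
          using y \<delta>0 a by (intro powr_mono2') auto
        then show "norm (deriv c y) \<le> C * \<delta> powr (a - 1)"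
          using bd[OF y1] mult_left_mono[OF _ C] by force
      qed (use z'w' in auto)
      also have "norm (z' - w') \<le> \<delta>"
      proof -
        have "z' - w' = of_real (1 - \<delta>) * (z - w)" by (simp add: z'_def w'_def algebra_simps)
        then have "norm (z' - w') = (1 - \<delta>) * \<delta>" by (simp only: norm_mult n1 \<delta>_def[symmetric])
        then show ?thesis using \<delta>0 True by (simp add: mult_le_cancel_right1)
      qed
      finally have "norm (c z' - c w') \<le> (C * \<delta> powr (a - 1)) * \<delta>" using C by (simp add: mult_left_mono)
      also have "\<dots> = C * \<delta> powr a" using \<delta>0 by (simp add: powr_diff)
      finally have 1: "norm (c z' - c w') \<le> C * \<delta> powr a" .
      have 2: "norm (c z - c z') \<le> C / a * \<delta> powr a" "norm (c w - c w') \<le> C / a * \<delta> powr a"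
        unfolding z'_def w'_def using radial[of _ \<delta>] z w \<delta>0 True by auto
      have "c z - c w = (c z - c z') + (c z' - c w') - (c w - c w')" by simp
      then have "norm (c z - c w) = norm ((c z - c z') + (c z' - c w') - (c w - c w'))"
        by (rule arg_cong)
      then have "norm (c z - c w) \<le> C / a * \<delta> powr a + C * \<delta> powr a + C / a * \<delta> powr a"
        using 1 2 norm_triangle_ineq4[of "(c z - c z') + (c z' - c w')" "c w - c w'"]
          norm_triangle_ineq[of "c z - c z'" "c z' - c w'"] by linarith
      also have "\<dots> = (2 * C / a + C) * \<delta> powr a" by (simp add: algebra_simps add_divide_distrib)
      finally show ?thesis unfolding \<delta>_def .
    next
      case False
      \<comment> \<open>Points at distance at least 1 are joined through the origin.\<close>
      have 2: "norm (c z - c 0) \<le> C / a" "norm (c w - c 0) \<le> C / a"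
        using radial[of _ 1] z w by auto
      have "norm (c z - c w) \<le> 2 * C / a" 
        using norm_triangle_ineq4[of "c z - c 0" "c w - c 0"] 2 by simp
      also have "\<dots> \<le> (2 * C / a + C) * 1" using C by simp
      also have "\<dots> \<le> (2 * C / a + C) * \<delta> powr a"
        using C a False by (intro mult_left_mono ge_one_powr_ge_zero) auto
      finally show ?thesis unfolding \<delta>_def .
    qed
  qed
qed

text \<open>The interior estimate gives uniform continuity, hence a continuous extension; the
  Hoelder bound passes to boundary points by shrinking both points with the same factor
  \<open>1 - 1 / (n + 1)\<close>.\<close>

lemma hardy_littlewood:
  fixes c :: "complex \<Rightarrow> complex"
  assumes hol: "c holomorphic_on ball 0 1" and a: "0 < a" "a < 1" 
    and bd: "\<And>z. norm z < 1 \<Longrightarrow> norm (deriv c z) \<le> C * (1 - norm z) powr (a - 1)"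
  obtains g C' where "continuous_on (cball 0 1) g" "\<And>z. norm z < 1 \<Longrightarrow> g z = c z"
    "\<And>x y. norm x \<le> 1 \<Longrightarrow> norm y \<le> 1 \<Longrightarrow> norm (g x - g y) \<le> C' * norm (x - y) powr a"
proof -
  define C' where "C' = 2 * C / a + C"
  have C: "0 \<le> C" using order_trans[OF norm_ge_zero bd[of 0]] by simp
  have C': "0 \<le> C'" using C a by (simp add: C'_def)
  have H: "norm (c z - c w) \<le> C' * norm (z - w) powr a" if "norm z < 1" "norm w < 1" for z w
    unfolding C'_def using hardy_littlewood_interior[OF hol a bd] that by blast
  have "uniformly_continuous_on (ball 0 1) c"
    unfolding uniformly_continuous_on_def
  proof (intro allI impI)
    fix e :: real assume e: "0 < e"
    define d where "d = (e / (C' + 1)) powr (1 / a)"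
    have d: "0 < d" using e C' by (simp add: d_def)
    have "dist (c w) (c z) < e" if "z \<in> ball 0 1" "w \<in> ball 0 1" "dist w z < d" for z w
    proof -
      have "norm (c w - c z) \<le> C' * norm (w - z) powr a" using H that by auto
      also have "\<dots> \<le> C' * d powr a" using that C' a
        by (intro mult_left_mono powr_mono2) (auto simp: dist_norm)
      also have "d powr a = e / (C' + 1)" using e C' a by (simp add: d_def powr_powr)
      also have "C' * (e / (C' + 1)) < e" using e C' by (simp add: field_simps)
      finally show ?thesis by (simp add: dist_norm)
    qed
    then show "\<exists>d>0. \<forall>x\<in>ball 0 1. \<forall>x'\<in>ball 0 1. dist x' x < d \<longrightarrow> dist (c x') (c x) < e"
      using d by blast
  qed
  then obtain g where g: "uniformly_continuous_on (closure (ball 0 1)) g" "\<And>x. x \<in> ball 0 1 \<Longrightarrow> c x = g x"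
    using uniformly_continuous_on_extension_on_closure by metis
  have cg: "continuous_on (cball 0 1) g" using uniformly_continuous_imp_continuous[OF g(1)] by simp
  have seq: "(\<lambda>n. g (of_real (1 - inverse (real (Suc n))) * x)) \<longlonglongrightarrow> g x" 
    "\<And>n. norm (of_real (1 - inverse (real (Suc n))) * x) < 1"
    "(\<lambda>n. of_real (1 - inverse (real (Suc n))) * x) \<longlonglongrightarrow> x"
    if "norm x \<le> 1" for x
  proof -
    show 1: "(\<lambda>n. of_real (1 - inverse (real (Suc n))) * x) \<longlonglongrightarrow> x"
      by (rule tendsto_eq_intros tendsto_of_real LIMSEQ_inverse_real_of_nat refl | simp)+
    show 2: "norm (of_real (1 - inverse (real (Suc n))) * x) < 1" for n
    proof -
      define m where "m = 1 - inverse (real (Suc n))"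
      have m: "0 \<le> m" "m < 1" by (auto simp: m_def field_simps)
      have "m * norm x \<le> m * 1" using that m by (intro mult_left_mono) auto
      then have "norm (of_real m * x) < 1" using m by (simp add: norm_mult)
      then show ?thesis by (simp only: m_def)
    qed
    show "(\<lambda>n. g (of_real (1 - inverse (real (Suc n))) * x)) \<longlonglongrightarrow> g x"
    proof (rule continuous_on_tendsto_compose[OF cg 1])
      show "\<forall>\<^sub>F n in sequentially. of_real (1 - inverse (real (Suc n))) * x \<in> cball 0 1"
        by (intro always_eventually allI) (simp only: mem_cball_0 less_imp_le[OF 2])
    qed (use that in auto)
  qed
  have "norm (g x - g y) \<le> C' * norm (x - y) powr a" if x: "norm x \<le> 1" and y: "norm y \<le> 1" for x y
  proof (rule LIMSEQ_le)
    let ?s = "\<lambda>n x. of_real (1 - inverse (real (Suc n))) * x :: complex"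
    show "(\<lambda>n. norm (g (?s n x) - g (?s n y))) \<longlonglongrightarrow> norm (g x - g y)"
      by (intro tendsto_intros seq x y)
    have "(\<lambda>n. norm (?s n x - ?s n y)) \<longlonglongrightarrow> norm (x - y)"
      by (intro tendsto_intros seq x y)
    then show "(\<lambda>n. C' * norm (?s n x - ?s n y) powr a) \<longlonglongrightarrow> C' * norm (x - y) powr a"
      by (intro tendsto_mult tendsto_const tendsto_powr'[OF _ tendsto_const]) (use a in auto)
    show "\<exists>N. \<forall>n\<ge>N. norm (g (?s n x) - g (?s n y)) \<le> C' * norm (?s n x - ?s n y) powr a"
      using H seq(2)[OF x] seq(2)[OF y] g(2) by auto
  qed
  then show ?thesis using that[of g C'] cg g(2) by auto
qed

subsection \<open>Weak convergence on the circle\<close>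

text \<open>Only values on the circle matter, where conjugation is inversion, so Laurent polynomials
  are closed under conjugation and products.\<close>

definition trig_poly :: "(complex \<Rightarrow> complex) \<Rightarrow> bool" where
  "trig_poly E \<longleftrightarrow> (\<exists>(A::int set) a. finite A \<and> (\<forall>s\<in>sphere 0 1. E s = (\<Sum>k\<in>A. a k * s powi k)))"

lemma trig_poly_monom: "trig_poly (\<lambda>s. c * s powi k)"
  unfolding trig_poly_def by (rule exI[of _ "{k}"], rule exI[of _ "\<lambda>_. c"]) auto

lemma trig_poly_const: "trig_poly (\<lambda>s. c)"
  using trig_poly_monom[of c 0] by simp

lemma trig_poly_cong: "(\<And>s. norm s = 1 \<Longrightarrow> E s = F s) \<Longrightarrow> trig_poly E \<longleftrightarrow> trig_poly F"
  unfolding trig_poly_def by simp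

lemma trig_poly_add:
  assumes "trig_poly E" "trig_poly F" shows "trig_poly (\<lambda>s. E s + F s)"
proof -
  obtain A a where A: "finite A" "\<And>s. norm s = 1 \<Longrightarrow> E s = (\<Sum>k\<in>A. a k * s powi k)"
    using assms(1) unfolding trig_poly_def by auto
  obtain B b where B: "finite B" "\<And>s. norm s = 1 \<Longrightarrow> F s = (\<Sum>k\<in>B. b k * s powi k)"
    using assms(2) unfolding trig_poly_def by auto
  have "E s + F s = (\<Sum>k\<in>A\<union>B. ((if k \<in> A then a k else 0) + (if k \<in> B then b k else 0)) * s powi k)"
    if "norm s = 1" for s
  proof -
    have "(\<Sum>k\<in>A\<union>B. (if k \<in> A then a k else 0) * s powi k) = (\<Sum>k\<in>A. a k * s powi k)"
      using A B by (intro sum.mono_neutral_cong_right) auto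
    moreover have "(\<Sum>k\<in>A\<union>B. (if k \<in> B then b k else 0) * s powi k) = (\<Sum>k\<in>B. b k * s powi k)"
      using A B by (intro sum.mono_neutral_cong_right) auto
    ultimately show ?thesis using A(2)[OF that] B(2)[OF that] by (simp add: distrib_right sum.distrib)
  qed
  then show ?thesis unfolding trig_poly_def using A B
    by (intro exI[of _ "A \<union> B"] exI[of _ "\<lambda>k. (if k \<in> A then a k else 0) + (if k \<in> B then b k else 0)"]) auto
qed

lemma trig_poly_monom_mult:
  assumes "trig_poly E" shows "trig_poly (\<lambda>s. c * s powi k * E s)"
proof -
  obtain A a where A: "finite A" "\<And>s. norm s = 1 \<Longrightarrow> E s = (\<Sum>k\<in>A. a k * s powi k)"
    using assms(1) unfolding trig_poly_def by auto
  have "c * s powi k * E s = (\<Sum>j\<in>(+) k ` A. c * a (j - k) * s powi j)" if "norm s = 1" for s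
  proof -
    have "s \<noteq> 0" using that by auto
    then have "c * s powi k * E s = (\<Sum>j\<in>A. c * a j * s powi (k + j))"
      unfolding A(2)[OF that] sum_distrib_left by (intro sum.cong) (auto simp: power_int_add)
    then show ?thesis by (subst sum.reindex) auto
  qed
  then show ?thesis unfolding trig_poly_def using A(1) 
    by (intro exI[of _ "(+) k ` A"] exI[of _ "\<lambda>j. c * a (j - k)"]) auto
qed

lemma trig_poly_sum:
  "finite A \<Longrightarrow> (\<And>k. k \<in> A \<Longrightarrow> trig_poly (E k)) \<Longrightarrow> trig_poly (\<lambda>s. \<Sum>k\<in>A. E k s)"
  by (induction A rule: finite_induct) (auto intro: trig_poly_const trig_poly_add)

lemma trig_poly_mult:
  assumes "trig_poly E" "trig_poly F" shows "trig_poly (\<lambda>s. E s * F s)"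
proof -
  obtain A a where A: "finite A" "\<And>s. norm s = 1 \<Longrightarrow> E s = (\<Sum>k\<in>A. a k * s powi k)"
    using assms(1) unfolding trig_poly_def by auto
  have "trig_poly (\<lambda>s. \<Sum>k\<in>A. a k * s powi k * F s)"
    by (intro trig_poly_sum A trig_poly_monom_mult assms)
  then show ?thesis using A(2) by (subst trig_poly_cong) (auto simp: sum_distrib_right)
qed

text \<open>The base case carries the idea: a real linear functional of \<open>s\<close> is a
  combination of \<open>s\<close> and \<open>cnj s\<close>, and \<open>cnj s\<close> is
  \<open>inverse s\<close> on the circle.\<close>

lemma trig_poly_of_real_polynomial:
  "real_polynomial_function q \<Longrightarrow> trig_poly (\<lambda>s. of_real (q s))"
proof (induction rule: real_polynomial_function.induct)
  case (linear L)
  interpret bounded_linear L by fact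
  have L: "of_real (L s) = of_real ((L 1 / 2)) * (s powi 1) + of_real (L 1 / 2) * (s powi (-1)) +
     ((of_real (L \<i> / 2) * (- \<i>)) * (s powi 1) + (of_real (L \<i> / 2) * \<i>) * (s powi (-1)))" if s: "norm s = 1" for s :: complex
  proof -
    have inv: "inverse s = cnj s" using s by (simp add: inverse_complex_def complex_eq_iff cmod_def)
    have "L s = L (Re s *\<^sub>R 1 + Im s *\<^sub>R \<i>)" by (rule arg_cong[of _ _ L]) (simp add: complex_eq_iff)
    also have "\<dots> = Re s * L 1 + Im s * L \<i>" by (simp only: add scaleR) simp
    finally have "L s = Re s * L 1 + Im s * L \<i>" .
    then show ?thesis by (simp add: power_int_minus inv complex_eq_iff)
  qed
  show ?case
    by (subst trig_poly_cong[OF L], assumption) (intro trig_poly_add trig_poly_monom)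
qed (auto intro: trig_poly_const trig_poly_add trig_poly_mult)

lemma trig_poly_dense:
  assumes "continuous_on (sphere 0 1) E" "0 < e"
  obtains F where "trig_poly F" "continuous_on (sphere 0 1) F" "\<And>s. norm s = 1 \<Longrightarrow> norm (E s - F s) < e"
proof -
  obtain g where g: "polynomial_function g" "\<And>s. s \<in> sphere 0 1 \<Longrightarrow> norm (E s - g s) < e"
    using Stone_Weierstrass_polynomial_function[OF compact_sphere assms] by blast
  have "real_polynomial_function (Re \<circ> g)" "real_polynomial_function (Im \<circ> g)"
    using g(1) bounded_linear_Re bounded_linear_Im unfolding polynomial_function_def by auto
  then have "trig_poly (\<lambda>s. of_real ((Re \<circ> g) s) + \<i> * s powi 0 * of_real ((Im \<circ> g) s))"
    by (intro trig_poly_add trig_poly_monom_mult trig_poly_of_real_polynomial)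
  moreover have "of_real ((Re \<circ> g) s) + \<i> * s powi 0 * of_real ((Im \<circ> g) s) = g s" for s
    by (simp add: complex_eq_iff)
  ultimately have "trig_poly g" by simp
  then show ?thesis using that[of g] g continuous_on_polymonial_function by auto
qed

text \<open>Nonnegative moments determine the negative ones by conjugation, since
  \<open>h n t\<close> lies on the circle and \<open>p\<close> is real. Density of trigonometric
  polynomials does the rest, as in Weyl's criterion.\<close>

lemma avg_weak_limit:
  fixes h :: "nat \<Rightarrow> real \<Rightarrow> complex" and p :: "complex \<Rightarrow> real" and E :: "complex \<Rightarrow> complex"
  assumes ch: "\<And>n. continuous_on {0..2*pi} (h n)" and nh: "\<And>n t. t \<in> {0..2*pi} \<Longrightarrow> norm (h n t) = 1"
    and cp: "continuous_on (sphere 0 1) p"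
    and mom: "\<And>k. (\<lambda>n. avg (\<lambda>t. h n t ^ k)) \<longlonglongrightarrow> avg (\<lambda>t. cis t ^ k * of_real (p (cis t)))"
    and cE: "continuous_on (sphere 0 1) E"
  shows "(\<lambda>n. avg (\<lambda>t. E (h n t))) \<longlonglongrightarrow> avg (\<lambda>t. E (cis t) * of_real (p (cis t)))"
proof -
  have cc: "continuous_on {0..2*pi} (\<lambda>t. E (h n t))" if "continuous_on (sphere 0 1) E" for n and E :: "complex \<Rightarrow> complex"
    by (rule continuous_on_compose2[OF that ch]) (use nh in auto)
  have ccp: "continuous_on {0..2*pi} (\<lambda>t. E (cis t) * of_real (p (cis t)))" if "continuous_on (sphere 0 1) E" for E :: "complex \<Rightarrow> complex"
    using that cp by (auto intro!: continuous_intros continuous_on_circle)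
  have inv: "cnj s = inverse s" if "norm s = 1" for s :: complex
    using that by (simp add: inverse_complex_def complex_eq_iff cmod_def)
  have ppow: "(\<lambda>n. avg (\<lambda>t. h n t powi k)) \<longlonglongrightarrow> avg (\<lambda>t. cis t powi k * of_real (p (cis t)))" for k
  proof (cases "0 \<le> k")
    case True then show ?thesis using mom[of "nat k"] by (simp add: power_int_def)
  next
    case False
    define m where "m = nat (- k)"
    have "(\<lambda>n. cnj (avg (\<lambda>t. h n t ^ m))) \<longlonglongrightarrow> cnj (avg (\<lambda>t. cis t ^ m * of_real (p (cis t))))"
      using mom[of m] by (intro tendsto_intros)
    moreover have "cnj (avg (\<lambda>t. h n t ^ m)) = avg (\<lambda>t. h n t powi k)" for n
      using False inv nh ch
      by (subst avg_cnj) (auto intro!: continuous_intros avg_cong simp: power_int_def m_def power_inverse)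
    moreover have "cnj (avg (\<lambda>t. cis t ^ m * of_real (p (cis t)))) = avg (\<lambda>t. cis t powi k * of_real (p (cis t)))"
      using False inv[of "cis _"]
      by (subst avg_cnj[OF ccp[of "\<lambda>s. s ^ m"]])
        (auto intro!: continuous_intros avg_cong simp: power_int_def m_def power_inverse)
    ultimately show ?thesis by simp
  qed
  have tp: "(\<lambda>n. avg (\<lambda>t. F (h n t))) \<longlonglongrightarrow> avg (\<lambda>t. F (cis t) * of_real (p (cis t)))" if tF: "trig_poly F" for F
  proof -
    obtain A a where A: "finite A" "\<And>s. norm s = 1 \<Longrightarrow> F s = (\<Sum>k\<in>A. a k * s powi k)"
      using tF unfolding trig_poly_def by auto
    have cpi: "continuous_on (sphere 0 1) (\<lambda>s::complex. s powi k)" for k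
      by (auto intro!: continuous_intros)
    have 1: "avg (\<lambda>t. F (h n t)) = (\<Sum>k\<in>A. a k * avg (\<lambda>t. h n t powi k))" for n
    proof -
      have "avg (\<lambda>t. F (h n t)) = avg (\<lambda>t. \<Sum>k\<in>A. a k * h n t powi k)"
        using A(2) nh by (intro avg_cong) auto
      also have "\<dots> = (\<Sum>k\<in>A. a k * avg (\<lambda>t. h n t powi k))"
        using A(1) by (subst avg_sum) (auto intro!: continuous_on_mult continuous_on_const cc[OF cpi] simp: avg_mult_right)
      finally show ?thesis .
    qed
    have 2: "avg (\<lambda>t. F (cis t) * of_real (p (cis t))) = (\<Sum>k\<in>A. a k * avg (\<lambda>t. cis t powi k * of_real (p (cis t))))"
    proof -
      have "avg (\<lambda>t. F (cis t) * of_real (p (cis t))) = avg (\<lambda>t. \<Sum>k\<in>A. a k * (cis t powi k * of_real (p (cis t))))"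
        using A(2) by (intro avg_cong) (auto simp: sum_distrib_right mult.assoc)
      also have "\<dots> = (\<Sum>k\<in>A. a k * avg (\<lambda>t. cis t powi k * of_real (p (cis t))))"
        using A(1) by (subst avg_sum) (auto intro!: continuous_on_mult[OF continuous_on_const] ccp[OF cpi] simp: avg_mult_right)
      finally show ?thesis .
    qed
    show ?thesis unfolding 1 2 by (intro tendsto_intros ppow)
  qed
  obtain B where "\<forall>s\<in>sphere 0 1. \<bar>p s\<bar> \<le> B"
    using compact_imp_bounded[OF compact_continuous_image[OF cp compact_sphere]]
    unfolding bounded_iff by (auto simp: image_iff)
  then have B: "\<bar>p s\<bar> \<le> B" if "norm s = 1" for s
    using that by simp
  have B0: "0 \<le> B" using B[of 1] by simp
  show ?thesis
    unfolding LIMSEQ_def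
  proof (intro allI impI)
    fix e :: real assume e: "0 < e"
    \<comment> \<open>Three errors are summed: replacing \<open>E\<close> by \<open>F\<close> before
      and after the limit, and the convergence for \<open>F\<close>. The second one is multiplied by
      the bound \<open>B\<close> of \<open>p\<close>; the \<open>+ 1\<close> protects against
      \<open>B = 0\<close>.\<close>
    define e' where "e' = e / (3 * (B + 1))"
    have e': "0 < e'" using e B0 by (simp add: e'_def)
    obtain F where F: "trig_poly F" "continuous_on (sphere 0 1) F" "\<And>s. norm s = 1 \<Longrightarrow> norm (E s - F s) < e'"
      using trig_poly_dense[OF cE e'] by blast
    obtain N where N: "\<And>n. n \<ge> N \<Longrightarrow> dist (avg (\<lambda>t. F (h n t))) (avg (\<lambda>t. F (cis t) * of_real (p (cis t)))) < e / 3"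
      using tp[OF F(1)] e unfolding LIMSEQ_def by (meson divide_pos_pos zero_less_numeral)
    have e'1: "e' \<le> e / 3" "e' * B < e / 3" using e B0 by (auto simp: e'_def field_simps)
    have 1: "norm (avg (\<lambda>t. E (h n t)) - avg (\<lambda>t. F (h n t))) \<le> e'" for n
      by (subst avg_diff[symmetric, OF cc[OF cE] cc[OF F(2)]], rule norm_avg_le_const)
        (use F(3) nh in \<open>auto intro!: continuous_on_diff cc cE F(2) less_imp_le[OF F(3)]\<close>)
    have 2: "norm (avg (\<lambda>t. E (cis t) * of_real (p (cis t))) - avg (\<lambda>t. F (cis t) * of_real (p (cis t)))) \<le> e' * B"
    proof (subst avg_diff[symmetric])
      show "norm (avg (\<lambda>t. E (cis t) * of_real (p (cis t)) - F (cis t) * of_real (p (cis t)))) \<le> e' * B"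
      proof (rule norm_avg_le_const)
        show "norm (E (cis t) * of_real (p (cis t)) - F (cis t) * of_real (p (cis t))) \<le> e' * B" for t
          using F(3)[of "cis t"] B[of "cis t"] e'
          unfolding left_diff_distrib[symmetric] norm_mult by (intro mult_mono) auto
      qed (intro continuous_intros ccp cE F)
    qed (intro ccp cE F)+
    have "dist (avg (\<lambda>t. E (h n t))) (avg (\<lambda>t. E (cis t) * of_real (p (cis t)))) < e" if "n \<ge> N" for n
    proof -
      have t: "norm (x - w) \<le> norm (x - y) + norm (y - z) + norm (w - z)" for x y z w :: complex
        by norm
      show ?thesis
        using 1[of n] 2 N[OF that] e'1 unfolding dist_norm
        using t[of "avg (\<lambda>t. E (h n t))" "avg (\<lambda>t. E (cis t) * of_real (p (cis t)))" "avg (\<lambda>t. F (h n t))" "avg (\<lambda>t. F (cis t) * of_real (p (cis t)))"]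
        by linarith
    qed
    then show "\<exists>no. \<forall>n\<ge>no. dist (avg (\<lambda>t. E (h n t))) (avg (\<lambda>t. E (cis t) * of_real (p (cis t)))) < e" by blast
  qed
qed

subsection \<open>Disc maps with Hoelder continuous boundary derivative\<close>

text \<open>The chord controls the angle. Where \<open>Re q\<close> is at least \<open>1/2\<close>,
  \<open>Ln\<close> is Lipschitz with constant 2; elsewhere the chord is at least \<open>1/2\<close>
  and the trivial bound \<open>pi\<close> for the angle suffices, which fixes the constant.\<close>

lemma abs_Arg_le:
  assumes "norm q = 1"
  shows "\<bar>Arg q\<bar> \<le> 2 * pi * norm (q - 1)"
proof (cases "1/2 \<le> Re q")
  case True
  have q0: "q \<noteq> 0" using assms by auto
  have "norm (Ln q - Ln 1) \<le> 2 * norm (q - 1)"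
  proof (rule field_differentiable_bound[of "{z. 1/2 \<le> Re z}" Ln "\<lambda>z. inverse z"])
    show "convex {z. 1/2 \<le> Re z}" by (rule convex_halfspace_Re_ge)
    fix z assume z: "z \<in> {z. 1/2 \<le> Re z}"
    then have "z \<notin> \<real>\<^sub>\<le>\<^sub>0" by (auto simp: complex_nonpos_Reals_iff)
    then show "(Ln has_field_derivative inverse z) (at z within {z. 1/2 \<le> Re z})"
      by (rule has_field_derivative_at_within[OF has_field_derivative_Ln])
    have "1/2 \<le> norm z" using z complex_Re_le_cmod[of z] by simp
    then show "norm (inverse z) \<le> 2" using le_imp_inverse_le[of "1/2" "norm z"] by (simp add: norm_inverse)
  qed (use True in auto)
  moreover have "\<bar>Arg q\<bar> \<le> norm (Ln q)" using abs_Im_le_cmod[of "Ln q"] q0 by (simp add: Arg_eq_Im_Ln)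
  moreover have "2 * norm (q - 1) \<le> 2 * pi * norm (q - 1)"
    using pi_gt3 by (intro mult_right_mono) auto
  ultimately show ?thesis by simp
next
  case False
  have "1/2 \<le> norm (q - 1)" using abs_Re_le_cmod[of "q - 1"] False by simp
  then have "pi * 1 \<le> 2 * pi * norm (q - 1)" by simp
  moreover have "\<bar>Arg q\<bar> \<le> pi" using mpi_less_Arg[of q] Arg_le_pi[of q] by linarith
  ultimately show ?thesis by linarith
qed

text \<open>Strict convexity of the disc. A chord between two boundary points runs through the open
  disc, so \<open>f\<close> can be differentiated along it even though it need not be differentiable
  across the circle.\<close>

lemma norm_convex_combination_less_1:
  fixes z w :: complex
  assumes "norm z \<le> 1" "norm w \<le> 1" "z \<noteq> w" "0 < t" "t < 1"
  shows "norm (z + of_real t * (w - z)) < 1"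
proof -
  have "(norm (z + of_real t * (w - z)))\<^sup>2 = (1 - t) * (norm z)\<^sup>2 + t * (norm w)\<^sup>2 - t * (1 - t) * (norm (z - w))\<^sup>2"
    unfolding cmod_power2 by (simp add: power2_eq_square algebra_simps)
  also have "\<dots> < (1 - t) * 1 + t * 1"
  proof -
    have "(1 - t) * (norm z)\<^sup>2 \<le> (1 - t) * 1" "t * (norm w)\<^sup>2 \<le> t * 1"
      using assms by (auto intro!: mult_left_mono simp: power_le_one)
    moreover have "0 < t * (1 - t) * (norm (z - w))\<^sup>2" using assms by simp
    ultimately show ?thesis by linarith
  qed
  finally show ?thesis using abs_square_less_1[of "norm (z + of_real t * (w - z))"] by simp
qed

locale smooth_disc_map =
  fixes a :: real and f :: "complex \<Rightarrow> complex"
  assumes a: "0 < a" "a < 1" and smooth: "S1alpha a f"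
begin

text \<open>Beyond the closed disc \<open>f\<close> is arbitrary, so \<open>deriv f\<close> is
  meaningless on the circle and its limit from inside takes its place.\<close>

definition f1 :: "complex \<Rightarrow> complex" where
  "f1 z = (if norm z < 1 then deriv f z else bderiv f z)"

lemma hol_f: "f holomorphic_on ball 0 1" and inj_f: "inj_on f (cball 0 1)" and f_0: "f 0 = 0"
  and cont_f: "continuous_on (cball 0 1) f"
  using smooth unfolding S1alpha_def by auto

lemma hol_f1: "f1 holomorphic_on ball 0 1"
  by (rule holomorphic_transform[OF holomorphic_deriv[OF hol_f open_ball]]) (auto simp: f1_def)

lemma f1_tendsto:
  assumes z: "norm z \<le> 1"
  shows "(f1 \<longlongrightarrow> f1 z) (at z within ball 0 1)"
proof (cases "norm z < 1")
  case True
  have "continuous_on (ball 0 1) f1" by (rule holomorphic_on_imp_continuous_on[OF hol_f1])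
  then show ?thesis using True unfolding continuous_on_def by auto
next
  case False
  then have "z \<in> sphere 0 1" using z by simp
  then have *: "(deriv f \<longlongrightarrow> bderiv f z) (at z within ball 0 1)"
    using smooth unfolding S1alpha_def by auto
  have "(f1 \<longlongrightarrow> bderiv f z) (at z within ball 0 1)"
    by (rule Lim_transform_eventually[OF *]) (auto simp: f1_def eventually_at_filter)
  then show ?thesis using False by (simp add: f1_def)
qed

text \<open>The boundary limits are taken from the open disc only; the value at another boundary
  point \<open>y\<close> is reached through an interior point that is close to both \<open>y\<close>
  and \<open>z\<close>.\<close>

lemma cont_f1: "continuous_on (cball 0 1) f1"
  unfolding continuous_on_iff
proof (intro ballI allI impI)
  fix z :: complex and e :: real assume z: "z \<in> cball 0 1" and e: "0 < e"
  have near: "\<exists>d>0. \<forall>y\<in>ball 0 1. dist y z < d \<longrightarrow> dist (f1 y) (f1 z) < e / 2" if "z \<in> cball 0 1" "0 < e" for z e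
  proof -
    have "\<forall>\<^sub>F y in at z within ball 0 1. dist (f1 y) (f1 z) < e / 2"
      using tendstoD[OF f1_tendsto[of z], of "e/2"] that by simp
    then obtain d where d: "d > 0" "\<forall>y\<in>ball 0 1. y \<noteq> z \<and> dist y z < d \<longrightarrow> dist (f1 y) (f1 z) < e/2"
      unfolding eventually_at by blast
    have "dist (f1 y) (f1 z) < e / 2" if "y \<in> ball 0 1" "dist y z < d" for y
      using d(2) that \<open>0 < e\<close> by (cases "y = z") auto
    then show ?thesis using d(1) by blast
  qed
  obtain d where d: "d > 0" "\<And>y. y \<in> ball 0 1 \<Longrightarrow> dist y z < d \<Longrightarrow> dist (f1 y) (f1 z) < e / 2"
    using near[OF z e] by blast
  have "dist (f1 y) (f1 z) < e" if y: "y \<in> cball 0 1" "dist y z < d" for y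
  proof -
    obtain d' where d': "d' > 0" "\<And>x. x \<in> ball 0 1 \<Longrightarrow> dist x y < d' \<Longrightarrow> dist (f1 x) (f1 y) < e / 2"
      using near[OF y(1) e] by blast
    have "y \<in> closure (ball 0 1)" using y by simp
    then obtain x where x: "x \<in> ball 0 1" "dist x y < min d' (d - dist y z)"
      using y(2) d'(1) unfolding closure_approachable by (metis diff_gt_0_iff_gt min_less_iff_conj)
    have "dist x z < d" using x(2) dist_triangle[of x z y] by simp
    then have "dist (f1 x) (f1 z) < e / 2" using d x by blast
    moreover have "dist (f1 x) (f1 y) < e / 2" using d' x by auto
    ultimately show ?thesis using dist_triangle2[of "f1 y" "f1 z" "f1 x"] by (simp add: dist_commute)
  qed
  then show "\<exists>d>0. \<forall>x'\<in>cball 0 1. dist x' z < d \<longrightarrow> dist (f1 x') (f1 z) < e"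
    using d(1) by blast
qed

lemma f1_nonzero:
  assumes "norm z \<le> 1" shows "f1 z \<noteq> 0"
proof (cases "norm z < 1")
  case True
  then show ?thesis
    using holomorphic_injective_imp_regular[OF hol_f open_ball inj_on_subset[OF inj_f ball_subset_cball], of z]
    by (simp add: f1_def)
next
  case False
  then have "z \<in> sphere 0 1" using assms by simp
  then show ?thesis using False smooth unfolding S1alpha_def f1_def by auto
qed

text \<open>The mean value inequality for \<open>f y - c * y\<close> along the chord. The constant
  \<open>c\<close> is left free: \<open>c = 0\<close> gives Lipschitz bounds, the value of
  \<open>f1\<close> at the base point gives differentiability and linearisation errors.\<close>

lemma linear_approx:
  assumes z: "norm z \<le> 1" and w: "norm w \<le> 1"
    and B: "\<And>y. norm y \<le> 1 \<Longrightarrow> norm (y - z) \<le> norm (w - z) \<Longrightarrow> norm (f1 y - c) \<le> B"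
  shows "norm (f w - f z - c * (w - z)) \<le> B * norm (w - z)"
proof (cases "z = w")
  case False
  define p where "p = (\<lambda>t. z + of_real t * (w - z))"
  have p: "norm (p t) < 1" if "0 < t" "t < 1" for t
    unfolding p_def by (rule norm_convex_combination_less_1[OF z w False that])
  have p': "norm (p t) \<le> 1" if "0 \<le> t" "t \<le> 1" for t
    using p[of t] z w that by (cases "t = 0"; cases "t = 1") (auto simp: p_def)
  have "norm ((\<lambda>t. f (p t) - c * p t) 1 - (\<lambda>t. f (p t) - c * p t) 0) \<le> (\<lambda>t. B * norm (w - z) * t) 1 - (\<lambda>t. B * norm (w - z) * t) 0"
  proof (rule differentiable_bound_general)
    have cp: "continuous_on A p" for A unfolding p_def by (intro continuous_intros)
    show "continuous_on {0..1} (\<lambda>t. f (p t) - c * p t)"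
      by (intro continuous_intros cp continuous_on_compose2[OF cont_f cp]) (use p' in auto)
    show "continuous_on {0..1} (\<lambda>t. B * norm (w - z) * t)" by (intro continuous_intros)
    fix t :: real assume t: "0 < t" "t < 1"
    have "(f has_field_derivative f1 (p t)) (at (p t))"
      using holomorphic_derivI[OF hol_f open_ball, of "p t"] p[OF t] by (simp add: f1_def)
    then have "((\<lambda>y. f (z + y * (w - z)) - c * (z + y * (w - z))) has_field_derivative (f1 (p t) * (w - z) - c * (w - z))) (at (of_real t))"
      unfolding p_def by (auto intro!: derivative_eq_intros DERIV_chain2[of f])
    then have "((\<lambda>t. f (p t) - c * p t) has_vector_derivative (f1 (p t) * (w - z) - c * (w - z))) (at t)"
      unfolding p_def by (rule has_vector_derivative_real_field)
    then show "((\<lambda>t. f (p t) - c * p t) has_vector_derivative ((f1 (p t) - c) * (w - z))) (at t)"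
      by (simp add: left_diff_distrib)
    show "((\<lambda>t. B * norm (w - z) * t) has_vector_derivative B * norm (w - z)) (at t)"
      unfolding has_real_derivative_iff_has_vector_derivative[symmetric]
      by (auto intro!: derivative_eq_intros)
    have "norm (p t - z) \<le> norm (w - z)"
      using t mult_right_mono[of t 1 "norm (w - z)"] by (simp add: p_def norm_mult)
    then have "norm (f1 (p t) - c) \<le> B" using B p[OF t] by simp
    then show "norm ((f1 (p t) - c) * (w - z)) \<le> B * norm (w - z)"
      by (simp add: norm_mult mult_right_mono)
  qed simp
  then show ?thesis by (simp add: p_def algebra_simps)
qed simp

lemma f1_unif:
  assumes "0 < e"
  obtains d where "0 < d" "\<And>y z. norm y \<le> 1 \<Longrightarrow> norm z \<le> 1 \<Longrightarrow> norm (y - z) < d \<Longrightarrow> norm (f1 y - f1 z) < e"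
  using compact_uniformly_continuous[OF cont_f1 compact_cball] assms
  unfolding uniformly_continuous_on_def dist_norm by (metis mem_cball_0)

lemma has_derivative_f:
  assumes z: "norm z \<le> 1"
  shows "(f has_field_derivative f1 z) (at z within cball 0 1)"
  unfolding has_field_derivative_def has_derivative_within_alt
proof (intro conjI allI impI)
  show "bounded_linear ((*) (f1 z))" by (rule bounded_linear_mult_right)
  fix e :: real assume e: "0 < e"
  obtain d where d: "0 < d" "\<And>y z. norm y \<le> 1 \<Longrightarrow> norm z \<le> 1 \<Longrightarrow> norm (y - z) < d \<Longrightarrow> norm (f1 y - f1 z) < e"
    using f1_unif[OF e] by blast
  have "norm (f y - f z - f1 z * (y - z)) \<le> e * norm (y - z)" if "y \<in> cball 0 1" "norm (y - z) < d" for y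
    by (rule linear_approx) (use that z d in \<open>auto intro!: less_imp_le[OF d(2)]\<close>)
  then show "\<exists>d>0. \<forall>y\<in>cball 0 1. norm (y - z) < d \<longrightarrow> norm (f y - f z - f1 z * (y - z)) \<le> e * norm (y - z)"
    using d(1) by blast
qed

lemma f1_bounded:
  obtains M where "1 \<le> M" "\<And>z. norm z \<le> 1 \<Longrightarrow> norm (f1 z) \<le> M"
    "\<And>z w. norm z \<le> 1 \<Longrightarrow> norm w \<le> 1 \<Longrightarrow> norm (f z - f w) \<le> M * norm (z - w)"
proof -
  obtain M where M: "\<forall>z\<in>cball 0 1. norm (f1 z) \<le> M"
    using compact_imp_bounded[OF compact_continuous_image[OF cont_f1 compact_cball]]
    unfolding bounded_iff by (auto simp: image_iff)
  have "norm (f z - f w) \<le> max 1 M * norm (z - w)" if "norm z \<le> 1" "norm w \<le> 1" for z w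
    using linear_approx[of w z 0 "max 1 M"] that M by (simp add: le_max_iff_disj)
  then show ?thesis using that[of "max 1 M"] M by (simp add: le_max_iff_disj)
qed

text \<open>\<open>S1alpha\<close> speaks of the derivative with respect to the angle, which is
  \<open>\<i> * s * f1 s\<close>. Angles are bounded by chords, and removing the factor
  \<open>s\<close> costs a Lipschitz term.\<close>

lemma f1_holder_sphere:
  obtains C where "0 \<le> C" "\<And>s y. norm s = 1 \<Longrightarrow> norm y = 1 \<Longrightarrow> norm (f1 y - f1 s) \<le> C * norm (y - s) powr a"
proof -
  obtain g C where g: "\<And>t. ((\<lambda>t. f (cis t)) has_vector_derivative g t) (at t)"
     and C: "\<And>x y. norm (g x - g y) \<le> C * dist x y powr a"
    using smooth unfolding S1alpha_def holder_on_def by auto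
  have g_eq: "g t = \<i> * cis t * f1 (cis t)" for t
  proof -
    have "((\<lambda>t. f (cis t)) has_vector_derivative (cis t * \<i> * f1 (cis t))) (at t)"
    proof -
      have "(cis has_vector_derivative (cis t * \<i>)) (at t)"
      proof -
        have "((\<lambda>z. exp (\<i> * z)) has_field_derivative (exp (\<i> * of_real t) * \<i>)) (at (of_real t))"
          by (auto intro!: derivative_eq_intros)
        from has_vector_derivative_real_field[OF this]
        have "((\<lambda>x. exp (\<i> * of_real x)) has_vector_derivative (exp (\<i> * of_real t) * \<i>)) (at t)" .
        then show ?thesis unfolding cis_conv_exp[symmetric] .
      qed
      moreover have "(f has_field_derivative f1 (cis t)) (at (cis t) within range cis)"
        by (rule has_field_derivative_subset[OF has_derivative_f]) auto
      ultimately show ?thesis using field_vector_diff_chain_within[of cis "cis t * \<i>" t UNIV f "f1 (cis t)"]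
        by (simp add: o_def)
    qed
    from vector_derivative_unique_at[OF g this] show ?thesis by (simp add: mult_ac)
  qed
  have C0: "0 \<le> C" using order_trans[OF norm_ge_zero C[of 1 0]] by simp
  obtain M where M: "1 \<le> M" "\<And>z. norm z \<le> 1 \<Longrightarrow> norm (f1 z) \<le> M"
    "\<And>z w. norm z \<le> 1 \<Longrightarrow> norm w \<le> 1 \<Longrightarrow> norm (f z - f w) \<le> M * norm (z - w)" by (rule f1_bounded) blast
  have "norm (f1 y - f1 s) \<le> (C * (2 * pi) powr a + 2 * M) * norm (y - s) powr a" if s: "norm s = 1" and y: "norm y = 1" for s y
  proof -
    define t \<theta> where "t = Arg s" and "\<theta> = Arg (y / s)"
    have s0: "s \<noteq> 0" and y0: "y \<noteq> 0" using s y by auto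
    have s_eq: "s = cis t" unfolding t_def cis_Arg[OF s0] sgn_eq s by simp
    have "norm (y/s) = 1" using s y by (simp add: norm_divide)
    then have "y / s = cis \<theta>" using s0 y0 unfolding \<theta>_def by (subst cis_Arg) (auto simp: sgn_eq)
    then have y_eq: "y = cis (t + \<theta>)" using s0 s_eq by (simp add: field_simps cis_mult)
    have th: "\<bar>\<theta>\<bar> \<le> 2 * pi * norm (y - s)"
    proof -
      have "y / s - 1 = (y - s) / s" using s0 by (simp add: diff_divide_distrib)
      then show ?thesis using abs_Arg_le[OF \<open>norm (y/s) = 1\<close>] s by (simp add: \<theta>_def norm_divide)
    qed
    have "\<i> * y * f1 y - \<i> * s * f1 s = g (t + \<theta>) - g t" by (simp add: g_eq s_eq y_eq)
    moreover have "\<i> * s * (f1 y - f1 s) = (\<i> * y * f1 y - \<i> * s * f1 s) - \<i> * (y - s) * f1 y" by (simp add: algebra_simps)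
    ultimately have "norm (\<i> * s * (f1 y - f1 s)) \<le> norm (g (t + \<theta>) - g t) + norm (\<i> * (y - s) * f1 y)"
      using norm_triangle_ineq4 by metis
    also have "norm (\<i> * s * (f1 y - f1 s)) = norm (f1 y - f1 s)" using s by (simp add: norm_mult)
    also have "norm (g (t + \<theta>) - g t) \<le> C * (2 * pi * norm (y - s)) powr a"
    proof -
      have "\<bar>\<theta>\<bar> powr a \<le> (2 * pi * norm (y - s)) powr a" using th a by (intro powr_mono2) auto
      then have "C * \<bar>\<theta>\<bar> powr a \<le> C * (2 * pi * norm (y - s)) powr a" using C0 by (rule mult_left_mono)
      then show ?thesis using C[of "t + \<theta>" t] by (simp add: dist_real_def)
    qed
    also have "\<dots> = C * (2 * pi) powr a * norm (y - s) powr a" by (simp add: powr_mult)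
    also have "norm (\<i> * (y - s) * f1 y) \<le> 2 * M * norm (y - s) powr a"
    proof -
      define x where "x = norm (y - s)"
      have x2: "0 \<le> x" "x \<le> 2" using norm_triangle_ineq4[of y s] s y by (auto simp: x_def)
      have "x powr (1 - a) \<le> 2 powr (1 - a)" using x2 a by (intro powr_mono2) auto
      moreover have "2 powr (1 - a) \<le> (2::real) powr 1" using a by (intro powr_mono) auto
      ultimately have "x powr a * x powr (1 - a) \<le> x powr a * 2" by (intro mult_left_mono) auto
      then have "x \<le> x powr a * 2" using x2 by (simp only: powr_add[symmetric]) simp
      then have "x * norm (f1 y) \<le> (x powr a * 2) * M" using M y x2 by (intro mult_mono) auto
      then show ?thesis by (simp add: norm_mult x_def mult_ac)
    qed
    finally show ?thesis by (simp add: algebra_simps)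
  qed
  moreover have "0 \<le> C * (2 * pi) powr a + 2 * M" using C0 M by simp
  ultimately show ?thesis using that by blast
qed

lemma f1_holder:
  obtains C where "0 \<le> C" "\<And>s y. norm s = 1 \<Longrightarrow> norm y \<le> 1 \<Longrightarrow> norm (f1 y - f1 s) \<le> C * norm (y - s) powr a"
proof -
  obtain C where C: "0 \<le> C" "\<And>s y. norm s = 1 \<Longrightarrow> norm y = 1 \<Longrightarrow> norm (f1 y - f1 s) \<le> C * norm (y - s) powr a"
    by (rule f1_holder_sphere) blast
  show ?thesis
    by (rule that[OF C(1) holder_at_boundary_point[OF cont_f1 hol_f1 _ a(2) C(1) C(2)]])
qed

text \<open>Close pairs are handled by linearisation, as \<open>f1\<close> is bounded away from 0;
  distant pairs form a compact set on which injectivity gives a positive minimum.\<close>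

lemma bilip:
  obtains c where "0 < c" "c \<le> 1" "\<And>z w. norm z \<le> 1 \<Longrightarrow> norm w \<le> 1 \<Longrightarrow> c * norm (z - w) \<le> norm (f z - f w)"
proof -
  have "\<exists>m>0. \<forall>z\<in>cball 0 1. m \<le> norm (f1 z)"
  proof -
    obtain z0 where "z0 \<in> cball 0 1" "\<forall>z\<in>cball 0 1. norm (f1 z0) \<le> norm (f1 z)"
      using continuous_attains_inf[of "cball 0 1" "\<lambda>z. norm (f1 z)"] continuous_on_norm[OF cont_f1] by auto
    then show ?thesis using f1_nonzero[of z0] by (intro exI[of _ "norm (f1 z0)"]) auto
  qed
  then obtain m where m: "0 < m" "\<And>z. norm z \<le> 1 \<Longrightarrow> m \<le> norm (f1 z)" by auto
  obtain d where d: "0 < d" "\<And>y z. norm y \<le> 1 \<Longrightarrow> norm z \<le> 1 \<Longrightarrow> norm (y - z) < d \<Longrightarrow> norm (f1 y - f1 z) < m / 2"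
    using f1_unif[of "m/2"] m by auto
  have near: "m / 2 * norm (z - w) \<le> norm (f z - f w)" if "norm z \<le> 1" "norm w \<le> 1" "norm (z - w) < d" for z w
  proof -
    have "norm (f w - f z - f1 z * (w - z)) \<le> m / 2 * norm (w - z)"
    proof (rule linear_approx)
      fix y assume y: "norm y \<le> 1" "norm (y - z) \<le> norm (w - z)"
      then have "norm (y - z) < d" using that by (simp add: norm_minus_commute)
      then show "norm (f1 y - f1 z) \<le> m / 2" using d(2)[OF y(1)] that less_imp_le by blast
    qed (use that in auto)
    moreover have "norm (f1 z * (w - z)) \<ge> m * norm (w - z)" using m that by (simp add: norm_mult mult_right_mono)
    moreover have "norm (f1 z * (w - z)) \<le> norm (f w - f z) + norm (f w - f z - f1 z * (w - z))" by norm
    ultimately show ?thesis by (simp add: norm_minus_commute)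
  qed
  define T :: "(complex \<times> complex) set"
    where "T = (cball 0 1 \<times> cball 0 1) \<inter> {p. d \<le> norm (fst p - snd p)}"
  have "compact T" unfolding T_def
    by (intro compact_Int_closed compact_Times compact_cball closed_Collect_le continuous_intros)
  have "\<exists>m'>0. \<forall>p\<in>T. m' \<le> norm (f (fst p) - f (snd p))"
  proof (cases "T = {}")
    case True then show ?thesis by (auto intro: exI[of _ 1])
  next
    case False
    have "continuous_on T (\<lambda>p. norm (f (fst p) - f (snd p)))"
      by (intro continuous_intros continuous_on_compose2[OF cont_f]) (auto simp: T_def)
    then obtain p where p: "p \<in> T" "\<forall>q\<in>T. norm (f (fst p) - f (snd p)) \<le> norm (f (fst q) - f (snd q))"
      using continuous_attains_inf[OF \<open>compact T\<close> False] by blast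
    have "fst p \<noteq> snd p" using p(1) d(1) by (auto simp: T_def)
    then have "f (fst p) \<noteq> f (snd p)" using p(1) inj_onD[OF inj_f, of "fst p" "snd p"] by (auto simp: T_def)
    then show ?thesis using p(2) by (intro exI[of _ "norm (f (fst p) - f (snd p))"]) auto
  qed
  then obtain m' where m': "0 < m'" "\<And>z w. norm z \<le> 1 \<Longrightarrow> norm w \<le> 1 \<Longrightarrow> d \<le> norm (z - w) \<Longrightarrow> m' \<le> norm (f z - f w)"
    by (force simp: T_def)
  \<comment> \<open>\<open>m/2\<close> is what the linearisation error leaves of \<open>m\<close>;
    \<open>m'\<close> is halved because two points of the disc can be at distance 2.\<close>
  define c where "c = min 1 (min (m/2) (m'/2))"
  have c: "0 < c" "c \<le> 1" "c \<le> m/2" "c \<le> m'/2" using m m' by (auto simp: c_def)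
  have "c * norm (z - w) \<le> norm (f z - f w)" if zw: "norm z \<le> 1" "norm w \<le> 1" for z w
  proof (cases "norm (z - w) < d")
    case True
    then show ?thesis using near[OF zw] mult_right_mono[OF c(3), of "norm (z - w)"] by simp
  next
    case False
    have "norm (z - w) \<le> 2" using norm_triangle_ineq4[of z w] zw by linarith
    then have "c * norm (z - w) \<le> m'/2 * 2" using c m' by (intro mult_mono) auto
    then show ?thesis using m'(2)[OF zw] False by linarith
  qed
  then show ?thesis using that c by blast
qed

text \<open>The factor \<open>f' z\<close> makes the singularity at \<open>s = z\<close> of the two double poles agree up to order \<open>2 - a\<close>.\<close>

lemma kernel_diff:
  obtains C where "0 \<le> C" "\<And>s z. norm s = 1 \<Longrightarrow> norm z < 1 \<Longrightarrow>
     norm (1 / (s - z)\<^sup>2 - (f1 z)\<^sup>2 / (f s - f z)\<^sup>2) \<le> C * norm (s - z) powr (a - 2)"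
proof -
  obtain C where C: "0 \<le> C" "\<And>s y. norm s = 1 \<Longrightarrow> norm y \<le> 1 \<Longrightarrow> norm (f1 y - f1 s) \<le> C * norm (y - s) powr a"
    by (rule f1_holder) blast
  obtain M where M: "1 \<le> M" "\<And>z. norm z \<le> 1 \<Longrightarrow> norm (f1 z) \<le> M"
    "\<And>z w. norm z \<le> 1 \<Longrightarrow> norm w \<le> 1 \<Longrightarrow> norm (f z - f w) \<le> M * norm (z - w)" by (rule f1_bounded) blast
  obtain c where c: "0 < c" "c \<le> 1" "\<And>z w. norm z \<le> 1 \<Longrightarrow> norm w \<le> 1 \<Longrightarrow> c * norm (z - w) \<le> norm (f z - f w)"
    by (rule bilip) blast
  have "norm (1 / (s - z)\<^sup>2 - (f1 z)\<^sup>2 / (f s - f z)\<^sup>2) \<le> (2 * C / c * (1 + M / c)) * norm (s - z) powr (a - 2)"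
    if s: "norm s = 1" and z: "norm z < 1" for s z
  proof -
    define x where "x = norm (s - z)"
    have x0: "0 < x" using s z by (auto simp: x_def)
    have sz: "s - z \<noteq> 0" using s z by auto
    have fx: "c * x \<le> norm (f s - f z)" using c(3)[of s z] s z by (simp add: x_def)
    have "0 < c * x" using c(1) x0 by simp
    then have fx0: "f s - f z \<noteq> 0" using fx by auto
    \<comment> \<open>The Hoelder bound is available against boundary points only, so
      \<open>f1 y - f1 z\<close> is split at \<open>s\<close>; hence the factor 2.\<close>
    have "norm (f z - f s - f1 z * (z - s)) \<le> (2 * C * x powr a) * norm (z - s)"
    proof (rule linear_approx)
      fix y assume y: "norm y \<le> 1" "norm (y - s) \<le> norm (z - s)"
      have "norm (f1 y - f1 s) \<le> C * norm (y - s) powr a" using C s y by auto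
      also have "\<dots> \<le> C * x powr a" using C y a by (intro mult_left_mono powr_mono2) (auto simp: x_def norm_minus_commute)
      finally have 1: "norm (f1 y - f1 s) \<le> C * x powr a" .
      have "norm (f1 z - f1 s) \<le> C * x powr a" using C(2)[OF s, of z] z by (simp add: x_def norm_minus_commute)
      then have "norm (f1 y - f1 s) + norm (f1 z - f1 s) \<le> 2 * C * x powr a" using 1 by linarith
      moreover have "norm (f1 y - f1 z) \<le> norm (f1 y - f1 s) + norm (f1 z - f1 s)" by norm
      ultimately show "norm (f1 y - f1 z) \<le> 2 * C * x powr a" by linarith
    qed (use s z in auto)
    moreover have "norm (f z - f s - f1 z * (z - s)) = norm ((f s - f z) - f1 z * (s - z))"
    proof -
      have "f z - f s - f1 z * (z - s) = - ((f s - f z) - f1 z * (s - z))" by (simp add: algebra_simps)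
      then show ?thesis by (simp only: norm_minus_cancel)
    qed
    ultimately have lin: "norm ((f s - f z) - f1 z * (s - z)) \<le> 2 * C * x powr a * x"
      by (simp add: x_def norm_minus_commute)
    \<comment> \<open>The kernel is the difference of squares of \<open>P\<close> and
      \<open>Q\<close>. Both are of size \<open>1 / x\<close>, and \<open>P - Q\<close> gains a
      factor \<open>x powr a\<close> from the linearisation error.\<close>
    define P Q where "P = 1 / (s - z)" and "Q = f1 z / (f s - f z)"
    have nP: "norm P = 1 / x" by (simp add: P_def x_def norm_divide)
    have nQ: "norm Q \<le> M / (c * x)" 
      unfolding Q_def norm_divide using M(1) M(2)[of z] z fx c x0 by (intro frac_le) auto
    have "P - Q = ((f s - f z) - f1 z * (s - z)) / ((s - z) * (f s - f z))"
      unfolding P_def Q_def using sz fx0 by (simp add: diff_frac_eq)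
    then have "norm (P - Q) = norm ((f s - f z) - f1 z * (s - z)) / (x * norm (f s - f z))"
      by (simp add: norm_divide norm_mult x_def)
    also have "\<dots> \<le> (2 * C * x powr a * x) / (x * (c * x))"
      using lin fx c x0 C(1) by (intro frac_le mult_left_mono) auto
    finally have PQ1: "norm (P - Q) \<le> (2 * C / c) * x powr a / x" using x0 by (simp add: field_simps)
    have PQ2: "norm (P + Q) \<le> (1 + M / c) / x"
      using norm_triangle_ineq[of P Q] nP nQ x0 c by (simp add: add_divide_distrib)
    have PQ: "1 / (s - z)\<^sup>2 - (f1 z)\<^sup>2 / (f s - f z)\<^sup>2 = (P - Q) * (P + Q)"
      by (simp add: P_def Q_def power2_eq_square algebra_simps)
    have "norm (1 / (s - z)\<^sup>2 - (f1 z)\<^sup>2 / (f s - f z)\<^sup>2) \<le> ((2 * C / c) * x powr a / x) * ((1 + M / c) / x)"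
      unfolding PQ norm_mult using C(1) c(1) x0 by (intro mult_mono PQ1 PQ2) auto
    also have "\<dots> = (2 * C / c * (1 + M / c)) * x powr (a - 2)"
      using x0 by (simp add: powr_diff power2_eq_square mult_ac)
    finally show ?thesis unfolding x_def .
  qed
  moreover have "0 \<le> 2 * C / c * (1 + M / c)" using C(1) c(1) M(1) by simp
  ultimately show ?thesis using that by blast
qed

section \<open>Winding averages and the Plemelj formula\<close>

lemma avg_winding_outside:
  assumes w: "w \<notin> f ` cball 0 1"
  shows "avg (\<lambda>t. f1 (cis t) * cis t / (f (cis t) - w)) = 0"
proof -
  have "avg (\<lambda>t. (\<lambda>z. f1 z / (f z - w)) (cis t) * cis t) = 0"
  proof (rule avg_cauchy_theorem)
    show "continuous_on (cball 0 1) (\<lambda>z. f1 z / (f z - w))"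
      using w by (auto intro!: continuous_intros cont_f1 cont_f)
    show "(\<lambda>z. f1 z / (f z - w)) holomorphic_on ball 0 1"
      using w by (auto intro!: holomorphic_intros hol_f1 hol_f)
  qed
  then show ?thesis by simp
qed

lemma f_neq: "norm z \<le> 1 \<Longrightarrow> norm w \<le> 1 \<Longrightarrow> z \<noteq> w \<Longrightarrow> f z \<noteq> f w"
  using inj_onD[OF inj_f, of z w] by auto

text \<open>The divided difference \<open>g\<close> of \<open>f\<close> at \<open>z0\<close> has no
  zeros, by injectivity and \<open>f1 z0 \<noteq> 0\<close>. Cauchy's formula for
  \<open>f1 / g\<close> gives the value without any topology of the boundary curve.\<close>

lemma avg_winding_inside:
  assumes z0: "norm z0 < 1"
  shows "avg (\<lambda>t. f1 (cis t) * cis t / (f (cis t) - f z0)) = 1"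
proof -
  define g where "g = (\<lambda>z. if z = z0 then deriv f z0 else (f z - f z0) / (z - z0))"
  have hg: "g holomorphic_on ball 0 1"
    unfolding g_def by (rule pole_lemma_open[OF hol_f open_ball])
  have cg: "continuous_on (cball 0 1) g"
  proof -
    have "isCont g z" if "norm z < 1" for z
      using holomorphic_on_imp_continuous_on[OF hg] that by (simp add: continuous_on_eq_continuous_at)
    moreover have "continuous (at z within cball 0 1) g" if "norm z \<le> 1" "z \<noteq> z0" for z
    proof -
      have "continuous (at z within cball 0 1) (\<lambda>z. (f z - f z0) / (z - z0))"
        using cont_f that by (intro continuous_intros) (auto simp: continuous_on_eq_continuous_within)
      then have "((\<lambda>z. (f z - f z0) / (z - z0)) \<longlongrightarrow> g z) (at z within cball 0 1)"
        using that by (simp add: continuous_within g_def)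
      moreover have "\<forall>\<^sub>F y in at z within cball 0 1. (f y - f z0) / (y - z0) = g y"
        using t1_space_nhds[OF that(2)] unfolding eventually_at_filter by (rule eventually_mono) (simp add: g_def)
      ultimately show ?thesis unfolding continuous_within by (rule Lim_transform_eventually)
    qed
    ultimately show ?thesis using z0 continuous_at_imp_continuous_at_within[of _ g]
      unfolding continuous_on_eq_continuous_within by (metis mem_cball_0)
  qed
  have g0: "g z \<noteq> 0" if "norm z \<le> 1" for z
    using f_neq[of z z0] that z0 f1_nonzero[of z0] by (auto simp: g_def f1_def)
  have "avg (\<lambda>t. (\<lambda>z. f1 z / g z) (of_real 1 * cis t) * (of_real 1 * cis t) / (of_real 1 * cis t - z0)) = f1 z0 / g z0"
    by (rule avg_cauchy_formula[of 1 "\<lambda>z. f1 z / g z"])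
      (use g0 z0 in \<open>auto intro!: continuous_intros cont_f1 cg holomorphic_intros hol_f1 hg\<close>)
  then have "avg (\<lambda>t. f1 (cis t) / g (cis t) * cis t / (cis t - z0)) = f1 z0 / g z0"
    by (simp only: of_real_1 mult_1)
  moreover have "f1 z0 / g z0 = 1" using z0 g0[of z0] by (simp add: g_def f1_def)
  moreover have "f1 (cis t) / g (cis t) * cis t / (cis t - z0) = f1 (cis t) * cis t / (f (cis t) - f z0)" for t
  proof -
    have "cis t \<noteq> z0" using z0 by auto
    then have "g (cis t) * (cis t - z0) = f (cis t) - f z0" by (simp add: g_def)
    then show ?thesis by (metis (no_types, lifting) divide_divide_eq_left times_divide_eq_left)
  qed
  ultimately show ?thesis by (simp only:)
qed

text \<open>A nearest point of the compact image cannot be the image of an interior point, because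
  there the image is open and one could move a little further towards \<open>w\<close>.\<close>

lemma nearest_boundary_point:
  assumes w: "w \<notin> f ` cball 0 1"
  obtains s where "norm s = 1" "\<And>y. norm y \<le> 1 \<Longrightarrow> norm (w - f s) \<le> norm (w - f y)"
proof -
  have "compact (f ` cball 0 1)" by (rule compact_continuous_image[OF cont_f compact_cball])
  obtain x where x: "x \<in> cball 0 1" "\<And>y. y \<in> cball 0 1 \<Longrightarrow> norm (w - f x) \<le> norm (w - f y)"
    using continuous_attains_inf[of "cball 0 1" "\<lambda>y. norm (w - f y)"]
      continuous_on_norm[OF continuous_on_diff[OF continuous_on_const cont_f]] by auto
  have "norm x = 1"
  proof (rule ccontr)
    assume "norm x \<noteq> 1"
    then have x1: "x \<in> ball 0 1" using x(1) by auto
    have "open (f ` ball 0 1)"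
      by (rule open_mapping_thm3[OF hol_f open_ball inj_on_subset[OF inj_f ball_subset_cball]])
    then obtain e where e: "0 < e" "ball (f x) e \<subseteq> f ` ball 0 1" using x1 by (meson imageI openE)
    define t where "t = min (1/2) (e / (2 * norm (w - f x)))"
    have wx: "w \<noteq> f x" using w x(1) by auto
    then have t: "0 < t" "t < 1" "t * norm (w - f x) < e"
      using e by (auto simp: t_def min_def field_simps)
    have "f x + of_real t * (w - f x) \<in> ball (f x) e"
      using t by (simp add: dist_norm norm_mult)
    then obtain y where y: "y \<in> ball 0 1" "f y = f x + of_real t * (w - f x)" using e(2) by (metis imageE subsetD)
    have "w - f y = of_real (1 - t) * (w - f x)" using y by (simp add: algebra_simps)
    then have "norm (w - f y) = (1 - t) * norm (w - f x)" using t by (simp only: norm_mult norm_of_real)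
    also have "\<dots> < norm (w - f x)" using t wx by (simp add: mult_less_cancel_right1)
    finally show False using x(2)[of y] y by auto
  qed
  then show ?thesis using that x by auto
qed

text \<open>A Plemelj formula: the exterior Cauchy integral is compared with the interior one, which vanishes,
  at the point \<open>f (r s\<^sub>0)\<close> with \<open>1 - r\<close> the distance from \<open>w\<close> to its nearest boundary point \<open>f s\<^sub>0\<close>.\<close>

lemma plemelj_nearest:
  fixes h :: "complex \<Rightarrow> complex"
  assumes h: "\<And>s y. norm s = 1 \<Longrightarrow> norm y = 1 \<Longrightarrow> norm (h y - h s) \<le> Ch * norm (y - s) powr a"
    and ch: "continuous_on (sphere 0 1) h"
    and van: "\<And>z. norm z < 1 \<Longrightarrow> avg (\<lambda>t. h (cis t) * f1 (cis t) * cis t / (f (cis t) - f z)) = 0"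
  shows "\<exists>C\<ge>0. \<forall>w s. w \<notin> f ` cball 0 1 \<longrightarrow> norm s = 1 \<longrightarrow> (\<forall>y. norm y \<le> 1 \<longrightarrow> norm (w - f s) \<le> norm (w - f y)) \<longrightarrow>
       norm (w - f s) \<le> 1 \<longrightarrow>
       norm (avg (\<lambda>t. h (cis t) * f1 (cis t) * cis t / (w - f (cis t))) - h s) \<le> C * norm (w - f s) powr a"
proof -
  obtain M where M: "1 \<le> M" "\<And>z. norm z \<le> 1 \<Longrightarrow> norm (f1 z) \<le> M"
    "\<And>z w. norm z \<le> 1 \<Longrightarrow> norm w \<le> 1 \<Longrightarrow> norm (f z - f w) \<le> M * norm (z - w)" by (rule f1_bounded) blast
  obtain c where c: "0 < c" "c \<le> 1" "\<And>z w. norm z \<le> 1 \<Longrightarrow> norm w \<le> 1 \<Longrightarrow> c * norm (z - w) \<le> norm (f z - f w)"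
    by (rule bilip) blast
  have Ch: "0 \<le> Ch" using order_trans[OF norm_ge_zero h[of 1 "-1"]] by (simp add: zero_le_mult_iff)
  define K where "K = (Ch * 2) * M * (M + 1) * (2 / c + 1) / c"
  have K: "0 \<le> K" using Ch M(1) c by (simp add: K_def)
  define C where "C = K * (1 + 9 / (1 - 2 powr (a - 1)))"
  have q: "(2::real) powr (a - 1) < 1" using a by (simp add: powr_less_one)
  have C0: "0 \<le> C" using K q by (simp add: C_def)
  have "norm (avg (\<lambda>t. h (cis t) * f1 (cis t) * cis t / (w - f (cis t))) - h s0) \<le> C * norm (w - f s0) powr a"
    if w: "w \<notin> f ` cball 0 1" and s0: "norm s0 = 1" 
      and near: "\<And>y. norm y \<le> 1 \<Longrightarrow> norm (w - f s0) \<le> norm (w - f y)" and d1: "norm (w - f s0) \<le> 1" for w s0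
  proof -
    define d where "d = norm (w - f s0)"
    have d: "0 < d" "d \<le> 1" using w s0 d1 by (auto simp: d_def)
    define z where "z = of_real (1 - d) * s0"
    have nz: "norm z = 1 - d" using d s0 by (simp only: z_def norm_mult norm_of_real) simp
    then have z1: "norm z < 1" using d by simp
    define w' where "w' = f z"
    define m where "m = (\<lambda>t. f1 (cis t) * cis t)"
    have fw: "f (cis t) - w \<noteq> 0" for t using w by force
    have fw': "f (cis t) - w' \<noteq> 0" for t
    proof -
      have "cis t \<noteq> z" using z1 by auto
      then show ?thesis using f_neq[of "cis t" z] z1 by (simp add: w'_def)
    qed
    have cf: "continuous_on A (\<lambda>t. f (cis t))" for A :: "real set"
      by (rule continuous_on_circle[OF continuous_on_subset[OF cont_f]]) auto
    have cm: "continuous_on A m" for A unfolding m_def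
      using continuous_on_circle[OF continuous_on_subset[OF cont_f1]] by (intro continuous_intros) auto
    have chc: "continuous_on A (\<lambda>t. h (cis t))" for A :: "real set" by (rule continuous_on_circle[OF ch])
    have cI: "continuous_on A (\<lambda>t. h (cis t) * m t / (f (cis t) - w))" "continuous_on A (\<lambda>t. h (cis t) * m t / (f (cis t) - w'))"
      "continuous_on A (\<lambda>t. m t / (f (cis t) - w))" "continuous_on A (\<lambda>t. m t / (f (cis t) - w'))" for A
      using fw fw' by (auto intro!: continuous_intros cf cm chc)
    \<comment> \<open>The Cauchy integral at \<open>w'\<close> vanishes by assumption, and the
      winding averages are 1 at \<open>w'\<close> and 0 at \<open>w\<close>. This makes
      \<open>h s0\<close> appear and replaces \<open>h\<close> by \<open>h - h s0\<close>, which
      vanishes at \<open>s0\<close> to order \<open>a\<close>.\<close>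
    define D where "D = (\<lambda>t. (h (cis t) - h s0) * m t * (1 / (f (cis t) - w') - 1 / (f (cis t) - w)))"
    have cD: "continuous_on A D" for A
      unfolding D_def using fw fw' by (auto intro!: continuous_intros cf cm chc)
    have "avg (\<lambda>t. h (cis t) * f1 (cis t) * cis t / (w - f (cis t))) = - avg (\<lambda>t. h (cis t) * m t / (f (cis t) - w))"
    proof -
      have "h (cis t) * f1 (cis t) * cis t / (w - f (cis t)) = (-1) * (h (cis t) * m t / (f (cis t) - w))" for t
        unfolding m_def by (simp add: minus_divide_right mult.assoc)
      then show ?thesis by (simp only: avg_mult_right) simp
    qed
    moreover have "avg D = - avg (\<lambda>t. h (cis t) * m t / (f (cis t) - w)) - h s0"
    proof -
      have "D t = (h (cis t) * m t / (f (cis t) - w') - h (cis t) * m t / (f (cis t) - w)) 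
            - h s0 * (m t / (f (cis t) - w') - m t / (f (cis t) - w))" for t
        unfolding D_def by (simp add: algebra_simps)
      then have "D = (\<lambda>t. (h (cis t) * m t / (f (cis t) - w') - h (cis t) * m t / (f (cis t) - w)) 
            - h s0 * (m t / (f (cis t) - w') - m t / (f (cis t) - w)))" by (rule ext)
      then have "avg D = (avg (\<lambda>t. h (cis t) * m t / (f (cis t) - w')) - avg (\<lambda>t. h (cis t) * m t / (f (cis t) - w)))
            - h s0 * (avg (\<lambda>t. m t / (f (cis t) - w')) - avg (\<lambda>t. m t / (f (cis t) - w)))"
        by (simp only: avg_diff avg_mult_right cI continuous_on_diff continuous_on_mult continuous_on_const)
      also have "\<dots> = - avg (\<lambda>t. h (cis t) * m t / (f (cis t) - w)) - h s0"
        using van[OF z1] avg_winding_outside[OF w] avg_winding_inside[OF z1] by (simp add: m_def w'_def mult.assoc)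
      finally show ?thesis .
    qed
    ultimately have eq: "avg (\<lambda>t. h (cis t) * f1 (cis t) * cis t / (w - f (cis t))) - h s0 = avg D" by simp
    have bd: "norm (D t) \<le> K * d * norm (cis t - z) powr (a - 2)" for t
    proof -
      define s where "s = cis t"
      have s: "norm s = 1" by (simp add: s_def)
      define x where "x = norm (s - z)"
      have zs0: "norm (z - s0) = d"
      proof -
        have "z - s0 = of_real (- d) * s0" by (simp add: z_def algebra_simps)
        then show ?thesis using s0 d by (simp only: norm_mult norm_of_real)
      qed
      have xd: "d \<le> x" using norm_triangle_ineq2[of s z] nz s by (simp add: x_def)
      have ss0: "norm (s - s0) \<le> 2 * x" 
        using norm_triangle_ineq[of "s - z" "z - s0"] xd zs0 by (simp add: x_def)
      \<comment> \<open>Both \<open>w\<close> and \<open>w'\<close> are at distance at least a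
        multiple of \<open>x\<close> from \<open>f s\<close>. For \<open>w\<close> this rests on
        \<open>f s0\<close> being nearest: \<open>d\<close> is then at most the distance from
        \<open>w\<close> to \<open>f s\<close>.\<close>
      have fsw: "x \<le> (2 / c + 1) * norm (f s - w)"
      proof -
        have 1: "d \<le> norm (f s - w)" using near[of s] s by (simp add: d_def norm_minus_commute)
        have "c * norm (s - s0) \<le> norm (f s - f s0)" using c(3) s s0 by simp
        also have "\<dots> \<le> norm (f s - w) + norm (w - f s0)" by norm
        also have "\<dots> \<le> 2 * norm (f s - w)" using 1 by (simp add: d_def)
        finally have "norm (s - s0) \<le> 2 / c * norm (f s - w)" using c(1) by (simp add: field_simps)
        moreover have "x \<le> norm (s - s0) + d" unfolding x_def using zs0 norm_triangle_ineq4[of "s - s0" "z - s0"] by simp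
        ultimately show ?thesis using 1 by (simp add: algebra_simps)
      qed
      have fsw': "c * x \<le> norm (f s - w')" using c(3)[of s z] s z1 by (simp add: x_def w'_def)
      have ww': "norm (w' - w) \<le> (M + 1) * d"
      proof -
        have "norm (w' - f s0) \<le> M * d" using M(3)[of z s0] z1 s0 zs0 by (simp add: w'_def)
        moreover have "norm (w' - w) \<le> norm (w' - f s0) + norm (w - f s0)" by norm
        ultimately show ?thesis by (simp add: d_def algebra_simps)
      qed
      have x0: "0 < x" using xd d by simp
      have "norm (1 / (f s - w') - 1 / (f s - w)) = norm (w' - w) / (norm (f s - w') * norm (f s - w))"
        using fw[of t] fw'[of t] by (simp add: s_def diff_frac_eq norm_divide norm_mult)
      also have "\<dots> \<le> ((M + 1) * d) / ((c * x) * (x / (2 / c + 1)))"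
      proof (rule frac_le)
        have "x / (2 / c + 1) \<le> norm (f s - w)" using fsw c(1)
          by (subst pos_divide_le_eq) (auto simp: mult.commute intro: add_pos_pos)
        then show "(c * x) * (x / (2 / c + 1)) \<le> norm (f s - w') * norm (f s - w)"
          using fsw' x0 c(1) by (intro mult_mono) auto
        show "0 < (c * x) * (x / (2 / c + 1))" using x0 c(1) by (intro mult_pos_pos divide_pos_pos add_pos_pos) auto
      qed (use ww' M(1) d in auto)
      also have "\<dots> = (M + 1) * (2 / c + 1) / c * d / x\<^sup>2" using c(1) x0 by (simp add: power2_eq_square mult_ac)
      finally have 1: "norm (1 / (f s - w') - 1 / (f s - w)) \<le> (M + 1) * (2 / c + 1) / c * d / x\<^sup>2" .
      have "norm (h s - h s0) \<le> Ch * norm (s - s0) powr a" using h[OF s0 s] .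
      also have "\<dots> \<le> Ch * (2 * x) powr a" using ss0 a Ch by (intro mult_left_mono powr_mono2) auto
      also have "(2 * x) powr a = 2 powr a * x powr a" by (simp add: powr_mult)
      also have "Ch * (2 powr a * x powr a) \<le> Ch * (2 * x powr a)"
        using powr_mono[of a 1 2] a Ch by (intro mult_left_mono mult_right_mono) auto
      finally have 2: "norm (h s - h s0) \<le> Ch * 2 * x powr a" by simp
      have 3: "norm (m t) \<le> M" using M(2)[of s] s by (simp add: m_def s_def norm_mult)
      have "norm (D t) \<le> (Ch * 2 * x powr a) * M * ((M + 1) * (2 / c + 1) / c * d / x\<^sup>2)"
        unfolding D_def norm_mult s_def[symmetric] using 1 2 3 Ch M(1) by (intro mult_mono) auto
      also have "\<dots> = K * d * x powr (a - 2)" using x0 by (simp add: K_def powr_diff)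
      finally show ?thesis by (simp add: x_def s_def)
    qed
    have "norm (avg D) \<le> avg (\<lambda>t. K * d * norm (cis t - z) powr (a - 2))"
    proof (rule norm_avg_le)
      have "cis t \<noteq> z" for t using z1 by auto
      then show "continuous_on {0..2 * pi} (\<lambda>t. K * d * norm (cis t - z) powr (a - 2))"
        by (intro continuous_intros) auto
    qed (use bd cD in auto)
    also have "\<dots> = K * d * avg (\<lambda>t. norm (cis t - z) powr (a - 2))" by (rule avg_mult_right_real)
    also have "\<dots> \<le> K * d * ((1 + 9 / (1 - 2 powr (a - 1))) * d powr (a - 1))"
      unfolding z_def using avg_powr_kernel_le[OF a s0 d] K d by (intro mult_left_mono) auto
    also have "\<dots> = C * d powr a" using d by (simp add: C_def powr_diff)
    finally show ?thesis unfolding eq d_def .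
  qed
  then show ?thesis using C0 by blast
qed

text \<open>The nearest boundary point \<open>f s0\<close> is at most as far from \<open>w\<close>
  as \<open>f s\<close>, so the bi-Lipschitz bound puts \<open>s0\<close> within
  \<open>2 / c * norm (w - f s)\<close> of \<open>s\<close>, and the Hoelder bound of
  \<open>h\<close> covers the change.\<close>

lemma plemelj:
  fixes h :: "complex \<Rightarrow> complex"
  assumes h: "\<And>s y. norm s = 1 \<Longrightarrow> norm y = 1 \<Longrightarrow> norm (h y - h s) \<le> Ch * norm (y - s) powr a"
    and ch: "continuous_on (sphere 0 1) h"
    and van: "\<And>z. norm z < 1 \<Longrightarrow> avg (\<lambda>t. h (cis t) * f1 (cis t) * cis t / (f (cis t) - f z)) = 0"
  shows "\<exists>C\<ge>0. \<forall>w s. w \<notin> f ` cball 0 1 \<longrightarrow> norm s = 1 \<longrightarrow> norm (w - f s) \<le> 1 \<longrightarrow>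
       norm (avg (\<lambda>t. h (cis t) * f1 (cis t) * cis t / (w - f (cis t))) - h s) \<le> C * norm (w - f s) powr a"
proof -
  obtain C where C: "0 \<le> C" 
    "\<forall>w s. w \<notin> f ` cball 0 1 \<longrightarrow> norm s = 1 \<longrightarrow> (\<forall>y. norm y \<le> 1 \<longrightarrow> norm (w - f s) \<le> norm (w - f y)) \<longrightarrow>
       norm (w - f s) \<le> 1 \<longrightarrow>
       norm (avg (\<lambda>t. h (cis t) * f1 (cis t) * cis t / (w - f (cis t))) - h s) \<le> C * norm (w - f s) powr a"
    using plemelj_nearest[OF h ch van] by blast
  obtain c where c: "0 < c" "c \<le> 1" "\<And>z w. norm z \<le> 1 \<Longrightarrow> norm w \<le> 1 \<Longrightarrow> c * norm (z - w) \<le> norm (f z - f w)"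
    by (rule bilip) blast
  have Ch: "0 \<le> Ch" using order_trans[OF norm_ge_zero h[of 1 "-1"]] by (simp add: zero_le_mult_iff)
  define C' where "C' = C + Ch * (2 / c) powr a"
  have "norm (avg (\<lambda>t. h (cis t) * f1 (cis t) * cis t / (w - f (cis t))) - h s) \<le> C' * norm (w - f s) powr a"
    if w: "w \<notin> f ` cball 0 1" and s: "norm s = 1" and d1: "norm (w - f s) \<le> 1" for w s
  proof -
    obtain s0 where s0: "norm s0 = 1" "\<And>y. norm y \<le> 1 \<Longrightarrow> norm (w - f s0) \<le> norm (w - f y)"
      by (rule nearest_boundary_point[OF w]) blast
    let ?H = "avg (\<lambda>t. h (cis t) * f1 (cis t) * cis t / (w - f (cis t)))"
    have d: "norm (w - f s0) \<le> norm (w - f s)" using s0 s by simp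
    have "norm (?H - h s0) \<le> C * norm (w - f s0) powr a" using C(2) w s0 d d1 by auto
    also have "\<dots> \<le> C * norm (w - f s) powr a" using C(1) d a by (intro mult_left_mono powr_mono2) auto
    finally have 1: "norm (?H - h s0) \<le> C * norm (w - f s) powr a" .
    have "c * norm (s0 - s) \<le> norm (f s0 - f s)" using c(3) s s0 by simp
    also have "\<dots> \<le> norm (w - f s0) + norm (w - f s)" by norm
    also have "\<dots> \<le> 2 * norm (w - f s)" using d by simp
    finally have "norm (s0 - s) \<le> 2 / c * norm (w - f s)" using c(1) by (simp add: field_simps)
    then have "Ch * norm (s0 - s) powr a \<le> Ch * (2 / c * norm (w - f s)) powr a"
      using Ch a by (intro mult_left_mono powr_mono2) auto
    then have 2: "norm (h s0 - h s) \<le> Ch * ((2 / c) powr a * norm (w - f s) powr a)"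
      using order_trans[OF h[OF s s0(1)]] powr_mult[of "2 / c" "norm (w - f s)" a] c(1) by simp
    have "norm (?H - h s) \<le> norm (?H - h s0) + norm (h s0 - h s)" by norm
    then show ?thesis using 1 2 unfolding C'_def by (simp add: algebra_simps)
  qed
  moreover have "0 \<le> C'" using C(1) Ch by (simp add: C'_def)
  ultimately show ?thesis by blast
qed

end

subsection \<open>The exterior map\<close>

text \<open>One of the two points may leave \<open>A\<close>; a compact neighbourhood of
  \<open>A\<close> inside \<open>V\<close> supplies the uniform continuity.\<close>

lemma uniform_near_compact:
  fixes E :: "complex \<Rightarrow> complex"
  assumes A: "compact A" "A \<noteq> {}" and V: "open V" "A \<subseteq> V" and cE: "continuous_on V E" and e: "0 < e"
  obtains d where "0 < d" "\<And>x y. y \<in> A \<Longrightarrow> norm (x - y) < d \<Longrightarrow> x \<in> V \<and> norm (E x - E y) < e"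
proof -
  obtain d1 where d1: "0 < d1" "{x. infdist x A \<le> d1} \<subseteq> V"
    using compact_in_open_separated[OF A(2,1) V] by metis
  have "compact {x. infdist x A \<le> d1}" by (rule compact_infdist_le[OF A(2,1) d1(1)])
  then have "uniformly_continuous_on {x. infdist x A \<le> d1} E"
    by (rule compact_uniformly_continuous[rotated]) (rule continuous_on_subset[OF cE d1(2)])
  then obtain d2 where d2: "0 < d2" "\<And>x y. infdist x A \<le> d1 \<Longrightarrow> infdist y A \<le> d1 \<Longrightarrow> dist y x < d2 \<Longrightarrow> dist (E y) (E x) < e"
    using e unfolding uniformly_continuous_on_def by (metis mem_Collect_eq)
  have "x \<in> V \<and> norm (E x - E y) < e" if y: "y \<in> A" and xy: "norm (x - y) < min d1 d2" for x y
  proof -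
    have "infdist x A \<le> dist x y" using y by (rule infdist_le)
    then have 1: "infdist x A \<le> d1" using xy by (simp add: dist_norm)
    moreover have "infdist y A \<le> d1" using y d1 by simp
    ultimately show ?thesis using d2(2)[of y x] d1(2) xy by (auto simp: dist_norm)
  qed
  then show ?thesis using that[of "min d1 d2"] d1 d2 by auto
qed

locale conformal_welding = smooth_disc_map +
  fixes \<phi> :: "complex \<Rightarrow> complex"
  assumes univalent: "univalent_ext_inf \<phi>" and matching: "matching f \<phi>"
begin

abbreviation "K \<equiv> f ` cball 0 1"

abbreviation "\<psi> \<equiv> psi_of \<phi>"

lemma hol_phi: "\<phi> holomorphic_on ext_disc" and inj_phi: "inj_on \<phi> ext_disc"
  and phi_inf: "filterlim \<phi> at_infinity at_infinity"
  using univalent unfolding univalent_ext_inf_def by auto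

lemma open_ext_disc: "open ext_disc"
  unfolding ext_disc_def by (intro open_Collect_less continuous_intros)

lemma compact_K: "compact K"
  by (rule compact_continuous_image[OF cont_f compact_cball])

lemma open_inside: "open (f ` ball 0 1)"
  by (rule open_mapping_thm3[OF hol_f open_ball inj_on_subset[OF inj_f ball_subset_cball]])

lemma frontier_inside: "frontier (f ` ball 0 1) = f ` sphere 0 1"
proof -
  have "closure (f ` ball 0 1) \<subseteq> K"
    by (rule closure_minimal) (auto intro: compact_imp_closed[OF compact_K])
  moreover have "K \<subseteq> closure (f ` ball 0 1)"
    using image_closure_subset[of "ball 0 1" f "closure (f ` ball 0 1)"] cont_f closure_subset[of "f ` ball 0 1"]
    by simp
  ultimately have "frontier (f ` ball 0 1) = K - f ` ball 0 1"
    using open_inside by (simp add: frontier_def interior_open)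
  also have "\<dots> = f ` (cball 0 1 - ball 0 1)"
    by (rule inj_on_image_set_diff[OF inj_f, symmetric]) auto
  also have "cball 0 1 - ball 0 1 = (sphere 0 1 :: complex set)" by auto
  finally show ?thesis .
qed

text \<open>\<open>matching\<close> only gives disjointness and equal frontiers. As \<open>K\<close>
  is homeomorphic to a disc, its complement is connected; it meets the open image but not the
  frontier of that image, hence lies in it.\<close>

lemma ext_image: "\<phi> ` ext_disc = - K"
proof -
  define U where "U = \<phi> ` ext_disc"
  have oU: "open U" unfolding U_def by (rule open_mapping_thm3[OF hol_phi open_ext_disc inj_phi])
  have fU: "frontier U = f ` sphere 0 1"
    using matching frontier_inside unfolding matching_def U_def by simp
  have "U \<inter> f ` sphere 0 1 = {}" using oU fU by (metis frontier_disjoint_eq inf_commute)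
  moreover have "U \<inter> f ` ball 0 1 = {}" using matching unfolding matching_def U_def by auto
  moreover have "cball 0 1 = (ball 0 1 \<union> sphere 0 1 :: complex set)" by auto
  then have "K = f ` ball 0 1 \<union> f ` sphere 0 1" by (simp only: image_Un)
  ultimately have UK: "U \<inter> K = {}" by auto
  have "connected (- K)"
  proof (rule connected_complement_homeomorphic_convex_compact)
    show "K homeomorphic (cball 0 1 :: complex set)"
      by (subst homeomorphic_sym) (rule homeomorphic_compact[OF compact_cball cont_f refl inj_f])
  qed auto
  moreover have "U \<noteq> {}"
  proof -
    have "2 \<in> ext_disc" by (simp add: ext_disc_def)
    then show ?thesis unfolding U_def by blast
  qed
  moreover have "- K \<inter> frontier U = {}" using fU by auto
  ultimately have "- K - U = {}"
    using connected_Int_frontier[of "- K" U] UK by blast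
  then show ?thesis using UK unfolding U_def by auto
qed

lemma zero_in_K: "0 \<in> K" using f_0 by force

text \<open>The exterior map conjugated by inversion: infinity becomes the ordinary point 0 of a
  univalent function in the disc.\<close>

definition inv_ext :: "complex \<Rightarrow> complex" where
  "inv_ext \<eta> = (if \<eta> = 0 then 0 else 1 / \<phi> (1 / \<eta>))"

lemma inverse_ext: "\<eta> \<noteq> 0 \<Longrightarrow> norm \<eta> < 1 \<Longrightarrow> 1 / \<eta> \<in> ext_disc"
  by (simp add: ext_disc_def norm_divide)

lemma phi_nonzero: "\<zeta> \<in> ext_disc \<Longrightarrow> \<phi> \<zeta> \<noteq> 0"
  using ext_image zero_in_K by (metis ComplD imageI)

lemma hol_phi_inverse: "(\<lambda>\<eta>. \<phi> (1 / \<eta>)) holomorphic_on ball 0 1 - {0}"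
proof -
  have "(\<phi> \<circ> (\<lambda>\<eta>. 1 / \<eta>)) holomorphic_on ball 0 1 - {0}"
  proof (rule holomorphic_on_compose_gen[OF _ hol_phi])
    show "(\<lambda>\<eta>. 1 / \<eta>) ` (ball 0 1 - {0}) \<subseteq> ext_disc"
      by (rule image_subsetI, rule inverse_ext) auto
  qed (auto intro!: holomorphic_intros)
  then show ?thesis by (simp add: o_def)
qed

lemma phi_inverse_at_0: "filterlim (\<lambda>\<eta>. \<phi> (1 / \<eta>)) at_infinity (at 0)"
proof -
  have "filterlim (\<lambda>\<eta>::complex. inverse \<eta>) at_infinity (at 0)" by (rule filterlim_inverse_at_infinity)
  then have "filterlim (\<lambda>\<eta>::complex. 1 / \<eta>) at_infinity (at 0)" by (simp add: inverse_eq_divide)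
  from filterlim_compose[OF phi_inf this] show ?thesis .
qed

lemma hol_inv_ext: "inv_ext holomorphic_on ball 0 1"
proof -
  have "((\<lambda>\<eta>. 1 / \<phi> (1 / \<eta>)) \<longlongrightarrow> 0) (at 0)"
    using filterlim_compose[OF tendsto_inverse_0 phi_inverse_at_0] by (simp add: inverse_eq_divide)
  moreover have "(\<lambda>\<eta>. 1 / \<phi> (1 / \<eta>)) holomorphic_on ball 0 1 - {0}"
  proof (intro holomorphic_intros hol_phi_inverse)
    show "\<phi> (1 / \<eta>) \<noteq> 0" if "\<eta> \<in> ball 0 1 - {0}" for \<eta>
      by (rule phi_nonzero[OF inverse_ext]) (use that in auto)
  qed
  ultimately have "(\<lambda>y. if y = 0 then 0 else 1 / \<phi> (1 / y)) holomorphic_on ball 0 1"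
    by (intro removable_singularity) auto
  then show ?thesis by (simp add: inv_ext_def[abs_def])
qed

lemma inj_inv_ext: "inj_on inv_ext (ball 0 1)"
proof (rule inj_onI)
  fix x y assume xy: "x \<in> ball 0 1" "y \<in> ball 0 1" "inv_ext x = inv_ext y"
  show "x = y"
  proof (cases "x = 0 \<or> y = 0")
    case True
    have "inv_ext z \<noteq> 0" if "z \<noteq> 0" "norm z < 1" for z
      using phi_nonzero[OF inverse_ext[OF that]] that by (simp add: inv_ext_def)
    then have *: "z = 0 \<longleftrightarrow> inv_ext z = 0" if "z \<in> ball 0 1" for z
      using that by (cases "z = 0") (auto simp: inv_ext_def[of 0])
    show ?thesis using True *[OF xy(1)] *[OF xy(2)] xy(3) by auto
  next
    case False
    then have eq: "\<phi> (1 / x) = \<phi> (1 / y)" using xy by (simp add: inv_ext_def)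
    have "1 / x = 1 / y" by (rule inj_onD[OF inj_phi eq inverse_ext inverse_ext]) (use False xy in auto)
    then show ?thesis by simp
  qed
qed

lemma psi_phi: "\<zeta> \<in> ext_disc \<Longrightarrow> \<psi> (\<phi> \<zeta>) = \<zeta>"
  unfolding psi_of_def by (rule inv_into_f_f[OF inj_phi])

lemma phi_psi: "w \<notin> K \<Longrightarrow> \<phi> (\<psi> w) = w" and psi_ext: "w \<notin> K \<Longrightarrow> \<psi> w \<in> ext_disc"
  unfolding psi_of_def by (rule f_inv_into_f inv_into_into, simp add: ext_image)+

lemma norm_psi: "w \<notin> K \<Longrightarrow> 1 < norm (\<psi> w)"
  using psi_ext by (auto simp: ext_disc_def)

lemma open_outside: "open (- K)"
  using compact_K by (simp add: compact_imp_closed open_Compl)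

lemma hol_psi: "\<psi> holomorphic_on - K"
  and deriv_psi: "w \<notin> K \<Longrightarrow> deriv \<phi> (\<psi> w) * deriv \<psi> w = 1"
proof -
  obtain g where g: "g holomorphic_on \<phi> ` ext_disc" "\<And>z. z \<in> ext_disc \<Longrightarrow> deriv \<phi> z * deriv g (\<phi> z) = 1"
    "\<And>z. z \<in> ext_disc \<Longrightarrow> g (\<phi> z) = z"
    by (rule holomorphic_has_inverse[OF hol_phi open_ext_disc inj_phi]) blast
  have eq: "g w = \<psi> w" if "w \<notin> K" for w
    using g(3)[OF psi_ext[OF that]] unfolding phi_psi[OF that] .
  show "\<psi> holomorphic_on - K"
    by (rule holomorphic_transform[OF g(1)[unfolded ext_image]]) (rule eq, simp)
  have dg: "deriv g w = deriv \<psi> w" if "w \<notin> K" for w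
  proof (rule deriv_cong_ev[OF _ refl])
    have "\<forall>\<^sub>F x in nhds w. x \<in> - K" by (rule eventually_nhds_in_open[OF open_outside]) (use that in simp)
    then show "\<forall>\<^sub>F x in nhds w. g x = \<psi> x" by (rule eventually_mono) (rule eq, simp)
  qed
  show "deriv \<phi> (\<psi> w) * deriv \<psi> w = 1" if "w \<notin> K"
    using g(2)[OF psi_ext[OF that]] unfolding phi_psi[OF that] dg[OF that] .
qed

lemma psi_nonzero: "w \<notin> K \<Longrightarrow> \<psi> w \<noteq> 0"
  using norm_psi[of w] by auto

lemma deriv_psi_nonzero: "w \<notin> K \<Longrightarrow> deriv \<psi> w \<noteq> 0"
  using deriv_psi[of w] by auto

section \<open>The exterior map at infinity and near the curve\<close>

lemma phi_inverse_notin: "\<eta> \<noteq> 0 \<Longrightarrow> norm \<eta> < 1 \<Longrightarrow> \<phi> (1 / \<eta>) \<notin> K"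
  using imageI[OF inverse_ext, of \<eta> \<phi>] unfolding ext_image by blast

text \<open>\<open>inv_ext\<close> is open at 0, so every sufficiently small \<open>1 / w\<close>
  comes from a small \<open>\<eta>\<close>, that is from a large value of
  \<open>\<psi>\<close>.\<close>

lemma psi_large:
  assumes "1 < R"
  obtains M where "0 < M" "\<And>w. w \<notin> K \<Longrightarrow> M < norm w \<Longrightarrow> R < norm (\<psi> w)"
proof -
  have R: "ball 0 (1/R) \<subseteq> (ball 0 1 :: complex set)" using assms by (simp add: ball_subset_ball_iff)
  have "open (inv_ext ` ball 0 (1/R))"
    by (rule open_mapping_thm3[OF holomorphic_on_subset[OF hol_inv_ext R] open_ball inj_on_subset[OF inj_inv_ext R]])
  moreover have "0 \<in> inv_ext ` ball 0 (1/R)" using assms by (intro image_eqI[of _ _ 0]) (auto simp: inv_ext_def)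
  ultimately obtain e where e: "0 < e" "ball 0 e \<subseteq> inv_ext ` ball 0 (1/R)" by (meson openE)
  have "R < norm (\<psi> w)" if w: "w \<notin> K" "1 / e < norm w" for w
  proof -
    have w0: "w \<noteq> 0" using w zero_in_K by auto
    have "norm (1 / w) < e" using w e w0 by (simp add: norm_divide field_simps)
    then obtain \<eta> where eta: "norm \<eta> < 1/R" "1 / w = inv_ext \<eta>" using e(2) by (auto simp: subset_iff image_iff)
    have eta0: "\<eta> \<noteq> 0" using eta(2) w0 by (auto simp: inv_ext_def)
    then have "w = \<phi> (1 / \<eta>)" using eta(2) w0 by (simp add: inv_ext_def)
    moreover have "norm \<eta> < 1" using eta(1) R by auto
    ultimately have "\<psi> w = 1 / \<eta>" using psi_phi inverse_ext eta0 by simp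
    then have "norm (\<psi> w) = 1 / norm \<eta>" by (simp add: norm_divide)
    moreover have "R * norm \<eta> < 1" using eta(1) assms by (simp add: field_simps)
    ultimately show ?thesis using eta0 by (simp add: pos_less_divide_eq)
  qed
  then show ?thesis using that[of "1/e"] e by simp
qed

text \<open>\<open>\<phi>\<close> sends the closed annulus between the radii \<open>R\<close> and
  \<open>R'\<close> to a compact set at positive distance from \<open>K\<close>, and everything
  beyond \<open>R'\<close> to points of modulus at least \<open>B + 1\<close>, while
  \<open>K\<close> has modulus at most \<open>B\<close>.\<close>

lemma psi_near_boundary:
  assumes "1 < R"
  obtains d where "0 < d" "\<And>w s. w \<notin> K \<Longrightarrow> norm s \<le> 1 \<Longrightarrow> norm (w - f s) < d \<Longrightarrow> norm (\<psi> w) < R"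
proof -
  obtain B where "\<forall>x\<in>K. norm x \<le> B"
    using compact_imp_bounded[OF compact_K] unfolding bounded_iff by blast
  then have B: "norm (f s) \<le> B" if "norm s \<le> 1" for s using that by simp
  have "\<forall>\<^sub>F \<zeta> in at_infinity. B + 1 \<le> norm (\<phi> \<zeta>)"
    using filterlim_at_infinity_imp_norm_at_top[OF phi_inf] unfolding filterlim_at_top by blast
  then obtain R' where R': "\<And>\<zeta>. R' \<le> norm \<zeta> \<Longrightarrow> B + 1 \<le> norm (\<phi> \<zeta>)"
    unfolding eventually_at_infinity by auto
  define V where "V = \<phi> ` (cball 0 R' - ball 0 R)"
  have sub: "cball 0 R' - ball 0 R \<subseteq> ext_disc" using assms by (auto simp: ext_disc_def)
  have "compact V" unfolding V_def
    by (intro compact_continuous_image continuous_on_subset[OF holomorphic_on_imp_continuous_on[OF hol_phi] sub] compact_diff compact_cball open_ball)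
  moreover have "V \<inter> K = {}" using sub ext_image unfolding V_def by blast
  ultimately obtain d where d: "0 < d" "\<And>x y. x \<in> V \<Longrightarrow> y \<in> K \<Longrightarrow> d \<le> dist x y"
    using separate_compact_closed[of V K] compact_imp_closed[OF compact_K] by metis
  have "norm (\<psi> w) < R" if w: "w \<notin> K" and s: "norm s \<le> 1" "norm (w - f s) < min d 1" for w s
  proof (rule ccontr)
    assume "\<not> norm (\<psi> w) < R"
    show False
    proof (cases "norm (\<psi> w) \<le> R'")
      case True
      then have "\<phi> (\<psi> w) \<in> V" using \<open>\<not> norm (\<psi> w) < R\<close> unfolding V_def by (intro imageI) auto
      then have "w \<in> V" using phi_psi[OF w] by simp
      then show False using d(2)[of w "f s"] s by (auto simp: dist_norm)
    next
      case False
      then have "B + 1 \<le> norm w" using R'[of "\<psi> w"] phi_psi[OF w] by simp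
      moreover have "norm w \<le> norm (f s) + norm (w - f s)" by norm
      ultimately show False using B[OF s(1)] s(2) by simp
    qed
  qed
  then show ?thesis using that[of "min d 1"] d(1) by auto
qed

text \<open>Among bounded points at distance at least \<open>e\<close> from \<open>K\<close>, the
  modulus of \<open>\<psi>\<close> has a minimum above 1, by compactness; at unbounded ones it
  exceeds 2. A value of modulus close to 1 therefore forces closeness to \<open>K\<close>.\<close>

lemma phi_near_boundary:
  assumes "0 < e"
  obtains r where "0 < r" "r < 1" "\<And>\<eta>. r < norm \<eta> \<Longrightarrow> norm \<eta> < 1 \<Longrightarrow> \<exists>s. norm s = 1 \<and> norm (\<phi> (1 / \<eta>) - f s) < e"
proof -
  obtain M where M: "0 < M" "\<And>w. w \<notin> K \<Longrightarrow> M < norm w \<Longrightarrow> 2 < norm (\<psi> w)"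
    by (rule psi_large[of 2]) auto
  define T where "T = cball 0 M \<inter> (\<Inter>y\<in>K. {w. e \<le> norm (w - y)})"
  have TK: "T \<subseteq> - K" using assms unfolding T_def by force
  have "compact T" unfolding T_def
    by (intro compact_Int_closed compact_cball closed_INT ballI closed_Collect_le continuous_intros)
  have "\<exists>R>1. \<forall>w\<in>T. R \<le> norm (\<psi> w)"
  proof (cases "T = {}")
    case True then show ?thesis by (auto intro: exI[of _ 2])
  next
    case False
    have "continuous_on T (\<lambda>w. norm (\<psi> w))"
      by (intro continuous_intros continuous_on_subset[OF holomorphic_on_imp_continuous_on[OF hol_psi] TK])
    then obtain w0 where "w0 \<in> T" "\<forall>w\<in>T. norm (\<psi> w0) \<le> norm (\<psi> w)"
      using continuous_attains_inf[OF \<open>compact T\<close> False] by blast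
    then show ?thesis using norm_psi[of w0] TK by blast
  qed
  then obtain R where R: "1 < R" "\<And>w. w \<in> T \<Longrightarrow> R \<le> norm (\<psi> w)" by blast
  \<comment> \<open>The modulus of \<open>\<psi>\<close> at \<open>\<phi> (1 / \<eta>)\<close> is
    \<open>1 / norm \<eta>\<close>, which this choice keeps below both 2 and
    \<open>R\<close>.\<close>
  define r where "r = max (1/2) (1 / R)"
  have "\<exists>s. norm s = 1 \<and> norm (\<phi> (1 / \<eta>) - f s) < e" if eta: "r < norm \<eta>" "norm \<eta> < 1" for \<eta>
  proof -
    have eta0: "\<eta> \<noteq> 0" using eta by (auto simp: r_def)
    define w where "w = \<phi> (1 / \<eta>)"
    have w: "w \<notin> K" unfolding w_def by (rule phi_inverse_notin[OF eta0 eta(2)])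
    have psiw: "norm (\<psi> w) = 1 / norm \<eta>" using psi_phi[OF inverse_ext[OF eta0 eta(2)]] by (simp add: w_def norm_divide)
    have "norm (\<psi> w) < 2" "norm (\<psi> w) < R"
      using eta R eta0 unfolding psiw by (auto simp: r_def field_simps)
    then have "w \<notin> T" "norm w \<le> M" using R(2) M(2)[OF w] by force+
    then obtain y where y: "y \<in> K" "norm (w - y) < e" unfolding T_def by (fastforce simp: not_le)
    obtain s where s: "norm s = 1" "\<And>y. norm y \<le> 1 \<Longrightarrow> norm (w - f s) \<le> norm (w - f y)"
      by (rule nearest_boundary_point[OF w]) blast
    have "norm (w - f s) < e" using y s(2) by force
    then show ?thesis using s(1) w_def by blast
  qed
  moreover have "0 < r" "r < 1" using R(1) by (auto simp: r_def)
  ultimately show ?thesis using that by blast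
qed

lemma circle_in_punctured:
  assumes "0 < r" "r < 1"
  shows "of_real r * cis t \<noteq> 0" "norm (of_real r * cis t) < 1" "norm (of_real r * cis t) = r"
  using assms by (auto simp: norm_mult)

lemma continuous_on_phi_circle:
  assumes "0 < r" "r < 1"
  shows "continuous_on A (\<lambda>t. \<phi> (1 / (of_real r * cis t)))"
  by (rule continuous_on_compose2[OF holomorphic_on_imp_continuous_on[OF hol_phi_inverse]])
    (use circle_in_punctured[OF assms] in \<open>auto intro!: continuous_intros\<close>)

text \<open>The mean value property at infinity: in the variable \<open>\<eta>\<close> the
  singularity at 0 is removable with value \<open>L\<close>.\<close>

lemma avg_phi_circle:
  assumes E: "E holomorphic_on - K" "(E \<longlongrightarrow> L) at_infinity" and r: "0 < r" "r < 1"
  shows "avg (\<lambda>t. E (\<phi> (1 / (of_real r * cis t)))) = L"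
proof -
  define q where "q = (\<lambda>\<eta>. if \<eta> = 0 then L else E (\<phi> (1 / \<eta>)))"
  have "(E \<circ> (\<lambda>\<eta>. \<phi> (1 / \<eta>))) holomorphic_on ball 0 1 - {0}"
  proof (rule holomorphic_on_compose_gen[OF hol_phi_inverse E(1)])
    show "(\<lambda>\<eta>. \<phi> (1 / \<eta>)) ` (ball 0 1 - {0}) \<subseteq> - K"
    proof (rule image_subsetI)
      fix \<eta> :: complex assume "\<eta> \<in> ball 0 1 - {0}"
      then show "\<phi> (1 / \<eta>) \<in> - K" using phi_inverse_notin[of \<eta>] by (simp del: image_iff)
    qed
  qed
  then have "(\<lambda>\<eta>. E (\<phi> (1 / \<eta>))) holomorphic_on ball 0 1 - {0}" by (simp add: o_def)
  moreover have "((\<lambda>\<eta>. E (\<phi> (1 / \<eta>))) \<longlongrightarrow> L) (at 0)"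
    by (rule filterlim_compose[OF E(2) phi_inverse_at_0])
  ultimately have hq: "q holomorphic_on ball 0 1" unfolding q_def
    by (intro removable_singularity) auto
  have sub: "cball 0 r \<subseteq> (ball 0 1 :: complex set)" using r by auto
  have "avg (\<lambda>t. q (of_real r * cis t)) = q 0"
    by (rule avg_mean_value) (use hq sub r in \<open>auto intro!: holomorphic_on_imp_continuous_on holomorphic_on_subset[OF hq]\<close>)
  then show ?thesis using r by (simp add: q_def)
qed

text \<open>As a function of \<open>z\<close>, \<open>1 / (w - \<phi> (1 / z))\<close> vanishes at 0
  and has a simple pole at \<open>\<eta>0 = 1 / \<psi> w\<close>, which the circle of radius
  \<open>r\<close> encloses. Written as \<open>Q z * z / (z - \<eta>0)\<close>, where
  \<open>Q\<close> is built from the divided differences \<open>G\<close> and \<open>D\<close> of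
  \<open>inv_ext\<close> at 0 and \<open>\<eta>0\<close>, it falls under Cauchy's formula.\<close>

lemma log_deriv_eq_avg:
  assumes w: "w \<notin> K" and r: "1 / norm (\<psi> w) < r" "r < 1"
  shows "avg (\<lambda>t. 1 / (w - \<phi> (1 / (of_real r * cis t)))) = deriv \<psi> w / \<psi> w"
proof -
  define \<eta>0 where "\<eta>0 = 1 / \<psi> w"
  have w0: "w \<noteq> 0" using w zero_in_K by auto
  have eta0: "\<eta>0 \<noteq> 0" "norm \<eta>0 < r" "norm \<eta>0 < 1" using psi_nonzero[OF w] norm_psi[OF w] r by (auto simp: \<eta>0_def norm_divide)
  have r0: "0 < r" using eta0 by (meson le_less_trans norm_ge_zero)
  have inv0: "inv_ext \<eta>0 = 1 / w" using eta0 phi_psi[OF w] by (simp add: inv_ext_def \<eta>0_def)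
  define D where "D = (\<lambda>z. if z = \<eta>0 then deriv inv_ext \<eta>0 else (inv_ext z - inv_ext \<eta>0) / (z - \<eta>0))"
  define G where "G = (\<lambda>z. if z = 0 then deriv inv_ext 0 else (inv_ext z - inv_ext 0) / (z - 0))"
  have hD: "D holomorphic_on ball 0 1" and hG: "G holomorphic_on ball 0 1"
    unfolding D_def G_def by (rule pole_lemma_open[OF hol_inv_ext open_ball])+
  have D0: "D z \<noteq> 0" if "norm z < 1" for z
    using that eta0 inj_onD[OF inj_inv_ext, of z \<eta>0] holomorphic_injective_imp_regular[OF hol_inv_ext open_ball inj_inv_ext, of \<eta>0]
    by (auto simp: D_def)
  define Q where "Q = (\<lambda>z. G z / (w * D z))"
  have hQ: "Q holomorphic_on ball 0 1" unfolding Q_def using D0 w0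
    by (intro holomorphic_intros hD hG) auto
  have sub: "cball 0 r \<subseteq> (ball 0 1 :: complex set)" using r by auto
  have "avg (\<lambda>t. Q (r * cis t) * (r * cis t) / (r * cis t - \<eta>0)) = Q \<eta>0"
    by (rule avg_cauchy_formula)
      (use hQ sub r eta0 in \<open>auto intro!: holomorphic_on_imp_continuous_on holomorphic_on_subset[OF hQ]\<close>)
  moreover have "Q (r * cis t) * (r * cis t) / (r * cis t - \<eta>0) = 1 / (w - \<phi> (1 / (of_real r * cis t)))" for t
  proof -
    define z where "z = of_real r * cis t"
    have z: "z \<noteq> 0" "norm z = r" "z \<noteq> \<eta>0" using r0 eta0 circle_in_punctured(3)[OF r0 r(2), of t] by (auto simp: z_def)
    have pz: "\<phi> (1 / z) \<noteq> 0" using z r by (intro phi_nonzero inverse_ext) auto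
    have ne: "w \<noteq> \<phi> (1 / z)"
    proof
      assume "w = \<phi> (1 / z)"
      then have "\<psi> w = 1 / z" using psi_phi inverse_ext z r by simp
      then show False using z by (simp add: \<eta>0_def)
    qed
    have "G z * z = 1 / \<phi> (1 / z)" using z by (simp add: G_def inv_ext_def)
    moreover have "D z * (z - \<eta>0) = 1 / \<phi> (1 / z) - 1 / w" using z inv0 by (simp add: D_def inv_ext_def)
    moreover have "Q z * z / (z - \<eta>0) = (G z * z) / (w * (D z * (z - \<eta>0)))"
      by (simp add: Q_def)
    ultimately have "Q z * z / (z - \<eta>0) = (1 / \<phi> (1 / z)) / (w * (1 / \<phi> (1 / z) - 1 / w))" by simp
    also have "\<dots> = 1 / (w - \<phi> (1 / z))" using pz w0 ne by (simp add: divide_simps)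
    finally show ?thesis by (simp add: z_def)
  qed
  moreover have "Q \<eta>0 = deriv \<psi> w / \<psi> w"
  proof -
    have "((\<lambda>z. 1 / \<phi> (1 / z)) has_field_derivative (deriv \<phi> (1/\<eta>0) / \<eta>0\<^sup>2) / w\<^sup>2) (at \<eta>0)"
    proof -
      have "(\<phi> has_field_derivative deriv \<phi> (1/\<eta>0)) (at (1/\<eta>0))"
        by (rule holomorphic_derivI[OF hol_phi open_ext_disc inverse_ext]) (use eta0 in auto)
      moreover have "((\<lambda>z. 1 / z) has_field_derivative (- 1 / \<eta>0\<^sup>2)) (at \<eta>0)"
        using eta0 by (auto intro!: derivative_eq_intros simp: power2_eq_square)
      ultimately have "((\<lambda>z. \<phi> (1 / z)) has_field_derivative deriv \<phi> (1/\<eta>0) * (- 1 / \<eta>0\<^sup>2)) (at \<eta>0)"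
        by (rule DERIV_chain2)
      moreover have "\<phi> (1/\<eta>0) = w" using phi_psi[OF w] by (simp add: \<eta>0_def)
      ultimately show ?thesis using w0 by (auto intro!: derivative_eq_intros simp: power2_eq_square)
    qed
    moreover have "\<forall>\<^sub>F z in nhds \<eta>0. 1 / \<phi> (1 / z) = inv_ext z"
      using t1_space_nhds[OF eta0(1)] by (rule eventually_mono) (simp add: inv_ext_def)
    ultimately have "deriv inv_ext \<eta>0 = (deriv \<phi> (1/\<eta>0) / \<eta>0\<^sup>2) / w\<^sup>2"
      by (metis DERIV_imp_deriv deriv_cong_ev)
    then have "Q \<eta>0 = \<eta>0 / deriv \<phi> (1/\<eta>0)"
      using eta0 w0 inv0 by (simp add: Q_def G_def D_def inv_ext_def[of 0] power2_eq_square)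
    moreover have "deriv \<psi> w = 1 / deriv \<phi> (1/\<eta>0)"
    proof -
      have "deriv \<phi> (\<psi> w) \<noteq> 0" using deriv_psi[OF w] by auto
      then show ?thesis using deriv_psi[OF w] by (simp add: \<eta>0_def field_simps)
    qed
    ultimately show ?thesis by (simp add: \<eta>0_def)
  qed
  ultimately show ?thesis by simp
qed

end

subsection \<open>Bounds for the harmonic measure of level curves\<close>

lemma cauchy_avg_derivative:
  fixes h :: "real \<Rightarrow> complex"
  assumes ch: "continuous_on {0..2*pi} h" and nh: "\<And>t. norm (h t) = 1" and z: "norm z < 1"
  shows "((\<lambda>z. avg (\<lambda>t. 1 / (h t - z) ^ Suc j)) has_field_derivative
      of_nat (Suc j) * avg (\<lambda>t. 1 / (h t - z) ^ Suc (Suc j))) (at z)"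
proof -
  have ne: "h t - x \<noteq> 0" if "norm x < 1" for t x using nh[of t] that by auto
  have "((\<lambda>z. integral (cbox 0 (2*pi)) (\<lambda>t. 1 / (h t - z) ^ Suc j)) has_field_derivative
      integral (cbox 0 (2*pi)) (\<lambda>t. of_nat (Suc j) * (1 / (h t - z) ^ Suc (Suc j)))) (at z within ball 0 1)"
  proof (rule leibniz_rule_field_derivative)
    fix x :: complex and t assume x: "x \<in> ball 0 1"
    have "((\<lambda>x. 1 / (h t - x) ^ Suc j) has_field_derivative of_nat (Suc j) * (1 / (h t - x) ^ Suc (Suc j))) (at x)"
      using ne[of x t] x
      by (auto intro!: derivative_eq_intros simp del: power_Suc of_nat_Suc) (simp add: divide_simps)
    then show "((\<lambda>x. 1 / (h t - x) ^ Suc j) has_field_derivative of_nat (Suc j) * (1 / (h t - x) ^ Suc (Suc j))) (at x within ball 0 1)"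
      by (rule has_field_derivative_at_within)
  next
    fix x :: complex assume x: "x \<in> ball 0 1"
    show "(\<lambda>t. 1 / (h t - x) ^ Suc j) integrable_on cbox 0 (2*pi)"
      using ne[of x] x ch by (intro integrable_continuous continuous_intros) auto
  next
    have "continuous_on (ball 0 1 \<times> {0..2*pi}) (\<lambda>p. h (snd p))"
      by (rule continuous_on_compose2[OF ch continuous_on_snd[OF continuous_on_id]]) auto
    then show "continuous_on (ball 0 1 \<times> cbox 0 (2*pi)) (\<lambda>(x, t). of_nat (Suc j) * (1 / (h t - x) ^ Suc (Suc j)))"
      using ne unfolding split_beta by (intro continuous_intros) auto
  qed (use z in auto)
  then have "((\<lambda>z. (1 / (2*pi)) * integral {0..2*pi} (\<lambda>t. 1 / (h t - z) ^ Suc j)) has_field_derivative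
      (1 / (2*pi)) * integral {0..2*pi} (\<lambda>t. of_nat (Suc j) * (1 / (h t - z) ^ Suc (Suc j)))) (at z)"
    using z by (intro DERIV_cmult) (simp add: at_within_open[of z "ball 0 1"])
  moreover have "complex_of_real (1 / (2 * pi)) * integral {0..2*pi} g = avg g" for g
    by (simp add: avg_def scaleR_conv_of_real)
  ultimately show ?thesis by (simp only: avg_mult_right)
qed

lemma cauchy_avg_holomorphic:
  fixes h :: "real \<Rightarrow> complex"
  assumes ch: "continuous_on {0..2*pi} h" and nh: "\<And>t. norm (h t) = 1"
  shows "(\<lambda>z. avg (\<lambda>t. 1 / (h t - z))) holomorphic_on ball 0 1"
  unfolding holomorphic_on_open[OF open_ball]
  using cauchy_avg_derivative[OF ch nh, of _ 0] by (auto intro!: exI)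

text \<open>At \<open>z = 0\<close> these are moments of the measure carried by \<open>h\<close>,
  and for \<open>j = 1\<close> the integral of the double pole.\<close>

lemma cauchy_avg_higher_deriv:
  fixes h :: "real \<Rightarrow> complex"
  assumes ch: "continuous_on {0..2*pi} h" and nh: "\<And>t. norm (h t) = 1" and z: "norm z < 1"
  shows "(deriv ^^ j) (\<lambda>z. avg (\<lambda>t. 1 / (h t - z))) z = fact j * avg (\<lambda>t. 1 / (h t - z) ^ Suc j)"
  using z
proof (induction j arbitrary: z)
  case (Suc j)
  have "(deriv ^^ Suc j) (\<lambda>z. avg (\<lambda>t. 1 / (h t - z))) z = deriv ((deriv ^^ j) (\<lambda>z. avg (\<lambda>t. 1 / (h t - z)))) z"
    by simp
  also have "\<dots> = deriv (\<lambda>z. fact j * avg (\<lambda>t. 1 / (h t - z) ^ Suc j)) z"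
  proof (rule deriv_cong_ev[OF _ refl])
    have "\<forall>\<^sub>F x in nhds z. x \<in> ball 0 1" using Suc.prems by (intro eventually_nhds_in_open) auto
    then show "\<forall>\<^sub>F x in nhds z. (deriv ^^ j) (\<lambda>z. avg (\<lambda>t. 1 / (h t - z))) x = fact j * avg (\<lambda>t. 1 / (h t - x) ^ Suc j)"
      by (rule eventually_mono) (use Suc.IH in auto)
  qed
  also have "\<dots> = fact j * (of_nat (Suc j) * avg (\<lambda>t. 1 / (h t - z) ^ Suc (Suc j)))"
    by (intro DERIV_imp_deriv DERIV_cmult cauchy_avg_derivative ch nh Suc.prems)
  finally show ?case by (simp add: mult_ac del: power_Suc)
qed simp

lemma avg_poisson_eq:
  fixes h :: "real \<Rightarrow> complex"
  assumes ch: "continuous_on {0..2*pi} h" and nh: "\<And>t. norm (h t) = 1" and z: "norm z < 1"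
  shows "avg (\<lambda>t. poisson z (h t)) = 1 + 2 * Re (z * avg (\<lambda>t. 1 / (h t - z)))"
proof -
  have ne: "h t - z \<noteq> 0" for t using nh[of t] z by auto
  have c: "continuous_on {0..2*pi} (\<lambda>t. z * (1 / (h t - z)))"
    using ne by (intro continuous_intros ch) auto
  have "avg (\<lambda>t. poisson z (h t)) = avg (\<lambda>t. 1 + 2 * Re (z * (1 / (h t - z))))"
    by (rule avg_cong) (rule poisson_eq[OF nh z])
  also have "\<dots> = 1 + 2 * avg (\<lambda>t. Re (z * (1 / (h t - z))))"
    by (simp only: avg_add[OF continuous_on_const continuous_on_mult[OF continuous_on_const continuous_on_Re[OF c]]]
        avg_const avg_mult_right_real)
  also have "avg (\<lambda>t. Re (z * (1 / (h t - z)))) = Re (avg (\<lambda>t. z * (1 / (h t - z))))"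
    by (rule avg_Re[OF c, symmetric])
  finally show ?thesis by (simp only: avg_mult_right)
qed

lemma continuous_on_poisson:
  assumes ch: "continuous_on A h" and nh: "\<And>t. norm (h t) = 1" and z: "norm z < 1"
  shows "continuous_on A (\<lambda>t. poisson z (h t))"
proof -
  have "h t - z \<noteq> 0" for t using nh[of t] z by auto
  then show ?thesis unfolding poisson_def by (intro continuous_intros ch) auto
qed

text \<open>Unlike for Lebesgue measure, the Poisson averages of the measure carried by
  \<open>h\<close> are unknown and have to stay in the bound; in the limit they become values of the
  Poisson integral that is to be estimated.\<close>

lemma avg_powr_le_dyadic:
  fixes h :: "real \<Rightarrow> complex"
  assumes a: "0 < a" "a < 1" and ch: "continuous_on {0..2*pi} h" and nh: "\<And>t. norm (h t) = 1"
    and s0: "norm s0 = 1" and \<delta>: "0 < \<delta>" "\<delta> \<le> 1"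
  shows "avg (\<lambda>t. norm (h t - of_real (1 - \<delta>) * s0) powr (a - 2)) \<le>
    1 + 9 * (\<Sum>k | 2^k * \<delta> \<le> 1. (2^k * \<delta>) powr (a - 1) * avg (\<lambda>t. poisson (of_real (1 - 2^k * \<delta>) * s0) (h t)))"
proof -
  have nz: "norm (of_real (1-\<tau>) * s0) = 1 - \<tau>" if "0 < \<tau>" "\<tau> \<le> 1" for \<tau>
    using that s0 by (simp only: norm_mult norm_of_real) simp
  have zk: "norm (of_real (1 - 2^k * \<delta>) * s0) < 1" if "2^k * \<delta> \<le> 1" for k
    using nz[of "2^k * \<delta>"] that \<delta> by simp
  have ne: "h t \<noteq> z" if "norm z < 1" for t z using nh[of t] that by auto
  have "avg (\<lambda>t. norm (h t - of_real (1 - \<delta>) * s0) powr (a - 2)) \<le> 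
     avg (\<lambda>t. 1 + 9 * (\<Sum>k | 2^k * \<delta> \<le> 1. (2^k * \<delta>) powr (a - 1) * poisson (of_real (1 - 2^k * \<delta>) * s0) (h t)))"
  proof (rule avg_mono)
    show "continuous_on {0..2*pi} (\<lambda>t. norm (h t - of_real (1 - \<delta>) * s0) powr (a - 2))"
      using ne[of "of_real (1 - \<delta>) * s0"] nz[OF \<delta>] \<delta> by (intro continuous_intros ch) auto
    show "continuous_on {0..2*pi} (\<lambda>t. 1 + 9 * (\<Sum>k | 2^k * \<delta> \<le> 1. (2^k * \<delta>) powr (a - 1) * poisson (of_real (1 - 2^k * \<delta>) * s0) (h t)))"
      by (intro continuous_intros continuous_on_poisson ch nh zk) auto
  qed (rule powr_le_dyadic_poisson[OF a nh s0 \<delta>])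
  also have "\<dots> = 1 + 9 * avg (\<lambda>t. \<Sum>k | 2^k * \<delta> \<le> 1. (2^k * \<delta>) powr (a - 1) * poisson (of_real (1 - 2^k * \<delta>) * s0) (h t))"
    by (subst avg_add, intro continuous_intros, intro continuous_intros continuous_on_poisson ch nh zk)
      (auto simp: avg_mult_right_real)
  also have "avg (\<lambda>t. \<Sum>k | 2^k * \<delta> \<le> 1. (2^k * \<delta>) powr (a - 1) * poisson (of_real (1 - 2^k * \<delta>) * s0) (h t)) =
     (\<Sum>k | 2^k * \<delta> \<le> 1. avg (\<lambda>t. (2^k * \<delta>) powr (a - 1) * poisson (of_real (1 - 2^k * \<delta>) * s0) (h t)))"
    by (rule avg_sum[OF finite_dyadic[OF \<delta>(1)]]) (intro continuous_intros continuous_on_poisson ch nh zk, auto)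
  finally show ?thesis by (simp only: avg_mult_right_real)
qed


section \<open>Projecting level curves to the circle\<close>

context conformal_welding
begin

text \<open>A level curve is near the boundary curve but not on it. A continuous extension
  \<open>E\<close> to the plane of the inverse of \<open>f\<close> (Dugundji) maps it close to the
  circle, and \<open>sgn\<close> projects it onto the circle.\<close>

lemma circle_approx:
  assumes "0 < e"
  shows "\<exists>r h. 1 - e < r \<and> 0 < r \<and> r < 1 \<and> continuous_on {0..2*pi} h \<and>
    (\<forall>t. norm (h t) = 1 \<and> norm (f (h t) - \<phi> (1 / (of_real r * cis t))) < e)"
proof -
  obtain M where M: "1 \<le> M" "\<And>z. norm z \<le> 1 \<Longrightarrow> norm (f1 z) \<le> M"
    "\<And>z w. norm z \<le> 1 \<Longrightarrow> norm w \<le> 1 \<Longrightarrow> norm (f z - f w) \<le> M * norm (z - w)" by (rule f1_bounded) blast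
  define g where "g = inv_into (cball 0 1) f"
  have gf: "g (f x) = x" if "norm x \<le> 1" for x unfolding g_def using that by (intro inv_into_f_f[OF inj_f]) auto
  have "continuous_on K g" by (rule continuous_on_inv[OF cont_f compact_cball]) (use gf in auto)
  moreover have "closedin (top_of_set UNIV) K" using compact_imp_closed[OF compact_K] by simp
  ultimately obtain E where E: "continuous_on UNIV E" "\<And>x. x \<in> K \<Longrightarrow> E x = g x"
    using Dugundji[of "UNIV :: complex set" UNIV K g] by auto
  have Ef: "E (f s) = s" if "norm s \<le> 1" for s using E(2)[of "f s"] gf[OF that] that by simp
  \<comment> \<open>The bound \<open>1/2\<close> keeps \<open>E\<close> away from 0, so that
    \<open>sgn\<close> is continuous. The other bound serves the final estimate: \<open>E\<close>
    misses \<open>s\<close> by less than \<open>e1\<close>, \<open>sgn\<close> moves it by at most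
    \<open>e1\<close> more, and \<open>f\<close> multiplies this by at most
    \<open>M\<close>.\<close>
  define e1 where "e1 = min (1/2) (e / (4 * M))"
  have e1: "0 < e1" "e1 \<le> 1/2" "M * (2 * e1) \<le> e / 2" 
    using assms M(1) by (auto simp: e1_def min_def field_simps)
  have "compact (f ` sphere 0 1)" by (rule compact_continuous_image[OF continuous_on_subset[OF cont_f]]) auto
  moreover have "f ` sphere 0 1 \<noteq> {}" by simp
  ultimately obtain d where d: "0 < d" 
      "\<And>x y. y \<in> f ` sphere 0 1 \<Longrightarrow> norm (x - y) < d \<Longrightarrow> x \<in> UNIV \<and> norm (E x - E y) < e1"
    by (rule uniform_near_compact[OF _ _ open_UNIV subset_UNIV E(1) e1(1)]) blast
  obtain r0 where r0: "0 < r0" "r0 < 1" 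
      "\<And>\<eta>. r0 < norm \<eta> \<Longrightarrow> norm \<eta> < 1 \<Longrightarrow> \<exists>s. norm s = 1 \<and> norm (\<phi> (1 / \<eta>) - f s) < min d (e / 2)"
    by (rule phi_near_boundary[of "min d (e/2)"]) (use d assms in auto)
  obtain r where "max r0 (1 - e) < r" "r < 1"
    using dense[of "max r0 (1 - e)" 1] r0 assms by auto
  then have r: "r0 < r" "1 - e < r" "r < 1" "0 < r" using r0 by auto
  define X where "X = (\<lambda>t. \<phi> (1 / (of_real r * cis t)))"
  define h where "h = (\<lambda>t. sgn (E (X t)))"
  have near: "\<exists>s. norm s = 1 \<and> norm (X t - f s) < e / 2 \<and> norm (E (X t) - s) < e1" for t
  proof -
    obtain s where s: "norm s = 1" "norm (X t - f s) < min d (e / 2)"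
      using r0(3)[of "of_real r * cis t"] circle_in_punctured(3)[OF r(4,3), of t] r by (auto simp: X_def)
    then show ?thesis using d(2)[of "f s" "X t"] Ef[of s] by (intro exI[of _ s]) auto
  qed
  have nz: "E (X t) \<noteq> 0" for t
  proof
    assume 0: "E (X t) = 0"
    obtain s where "norm s = 1" "norm (E (X t) - s) < e1" using near[of t] by blast
    then show False using e1 0 by simp
  qed
  have "continuous_on {0..2*pi} h" unfolding h_def
    using nz by (intro continuous_on_sgn continuous_on_compose2[OF E(1)])
      (auto simp: X_def intro!: continuous_on_phi_circle r)
  moreover have "norm (h t) = 1 \<and> norm (f (h t) - X t) < e" for t
  proof -
    obtain s where s: "norm s = 1" "norm (X t - f s) < e / 2" "norm (E (X t) - s) < e1"
      using near[of t] by blast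
    have h1: "norm (h t) = 1" using nz[of t] by (simp add: h_def norm_sgn)
    have "norm (h t - E (X t)) = \<bar>1 - norm (E (X t))\<bar>"
    proof -
      have "h t - E (X t) = of_real (1 - norm (E (X t))) * sgn (E (X t))"
        using nz[of t] by (simp add: h_def sgn_eq field_simps)
      then show ?thesis using nz[of t] by (simp only: norm_mult norm_of_real norm_sgn) simp
    qed
    also have "\<dots> \<le> norm (E (X t) - s)" using norm_triangle_ineq3[of "E (X t)" s] s(1) by (simp add: abs_minus_commute)
    finally have "norm (h t - s) \<le> 2 * e1"
      using norm_triangle_ineq[of "h t - E (X t)" "E (X t) - s"] s(3) by simp
    then have "M * norm (h t - s) \<le> M * (2 * e1)" using M(1) by (intro mult_left_mono) auto
    then have "norm (f (h t) - f s) \<le> M * (2 * e1)"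
      using order_trans[OF M(3)[of "h t" s]] h1 s(1) by simp
    moreover have "norm (f (h t) - X t) \<le> norm (f (h t) - f s) + norm (X t - f s)" by norm
    ultimately show ?thesis using h1 s(2) e1(3) by simp
  qed
  ultimately show ?thesis using r unfolding X_def by blast
qed

lemma tendsto_inverse_shift: "((\<lambda>x::complex. 1 / (x - w)) \<longlongrightarrow> 0) at_infinity"
proof -
  have "filterlim (\<lambda>x::complex. x + (- w)) at_infinity at_infinity"
    by (rule tendsto_add_filterlim_at_infinity'[OF filterlim_ident tendsto_const])
  from filterlim_compose[OF tendsto_inverse_0 this] show ?thesis by (simp add: inverse_eq_divide)
qed

text \<open>Convergence is uniform along the curve, as needed for averages over whole level curves,
  and the boundary values are indexed by the parameter \<open>s\<close> instead of the point
  \<open>f s\<close>.\<close>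

definition boundary_limit :: "(complex \<Rightarrow> complex) \<Rightarrow> (complex \<Rightarrow> complex) \<Rightarrow> bool" where
  "boundary_limit E B \<longleftrightarrow> continuous_on (sphere 0 1) B \<and>
     (\<forall>e>0. \<exists>d>0. \<forall>x s. x \<notin> K \<longrightarrow> norm s = 1 \<longrightarrow> norm (x - f s) < d \<longrightarrow> norm (E x - B s) < e)"

lemma boundary_limit_continuous:
  assumes "open V" "f ` sphere 0 1 \<subseteq> V" "continuous_on V E"
  shows "boundary_limit E (\<lambda>s. E (f s))"
  unfolding boundary_limit_def
proof (intro conjI allI impI)
  have cf: "continuous_on (sphere 0 1) f" by (rule continuous_on_subset[OF cont_f]) auto
  show "continuous_on (sphere 0 1) (\<lambda>s. E (f s))"
    by (rule continuous_on_compose2[OF assms(3) cf]) (use assms(2) in auto)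
  fix e :: real assume e: "0 < e"
  have "compact (f ` sphere 0 1)" by (rule compact_continuous_image[OF cf]) auto
  moreover have "f ` sphere 0 1 \<noteq> {}" by simp
  ultimately obtain d where d: "0 < d" 
      "\<And>x y. y \<in> f ` sphere 0 1 \<Longrightarrow> norm (x - y) < d \<Longrightarrow> x \<in> V \<and> norm (E x - E y) < e"
    by (rule uniform_near_compact[OF _ _ assms e]) blast
  show "\<exists>d>0. \<forall>x s. x \<notin> K \<longrightarrow> norm s = 1 \<longrightarrow> norm (x - f s) < d \<longrightarrow> norm (E x - E (f s)) < e"
    using d by (intro exI[of _ d]) auto
qed

lemma boundary_limit_inverse:
  assumes "w \<notin> f ` sphere 0 1"
  shows "boundary_limit (\<lambda>x. 1 / (x - w) ^ k) (\<lambda>s. 1 / (f s - w) ^ k)"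
  by (rule boundary_limit_continuous[of "- {w}"]) (use assms in \<open>auto intro!: continuous_intros\<close>)

end

text \<open>\<open>h n\<close> replaces the level curve \<open>\<phi> (cis t / r n)\<close> by nearby boundary points \<open>f (h n t)\<close>; \<open>c\<close> is a subsequential
  limit of the Cauchy integrals of the resulting measures on the circle.\<close>

locale welding_approximation = conformal_welding +
  fixes r :: "nat \<Rightarrow> real" and h :: "nat \<Rightarrow> real \<Rightarrow> complex" and c :: "complex \<Rightarrow> complex"
  assumes r: "\<And>n. 0 < r n" "\<And>n. r n < 1" "r \<longlonglongrightarrow> 1"
    and ch: "\<And>n. continuous_on {0..2*pi} (h n)" and nh: "\<And>n t. norm (h n t) = 1"
    and approx: "\<And>e. 0 < e \<Longrightarrow> \<forall>\<^sub>F n in sequentially. \<forall>t. norm (f (h n t) - \<phi> (1 / (of_real (r n) * cis t))) < e"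
    and hol_c: "c holomorphic_on ball 0 1"
    and conv: "\<And>C. compact C \<Longrightarrow> C \<subseteq> ball 0 1 \<Longrightarrow> uniform_limit C (\<lambda>n z. avg (\<lambda>t. 1 / (h n t - z))) c sequentially"
begin

lemma continuous_on_h: "continuous_on (sphere 0 1) B \<Longrightarrow> continuous_on {0..2*pi} (\<lambda>t. B (h n t))"
  by (rule continuous_on_compose2[OF _ ch]) (use nh in auto)

text \<open>\<open>E\<close> on the level curve and \<open>B\<close> on its projection
  \<open>h n\<close> differ uniformly little, since \<open>f (h n t)\<close> is close to the level
  curve.\<close>

lemma avg_boundary_limit:
  assumes B: "boundary_limit E B"
    and E: "\<forall>\<^sub>F n in sequentially. continuous_on {0..2*pi} (\<lambda>t. E (\<phi> (1 / (of_real (r n) * cis t)))) \<and>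
       avg (\<lambda>t. E (\<phi> (1 / (of_real (r n) * cis t)))) = L"
  shows "(\<lambda>n. avg (\<lambda>t. B (h n t))) \<longlonglongrightarrow> L"
  unfolding tendsto_iff
proof (intro allI impI)
  fix e :: real assume e: "0 < e"
  have cB: "continuous_on (sphere 0 1) B" using B unfolding boundary_limit_def by blast
  obtain d where d: "d > 0" "\<And>x s. x \<notin> K \<Longrightarrow> norm s = 1 \<Longrightarrow> norm (x - f s) < d \<Longrightarrow> norm (E x - B s) < e / 2"
    using B e unfolding boundary_limit_def by (meson half_gt_zero)
  show "\<forall>\<^sub>F n in sequentially. dist (avg (\<lambda>t. B (h n t))) L < e"
    using approx[OF d(1)] E
  proof eventually_elim
    case (elim n)
    let ?X = "\<lambda>t. \<phi> (1 / (of_real (r n) * cis t))"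
    have "norm (avg (\<lambda>t. B (h n t) - E (?X t))) \<le> e / 2"
    proof (rule norm_avg_le_const)
      show "continuous_on {0..2*pi} (\<lambda>t. B (h n t) - E (?X t))"
        using elim by (intro continuous_on_diff continuous_on_h[OF cB]) auto
      fix t
      have "?X t \<notin> K" by (rule phi_inverse_notin) (use circle_in_punctured[OF r(1,2)] in auto)
      moreover have "norm (?X t - f (h n t)) < d" using elim by (simp add: norm_minus_commute)
      ultimately have "norm (E (?X t) - B (h n t)) < e / 2" using d(2) nh by blast
      then show "norm (B (h n t) - E (?X t)) \<le> e / 2" by (simp add: norm_minus_commute)
    qed
    moreover have "avg (\<lambda>t. B (h n t) - E (?X t)) = avg (\<lambda>t. B (h n t)) - L"
      using elim avg_diff[OF continuous_on_h[OF cB], of "\<lambda>t. E (?X t)" n] by simp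
    ultimately show ?case using e by (simp add: dist_norm)
  qed
qed

text \<open>The kernel is holomorphic outside \<open>K\<close> and vanishes at infinity, so its
  averages over level curves are 0. A multiple of it can therefore be subtracted from the double
  pole \<open>1 / (s - z)^2\<close> without changing the limit.\<close>

lemma avg_inverse_square_tendsto_0:
  assumes z: "norm z < 1"
  shows "(\<lambda>n. avg (\<lambda>t. 1 / (f (h n t) - f z)\<^sup>2)) \<longlonglongrightarrow> 0"
proof (rule avg_boundary_limit[of "\<lambda>x. 1 / (x - f z)\<^sup>2" "\<lambda>s. 1 / (f s - f z)\<^sup>2"])
  have "f z \<notin> f ` sphere 0 1" using f_neq[of z] z by force
  then show "boundary_limit (\<lambda>x. 1 / (x - f z)\<^sup>2) (\<lambda>s. 1 / (f s - f z)\<^sup>2)" by (rule boundary_limit_inverse)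
  have hE: "(\<lambda>x. 1 / (x - f z)\<^sup>2) holomorphic_on - K"
    using z by (intro holomorphic_intros) force
  have lE: "((\<lambda>x. 1 / (x - f z)\<^sup>2) \<longlongrightarrow> 0) at_infinity"
    using tendsto_power[OF tendsto_inverse_shift[of "f z"], of 2] by (simp add: power_one_over)
  have "continuous_on {0..2*pi} (\<lambda>t. 1 / (\<phi> (1 / (of_real (r n) * cis t)) - f z)\<^sup>2)" for n
  proof -
    have "\<phi> (1 / (of_real (r n) * cis t)) - f z \<noteq> 0" for t
      using phi_inverse_notin[of "of_real (r n) * cis t"] circle_in_punctured[OF r(1,2), of n t] z by force
    then show ?thesis by (intro continuous_intros continuous_on_phi_circle r) auto
  qed
  then show "\<forall>\<^sub>F n in sequentially. continuous_on {0..2*pi} (\<lambda>t. 1 / (\<phi> (1 / (of_real (r n) * cis t)) - f z)\<^sup>2) \<and>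
       avg (\<lambda>t. 1 / (\<phi> (1 / (of_real (r n) * cis t)) - f z)\<^sup>2) = 0"
    using avg_phi_circle[OF hE lE r(1,2)] by simp
qed

definition u :: "complex \<Rightarrow> real" where "u z = 1 + 2 * Re (z * c z)"

lemma c_tendsto:
  assumes "norm z < 1" shows "(\<lambda>n. avg (\<lambda>t. 1 / (h n t - z))) \<longlonglongrightarrow> c z"
  using tendsto_uniform_limitI[OF conv[of "{z}"], of z] assms by simp

lemma u_tendsto:
  assumes "norm z < 1" shows "(\<lambda>n. avg (\<lambda>t. poisson z (h n t))) \<longlonglongrightarrow> u z"
  unfolding avg_poisson_eq[OF ch nh assms] u_def by (intro tendsto_intros c_tendsto assms)

lemma u_nonneg:
  assumes "norm z < 1" shows "0 \<le> u z"
proof (rule LIMSEQ_le_const[OF u_tendsto[OF assms]], intro exI[of _ 0] allI impI)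
  fix n
  have "avg (\<lambda>t. 0::real) \<le> avg (\<lambda>t. poisson z (h n t))"
    using assms by (intro avg_mono continuous_on_poisson ch nh poisson_nonneg) auto
  then show "0 \<le> avg (\<lambda>t. poisson z (h n t))" by simp
qed

lemma c_bound:
  assumes "norm z < 1" shows "norm (c z) \<le> 1 / (1 - norm z)"
proof (rule LIMSEQ_le_const2[OF tendsto_norm[OF c_tendsto[OF assms]]], intro exI[of _ 0] allI impI)
  fix n
  have ne: "1 - norm z \<le> norm (h n t - z)" for t using norm_triangle_ineq2[of "h n t" z] nh[of n t] by simp
  have nz: "h n t - z \<noteq> 0" for t using ne[of t] assms by auto
  show "norm (avg (\<lambda>t. 1 / (h n t - z))) \<le> 1 / (1 - norm z)"
  proof (rule norm_avg_le_const)
    show "continuous_on {0..2*pi} (\<lambda>t. 1 / (h n t - z))" using nz by (intro continuous_intros ch) auto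
    show "norm (1 / (h n t - z)) \<le> 1 / (1 - norm z)" for t
      unfolding norm_divide using ne[of t] assms by (intro frac_le) auto
  qed
qed

lemma higher_deriv_c_tendsto:
  assumes z: "norm z < 1"
  shows "(\<lambda>n. avg (\<lambda>t. 1 / (h n t - z) ^ Suc j)) \<longlonglongrightarrow> (deriv ^^ j) c z / fact j"
proof -
  define R where "R = (1 + norm z) / 2"
  have R: "norm z < R" "R < 1" using z by (auto simp: R_def)
  have "(\<lambda>n. (deriv ^^ j) (\<lambda>z. avg (\<lambda>t. 1 / (h n t - z))) z) \<longlonglongrightarrow> (deriv ^^ j) c z"
  proof (rule higher_deriv_complex_uniform_limit[where A = "ball 0 R"])
    show "uniform_limit (ball 0 R) (\<lambda>n z. avg (\<lambda>t. 1 / (h n t - z))) c sequentially"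
      by (rule uniform_limit_on_subset[OF conv[of "cball 0 R"]]) (use R in auto)
    show "\<forall>\<^sub>F n in sequentially. (\<lambda>z. avg (\<lambda>t. 1 / (h n t - z))) holomorphic_on ball 0 R"
      by (intro always_eventually allI holomorphic_on_subset[OF cauchy_avg_holomorphic[OF ch nh]]) (use R in auto)
  qed (use R in auto)
  then have "(\<lambda>n. fact j * avg (\<lambda>t. 1 / (h n t - z) ^ Suc j)) \<longlonglongrightarrow> (deriv ^^ j) c z"
    unfolding cauchy_avg_higher_deriv[OF ch nh z] .
  then have "(\<lambda>n. (fact j * avg (\<lambda>t. 1 / (h n t - z) ^ Suc j)) / fact j) \<longlonglongrightarrow> (deriv ^^ j) c z / fact j"
    by (rule tendsto_divide[OF _ tendsto_const]) simp
  then show ?thesis by simp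
qed

text \<open>After the subtraction of the vanishing average only the weakly singular kernel is left.
  Its dyadic bound involves \<open>u\<close> only on the same radius and at heights
  \<open>2^k * \<delta>\<close> of at least \<open>\<delta>\<close>, which is what allows the
  absorption below.\<close>

lemma deriv_c_le_dyadic:
  obtains C where "0 \<le> C" "\<And>s \<delta>. norm s = 1 \<Longrightarrow> 0 < \<delta> \<Longrightarrow> \<delta> \<le> 1 \<Longrightarrow>
    norm (deriv c (of_real (1 - \<delta>) * s)) \<le>
      C * (1 + 9 * (\<Sum>k | 2^k * \<delta> \<le> 1. (2^k * \<delta>) powr (a - 1) * u (of_real (1 - 2^k * \<delta>) * s)))"
proof -
  obtain C where C: "0 \<le> C" "\<And>s z. norm s = 1 \<Longrightarrow> norm z < 1 \<Longrightarrow>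
     norm (1 / (s - z)\<^sup>2 - (f1 z)\<^sup>2 / (f s - f z)\<^sup>2) \<le> C * norm (s - z) powr (a - 2)"
    by (rule kernel_diff) blast
  have "norm (deriv c (of_real (1 - \<delta>) * s)) \<le>
      C * (1 + 9 * (\<Sum>k | 2^k * \<delta> \<le> 1. (2^k * \<delta>) powr (a - 1) * u (of_real (1 - 2^k * \<delta>) * s)))"
    if s: "norm s = 1" and \<delta>: "0 < \<delta>" "\<delta> \<le> 1" for s \<delta>
  proof -
    define z where "z = of_real (1 - \<delta>) * s"
    have nz: "norm (of_real (1-\<tau>) * s) = 1 - \<tau>" if "0 < \<tau>" "\<tau> \<le> 1" for \<tau>
      using that s by (simp only: norm_mult norm_of_real) simp
    have z: "norm z < 1" using nz[OF \<delta>] \<delta> by (simp add: z_def)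
    have zk: "norm (of_real (1 - 2^k * \<delta>) * s) < 1" if "2^k * \<delta> \<le> 1" for k
      using nz[of "2^k * \<delta>"] that \<delta> by simp
    have ne: "h n t - z \<noteq> 0" for n t using nh[of n t] z by auto
    have fne: "f (h n t) - f z \<noteq> 0" for n t
    proof -
      have "h n t \<noteq> z" using ne[of n t] by auto
      then show ?thesis using f_neq[of "h n t" z] nh[of n t] z by simp
    qed
    have cfh: "continuous_on {0..2*pi} (\<lambda>t. f (h n t))" for n
      by (rule continuous_on_h[OF continuous_on_subset[OF cont_f]]) auto
    have lim1: "(\<lambda>n. avg (\<lambda>t. 1 / (h n t - z)\<^sup>2)) \<longlonglongrightarrow> deriv c z"
      using higher_deriv_c_tendsto[OF z, of 1] by (simp add: numeral_2_eq_2)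
    have lim2: "(\<lambda>n. (f1 z)\<^sup>2 * avg (\<lambda>t. 1 / (f (h n t) - f z)\<^sup>2)) \<longlonglongrightarrow> 0"
      using tendsto_mult_right_zero[OF avg_inverse_square_tendsto_0[OF z]] by simp
    have L1: "(\<lambda>n. norm (avg (\<lambda>t. 1 / (h n t - z)\<^sup>2) - (f1 z)\<^sup>2 * avg (\<lambda>t. 1 / (f (h n t) - f z)\<^sup>2))) \<longlonglongrightarrow> norm (deriv c z - 0)"
      by (intro tendsto_norm tendsto_diff lim1 lim2)
    have L2: "(\<lambda>n. C * (1 + 9 * (\<Sum>k | 2^k * \<delta> \<le> 1. (2^k * \<delta>) powr (a - 1) * avg (\<lambda>t. poisson (of_real (1 - 2^k * \<delta>) * s) (h n t)))))
       \<longlonglongrightarrow> C * (1 + 9 * (\<Sum>k | 2^k * \<delta> \<le> 1. (2^k * \<delta>) powr (a - 1) * u (of_real (1 - 2^k * \<delta>) * s)))"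
      by (intro tendsto_mult tendsto_add tendsto_const tendsto_sum u_tendsto zk) auto
    have le: "norm (avg (\<lambda>t. 1 / (h n t - z)\<^sup>2) - (f1 z)\<^sup>2 * avg (\<lambda>t. 1 / (f (h n t) - f z)\<^sup>2)) \<le>
       C * (1 + 9 * (\<Sum>k | 2^k * \<delta> \<le> 1. (2^k * \<delta>) powr (a - 1) * avg (\<lambda>t. poisson (of_real (1 - 2^k * \<delta>) * s) (h n t))))" for n
    proof -
      have "avg (\<lambda>t. 1 / (h n t - z)\<^sup>2) - (f1 z)\<^sup>2 * avg (\<lambda>t. 1 / (f (h n t) - f z)\<^sup>2) =
         avg (\<lambda>t. 1 / (h n t - z)\<^sup>2 - (f1 z)\<^sup>2 * (1 / (f (h n t) - f z)\<^sup>2))"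
        using ne fne by (subst avg_diff) (auto intro!: continuous_intros ch cfh simp: avg_mult_right simp del: times_divide_eq_right)
      also have "norm \<dots> \<le> avg (\<lambda>t. C * norm (h n t - z) powr (a - 2))"
      proof (rule norm_avg_le)
        show "continuous_on {0..2*pi} (\<lambda>t. 1 / (h n t - z)\<^sup>2 - (f1 z)\<^sup>2 * (1 / (f (h n t) - f z)\<^sup>2))"
          using ne fne by (intro continuous_intros ch cfh) auto
        show "continuous_on {0..2*pi} (\<lambda>t. C * norm (h n t - z) powr (a - 2))"
          using ne by (intro continuous_intros ch) auto
        show "norm (1 / (h n t - z)\<^sup>2 - (f1 z)\<^sup>2 * (1 / (f (h n t) - f z)\<^sup>2)) \<le> C * norm (h n t - z) powr (a - 2)" for t
          using C(2)[OF nh z, of n t] by simp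
      qed
      also have "\<dots> = C * avg (\<lambda>t. norm (h n t - z) powr (a - 2))" by (rule avg_mult_right_real)
      also have "\<dots> \<le> C * (1 + 9 * (\<Sum>k | 2^k * \<delta> \<le> 1. (2^k * \<delta>) powr (a - 1) * avg (\<lambda>t. poisson (of_real (1 - 2^k * \<delta>) * s) (h n t))))"
        unfolding z_def by (rule mult_left_mono[OF avg_powr_le_dyadic[OF a ch nh s \<delta>] C(1)])
      finally show ?thesis .
    qed
    have "norm (deriv c z - 0) \<le> C * (1 + 9 * (\<Sum>k | 2^k * \<delta> \<le> 1. (2^k * \<delta>) powr (a - 1) * u (of_real (1 - 2^k * \<delta>) * s)))"
      by (rule LIMSEQ_le[OF L1 L2]) (use le in blast)
    then show ?thesis unfolding z_def diff_zero .
  qed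
  then show ?thesis using that C(1) by blast
qed

text \<open>Absorption: on \<open>\<bar>z\<bar> \<le> 1 - \<delta>\<close> the supremum \<open>m\<close> of \<open>u\<close> bounds \<open>c'\<close> by a multiple of \<open>1 + m\<close> times an integrable
  weight, hence \<open>u\<close> itself by a constant plus \<open>m / 2\<close>.\<close>

lemma u_bounded:
  obtains m where "0 \<le> m" "\<And>z. norm z < 1 \<Longrightarrow> u z \<le> m"
proof -
  obtain C where C: "0 \<le> C" "\<And>s \<delta>. norm s = 1 \<Longrightarrow> 0 < \<delta> \<Longrightarrow> \<delta> \<le> 1 \<Longrightarrow>
    norm (deriv c (of_real (1 - \<delta>) * s)) \<le>
      C * (1 + 9 * (\<Sum>k | 2^k * \<delta> \<le> 1. (2^k * \<delta>) powr (a - 1) * u (of_real (1 - 2^k * \<delta>) * s)))"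
    by (rule deriv_c_le_dyadic) blast
  define q where "q = 1 + 9 / (1 - 2 powr (a - 1))"
  have "(2::real) powr (a - 1) < 1" using a by (simp add: powr_less_one)
  then have q: "1 \<le> q" by (simp add: q_def)
  define C1 where "C1 = C * q"
  have C1: "0 \<le> C1" using C(1) q by (simp add: C1_def)
  \<comment> \<open>In the layer of height \<open>\<tau>\<close> the weight
    \<open>C1 * t powr (a - 1)\<close> has integral \<open>C1 / a * \<tau> powr a\<close>;
    \<open>\<tau>\<close> is so small that twice this is at most \<open>1/2\<close>.\<close>
  define \<tau> where "\<tau> = min (1/2) ((a / (4 * (C1 + 1))) powr (1 / a))"
  have \<tau>: "0 < \<tau>" "\<tau> \<le> 1/2" using a C1 by (auto simp: \<tau>_def)
  have \<tau>a: "2 * (C1 / a * \<tau> powr a) \<le> 1/2"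
  proof -
    have "\<tau> powr a \<le> ((a / (4 * (C1 + 1))) powr (1 / a)) powr a"
      using \<tau> a by (intro powr_mono2) (auto simp: \<tau>_def)
    also have "\<dots> = a / (4 * (C1 + 1))" using a C1 by (simp add: powr_powr)
    finally have "2 * (C1 / a * \<tau> powr a) \<le> 2 * (C1 / a * (a / (4 * (C1 + 1))))"
      using C1 a by (intro mult_left_mono) auto
    also have "\<dots> \<le> 1/2" using a C1 by (simp add: field_simps)
    finally show ?thesis .
  qed
  \<comment> \<open>This value solves \<open>m = 1 + 2 / \<tau> + (1 + m) / 2\<close>.\<close>
  have main: "u z \<le> 3 + 4 / \<tau>" if z: "norm z < 1" for z
  proof -
    define d where "d = 1 - norm z"
    have d: "0 < d" "d \<le> 1" using z by (auto simp: d_def)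
    \<comment> \<open>Working on a smaller closed disc makes the maximum of \<open>u\<close> finite
      beforehand, without which nothing could be absorbed. The resulting bound is independent of
      \<open>d\<close>.\<close>
    have cc: "continuous_on (cball 0 (1 - d)) u" unfolding u_def
      by (intro continuous_intros continuous_on_subset[OF holomorphic_on_imp_continuous_on[OF hol_c]]) (use d in auto)
    have "z \<in> cball 0 (1 - d)" by (simp add: d_def)
    then obtain z0 where z0: "z0 \<in> cball 0 (1 - d)" "\<And>y. y \<in> cball 0 (1 - d) \<Longrightarrow> u y \<le> u z0"
      using continuous_attains_sup[OF compact_cball _ cc] by blast
    define m where "m = u z0"
    have m0: "0 \<le> m" unfolding m_def using u_nonneg z0(1) d by auto
    have dc: "norm (deriv c (of_real (1 - \<delta>) * s)) \<le> C1 * (1 + m) * \<delta> powr (a - 1)"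
      if s: "norm s = 1" and \<delta>: "d \<le> \<delta>" "\<delta> \<le> 1" for s \<delta>
    proof -
      have \<delta>0: "0 < \<delta>" using \<delta> d by simp
      have "(\<Sum>k | 2^k * \<delta> \<le> 1. (2^k * \<delta>) powr (a - 1) * u (of_real (1 - 2^k * \<delta>) * s)) \<le>
         (\<Sum>k | 2^k * \<delta> \<le> 1. (2^k * \<delta>) powr (a - 1) * m)"
      proof (intro sum_mono mult_left_mono)
        fix k assume k: "k \<in> {k. 2^k * \<delta> \<le> 1}"
        have "1 * \<delta> \<le> 2^k * \<delta>" using \<delta>0 by (intro mult_right_mono) auto
        then have "norm (of_real (1 - 2^k * \<delta>) * s) \<le> 1 - d"
          using k s \<delta> by (simp only: norm_mult norm_of_real) simp
        then show "u (of_real (1 - 2^k * \<delta>) * s) \<le> m" unfolding m_def by (intro z0(2)) (simp only: mem_cball_0)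
      qed auto
      also have "\<dots> = (\<Sum>k | 2^k * \<delta> \<le> 1. (2^k * \<delta>) powr (a - 1)) * m" by (simp add: sum_distrib_right)
      also have "\<dots> \<le> (\<delta> powr (a - 1) / (1 - 2 powr (a - 1))) * m"
        by (rule mult_right_mono[OF sum_dyadic_powr_le[OF a(2) \<delta>0] m0])
      finally have 1: "(\<Sum>k | 2^k * \<delta> \<le> 1. (2^k * \<delta>) powr (a - 1) * u (of_real (1 - 2^k * \<delta>) * s)) \<le>
         \<delta> powr (a - 1) / (1 - 2 powr (a - 1)) * m" .
      have 2: "1 \<le> \<delta> powr (a - 1)" using \<delta> \<delta>0 a powr_mono'[of "a - 1" 0 \<delta>] by simp
      have "norm (deriv c (of_real (1 - \<delta>) * s)) \<le> C * (1 + 9 * (\<delta> powr (a - 1) / (1 - 2 powr (a - 1)) * m))"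
        by (rule order_trans[OF C(2)[OF s \<delta>0 \<delta>(2)] mult_left_mono[OF _ C(1)]]) (use 1 in linarith)
      also have "\<dots> \<le> C * (\<delta> powr (a - 1) * (1 + m) + 9 * (\<delta> powr (a - 1) / (1 - 2 powr (a - 1)) * (1 + m)))"
      proof (intro mult_left_mono add_mono C(1))
        show "1 \<le> \<delta> powr (a - 1) * (1 + m)" using 2 m0 mult_mono[of 1 "\<delta> powr (a - 1)" 1 "1 + m"] by simp
        show "m \<le> 1 + m" by simp
        show "0 \<le> \<delta> powr (a - 1) / (1 - 2 powr (a - 1))" using \<open>(2::real) powr (a - 1) < 1\<close> by simp
      qed auto
      also have "\<dots> = C1 * (1 + m) * \<delta> powr (a - 1)" by (simp add: C1_def q_def algebra_simps)
      finally show ?thesis .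
    qed
    have nn: "0 \<le> C1 * (1 + m) / a * x powr a" for x
      by (intro mult_nonneg_nonneg divide_nonneg_pos) (use C1 m0 a in auto)
    \<comment> \<open>At heights above \<open>\<tau>\<close> the crude bound for \<open>c\<close> is
      enough; below, \<open>c'\<close> is integrated along the radius starting from height
      \<open>\<tau>\<close>.\<close>
    have cb: "norm (c (of_real (1 - \<delta>) * s)) \<le> 1 / \<tau> + C1 * (1 + m) / a * \<tau> powr a"
      if s: "norm s = 1" and \<delta>: "d \<le> \<delta>" "\<delta> \<le> 1" for s \<delta>
    proof (cases "\<tau> \<le> \<delta>")
      case True
      have n: "norm (of_real (1 - \<delta>) * s) = 1 - \<delta>" using \<delta> s by (simp only: norm_mult norm_of_real) simp
      then have "norm (of_real (1 - \<delta>) * s) < 1" using \<delta> d by linarith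
      then have "norm (c (of_real (1 - \<delta>) * s)) \<le> 1 / (1 - norm (of_real (1 - \<delta>) * s))" by (rule c_bound)
      then have "norm (c (of_real (1 - \<delta>) * s)) \<le> 1 / \<delta>" unfolding n by simp
      also have "\<dots> \<le> 1 / \<tau>" using True \<tau> by (intro divide_left_mono) auto
      finally show ?thesis using nn[of \<tau>] by linarith
    next
      case False
      have \<delta>0: "0 < \<delta>" using \<delta> d by simp
      have n: "norm (of_real (1 - t) * s) = 1 - t" if "t \<le> 1" for t using that s by (simp only: norm_mult norm_of_real) simp
      have der: "((\<lambda>t. c (of_real (1 - t) * s)) has_vector_derivative - s * deriv c (of_real (1 - t) * s)) (at t)" if "\<delta> \<le> t" "t \<le> \<tau>" for t
      proof -
        have "(c has_field_derivative deriv c (of_real (1 - t) * s)) (at ((1 - of_real t) * s))"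
          using holomorphic_derivI[OF hol_c, of "of_real (1 - t) * s"] n[of t] that \<tau> \<delta>0 by simp
        then have "((\<lambda>x. c ((1 - x) * s)) has_field_derivative deriv c (of_real (1 - t) * s) * (- s)) (at (of_real t))"
          by (rule DERIV_chain2) (auto intro!: derivative_eq_intros)
        from has_vector_derivative_real_field[OF this] show ?thesis by (simp add: mult.commute)
      qed
      have "norm ((\<lambda>t. c (of_real (1 - t) * s)) \<tau> - (\<lambda>t. c (of_real (1 - t) * s)) \<delta>) \<le>
        (\<lambda>t. C1 * (1 + m) / a * t powr a) \<tau> - (\<lambda>t. C1 * (1 + m) / a * t powr a) \<delta>"
      proof (rule differentiable_bound_general)
        show "\<delta> < \<tau>" using False by simp
        show "continuous_on {\<delta>..\<tau>} (\<lambda>t. c (of_real (1 - t) * s))"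
          using has_vector_derivative_continuous[OF der] by (intro continuous_at_imp_continuous_on) auto
        show "continuous_on {\<delta>..\<tau>} (\<lambda>t. C1 * (1 + m) / a * t powr a)"
          using a \<delta>0 by (intro continuous_intros) auto
        fix t assume t: "\<delta> < t" "t < \<tau>"
        show "((\<lambda>t. c (of_real (1 - t) * s)) has_vector_derivative - s * deriv c (of_real (1 - t) * s)) (at t)"
          using der t by auto
        show "((\<lambda>t. C1 * (1 + m) / a * t powr a) has_vector_derivative C1 * (1 + m) * t powr (a - 1)) (at t)"
          unfolding has_real_derivative_iff_has_vector_derivative[symmetric]
          using t \<delta>0 a by (auto intro!: derivative_eq_intros)
        show "norm (- s * deriv c (of_real (1 - t) * s)) \<le> C1 * (1 + m) * t powr (a - 1)"
          using dc[OF s, of t] t \<delta> \<tau> s by (simp add: norm_mult)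
      qed
      then have "norm (c (of_real (1 - \<tau>) * s) - c (of_real (1 - \<delta>) * s)) \<le> C1 * (1 + m) / a * \<tau> powr a"
        using nn[of \<delta>] by linarith
      moreover have "norm (c (of_real (1 - \<tau>) * s)) \<le> 1 / \<tau>"
      proof -
        have n\<tau>: "norm (of_real (1 - \<tau>) * s) = 1 - \<tau>" by (rule n) (use \<tau> in simp)
        then have "norm (of_real (1 - \<tau>) * s) < 1" using \<tau> by linarith
        then have "norm (c (of_real (1 - \<tau>) * s)) \<le> 1 / (1 - norm (of_real (1 - \<tau>) * s))" by (rule c_bound)
        then show ?thesis unfolding n\<tau> by simp
      qed
      moreover have "norm (c (of_real (1 - \<delta>) * s)) \<le> norm (c (of_real (1 - \<tau>) * s)) + norm (c (of_real (1 - \<tau>) * s) - c (of_real (1 - \<delta>) * s))"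
        by norm
      ultimately show ?thesis by linarith
    qed
    have "m \<le> 1 + 2 * (1 / \<tau> + C1 * (1 + m) / a * \<tau> powr a)"
    proof -
      define s where "s = (if z0 = 0 then 1 else sgn z0)"
      have s: "norm s = 1" by (simp add: s_def norm_sgn)
      have z0s: "z0 = of_real (1 - (1 - norm z0)) * s" by (simp add: s_def sgn_eq)
      have nz0: "norm z0 \<le> 1 - d" using z0(1) by simp
      have "norm (c (of_real (1 - (1 - norm z0)) * s)) \<le> 1 / \<tau> + C1 * (1 + m) / a * \<tau> powr a"
        by (rule cb[OF s]) (use nz0 in auto)
      then have cz0: "norm (c z0) \<le> 1 / \<tau> + C1 * (1 + m) / a * \<tau> powr a" unfolding z0s[symmetric] .
      have "Re (z0 * c z0) \<le> norm (c z0)"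
      proof -
        have "Re (z0 * c z0) \<le> norm z0 * norm (c z0)" using complex_Re_le_cmod[of "z0 * c z0"] by (simp add: norm_mult)
        also have "\<dots> \<le> 1 * norm (c z0)" using nz0 d by (intro mult_right_mono) auto
        finally show ?thesis by simp
      qed
      then have "m \<le> 1 + 2 * norm (c z0)" unfolding m_def u_def by linarith
      also have "\<dots> \<le> 1 + 2 * (1 / \<tau> + C1 * (1 + m) / a * \<tau> powr a)"
        by (intro add_left_mono mult_left_mono cz0) simp
      finally show ?thesis .
    qed
    also have "\<dots> = 1 + 2 / \<tau> + (2 * (C1 / a * \<tau> powr a)) * (1 + m)" by (simp add: field_simps)
    also have "\<dots> \<le> 1 + 2 / \<tau> + 1/2 * (1 + m)" using mult_right_mono[OF \<tau>a, of "1 + m"] m0 by simp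
    finally have "m \<le> 1 + 2 / \<tau> + 1/2 * (1 + m)" .
    moreover have "4 / \<tau> = 2 * (2 / \<tau>)" by simp
    ultimately have "m \<le> 3 + 4 / \<tau>" by argo
    moreover have "u z \<le> m" unfolding m_def by (rule z0(2)) fact
    ultimately show ?thesis by simp
  qed
  show ?thesis by (rule that[of "3 + 4 / \<tau>"]) (use main \<tau> in auto)
qed

lemma deriv_c_bound:
  obtains C where "\<And>z. norm z < 1 \<Longrightarrow> norm (deriv c z) \<le> C * (1 - norm z) powr (a - 1)"
proof -
  obtain C where C: "0 \<le> C" "\<And>s \<delta>. norm s = 1 \<Longrightarrow> 0 < \<delta> \<Longrightarrow> \<delta> \<le> 1 \<Longrightarrow>
    norm (deriv c (of_real (1 - \<delta>) * s)) \<le>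
      C * (1 + 9 * (\<Sum>k | 2^k * \<delta> \<le> 1. (2^k * \<delta>) powr (a - 1) * u (of_real (1 - 2^k * \<delta>) * s)))"
    by (rule deriv_c_le_dyadic) blast
  obtain m where m: "0 \<le> m" "\<And>z. norm z < 1 \<Longrightarrow> u z \<le> m" by (rule u_bounded) blast
  have "norm (deriv c z) \<le> (C * (1 + 9 / (1 - 2 powr (a - 1)) * m)) * (1 - norm z) powr (a - 1)" if z: "norm z < 1" for z
  proof -
    define \<delta> where "\<delta> = 1 - norm z"
    define s where "s = (if z = 0 then 1 else sgn z)"
    have s: "norm s = 1" by (simp add: s_def norm_sgn)
    have zs: "z = of_real (1 - \<delta>) * s" by (simp add: s_def sgn_eq \<delta>_def)
    have \<delta>: "0 < \<delta>" "\<delta> \<le> 1" using z by (auto simp: \<delta>_def)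
    have "(\<Sum>k | 2^k * \<delta> \<le> 1. (2^k * \<delta>) powr (a - 1) * u (of_real (1 - 2^k * \<delta>) * s)) \<le>
         (\<Sum>k | 2^k * \<delta> \<le> 1. (2^k * \<delta>) powr (a - 1) * m)"
    proof (intro sum_mono mult_left_mono m)
      fix k assume k: "k \<in> {k. 2^k * \<delta> \<le> 1}"
      have "0 < 2^k * \<delta>" using \<delta> by simp
      then show "norm (of_real (1 - 2^k * \<delta>) * s) < 1"
        using k s by (simp only: norm_mult norm_of_real) simp
    qed auto
    also have "\<dots> = (\<Sum>k | 2^k * \<delta> \<le> 1. (2^k * \<delta>) powr (a - 1)) * m" by (simp add: sum_distrib_right)
    also have "\<dots> \<le> (\<delta> powr (a - 1) / (1 - 2 powr (a - 1))) * m"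
      by (rule mult_right_mono[OF sum_dyadic_powr_le[OF a(2) \<delta>(1)] m(1)])
    finally have 1: "(\<Sum>k | 2^k * \<delta> \<le> 1. (2^k * \<delta>) powr (a - 1) * u (of_real (1 - 2^k * \<delta>) * s)) \<le>
         \<delta> powr (a - 1) / (1 - 2 powr (a - 1)) * m" .
    have 2: "1 \<le> \<delta> powr (a - 1)" using \<delta> a powr_mono'[of "a - 1" 0 \<delta>] by simp
    have "norm (deriv c z) \<le> C * (1 + 9 * (\<Sum>k | 2^k * \<delta> \<le> 1. (2^k * \<delta>) powr (a - 1) * u (of_real (1 - 2^k * \<delta>) * s)))"
      using C(2)[OF s \<delta>] zs by simp
    also have "\<dots> \<le> C * (\<delta> powr (a - 1) + 9 * (\<delta> powr (a - 1) / (1 - 2 powr (a - 1)) * m))"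
      using 1 2 by (intro mult_left_mono add_mono C(1)) auto
    finally show ?thesis by (simp add: \<delta>_def algebra_simps)
  qed
  then show ?thesis using that by blast
qed

end

context conformal_welding
begin

text \<open>A density of the harmonic measure: it is tested only on functions whose averages over the level curves
  \<open>\<phi> (cis t / r)\<close> do not depend on \<open>r\<close>, so that subsequential limits suffice.\<close>

definition welding_density :: "(complex \<Rightarrow> real) \<Rightarrow> bool" where
  "welding_density p \<longleftrightarrow> (\<forall>s. norm s = 1 \<longrightarrow> 0 \<le> p s) \<and>
     (\<exists>C. \<forall>s y. norm s = 1 \<longrightarrow> norm y = 1 \<longrightarrow> \<bar>p y - p s\<bar> \<le> C * norm (y - s) powr a) \<and>
     (\<forall>E B L. boundary_limit E B \<longrightarrow>
        (\<exists>r0<1. \<forall>r. r0 < r \<longrightarrow> 0 < r \<longrightarrow> r < 1 \<longrightarrow>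
           continuous_on {0..2*pi} (\<lambda>t. E (\<phi> (1 / (of_real r * cis t)))) \<and>
           avg (\<lambda>t. E (\<phi> (1 / (of_real r * cis t)))) = L) \<longrightarrow>
        avg (\<lambda>t. B (cis t) * of_real (p (cis t))) = L)"

end

lemma continuous_on_holder:
  fixes g :: "complex \<Rightarrow> 'b::real_normed_vector"
  assumes "0 < a" "\<And>s y. s \<in> S \<Longrightarrow> y \<in> S \<Longrightarrow> norm (g y - g s) \<le> C * norm (y - s) powr a"
  shows "continuous_on S g"
  unfolding continuous_on_def
proof
  fix s assume s: "s \<in> S"
  have "((\<lambda>y. C * norm (y - s) powr a) \<longlongrightarrow> C * norm (s - s) powr a) (at s within S)"
    using assms(1) by (intro tendsto_intros tendsto_powr') auto
  then have "((\<lambda>y. C * norm (y - s) powr a) \<longlongrightarrow> 0) (at s within S)" by simp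
  then have "((\<lambda>y. g y - g s) \<longlongrightarrow> 0) (at s within S)"
    by (rule Lim_null_comparison[rotated]) (use assms(2) s in \<open>auto simp: eventually_at_filter\<close>)
  then show "(g \<longlongrightarrow> g s) (at s within S)" using Lim_null by blast
qed

lemma norm_diff_le_powr:
  fixes s y :: complex
  assumes "norm s \<le> 1" "norm y \<le> 1" "0 < a" "a < 1"
  shows "norm (y - s) \<le> 2 * norm (y - s) powr a"
proof -
  define x where "x = norm (y - s)"
  have x2: "0 \<le> x" "x \<le> 2" using norm_triangle_ineq4[of y s] assms by (auto simp: x_def)
  have "x powr (1 - a) \<le> 2 powr (1 - a)" using x2 assms by (intro powr_mono2) auto
  moreover have "2 powr (1 - a) \<le> (2::real) powr 1" using assms by (intro powr_mono) auto
  ultimately have "x powr a * x powr (1 - a) \<le> x powr a * 2" by (intro mult_left_mono) auto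
  then have "x \<le> x powr a * 2" using x2 by (simp only: powr_add[symmetric]) simp
  then show ?thesis by (simp add: x_def mult.commute)
qed

section \<open>Existence of the density\<close>

context welding_approximation
begin

text \<open>The density is the boundary value \<open>p\<close> of \<open>u\<close>. The Taylor
  coefficients of \<open>c\<close> at 0 are limits of the moments of \<open>inverse (h n t)\<close>,
  and they are also the corresponding moments of \<open>p\<close>; so the moments converge and the
  measures tend weakly to \<open>p\<close>.\<close>

lemma ex_density: "\<exists>p. welding_density p"
proof -
  obtain C where C: "\<And>z. norm z < 1 \<Longrightarrow> norm (deriv c z) \<le> C * (1 - norm z) powr (a - 1)"
    by (rule deriv_c_bound) blast
  have "\<exists>g C'. continuous_on (cball 0 1) g \<and> (\<forall>z. norm z < 1 \<longrightarrow> g z = c z) \<and>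
      (\<forall>x y. norm x \<le> 1 \<longrightarrow> norm y \<le> 1 \<longrightarrow> norm (g x - g y) \<le> C' * norm (x - y) powr a)"
    by (rule hardy_littlewood[OF hol_c a C]) blast+
  then obtain g C' where "continuous_on (cball 0 1) g" "\<forall>z. norm z < 1 \<longrightarrow> g z = c z"
    "\<forall>x y. norm x \<le> 1 \<longrightarrow> norm y \<le> 1 \<longrightarrow> norm (g x - g y) \<le> C' * norm (x - y) powr a"
    by blast
  then have g: "continuous_on (cball 0 1) g" "\<And>z. norm z < 1 \<Longrightarrow> g z = c z"
    "\<And>x y. norm x \<le> 1 \<Longrightarrow> norm y \<le> 1 \<Longrightarrow> norm (g x - g y) \<le> C' * norm (x - y) powr a"
    by blast+
  have hg: "g holomorphic_on ball 0 1"
    by (rule holomorphic_transform[OF hol_c]) (use g(2) in auto)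
  define p where "p = (\<lambda>s. 1 + 2 * Re (s * g s))"
  have cp: "continuous_on (cball 0 1) p" unfolding p_def by (intro continuous_intros g)
  have cp': "continuous_on (sphere 0 1) p" by (rule continuous_on_subset[OF cp]) auto
  have pos: "0 \<le> p s" if "norm s \<le> 1" for s
  proof -
    have "0 \<le> p z" if "z \<in> ball 0 1" for z using u_nonneg[of z] g(2)[of z] that by (simp add: p_def u_def)
    then show ?thesis using continuous_ge_on_closure[of "ball 0 1" p s 0] cp that by simp
  qed
  obtain G where G: "\<And>s. norm s \<le> 1 \<Longrightarrow> norm (g s) \<le> G"
  proof -
    obtain G where "\<forall>x\<in>g ` cball 0 1. norm x \<le> G"
      using compact_imp_bounded[OF compact_continuous_image[OF g(1) compact_cball]] unfolding bounded_iff by blast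
    then show ?thesis by (intro that[of G]) auto
  qed
  have G0: "0 \<le> G" using order_trans[OF norm_ge_zero G[of 0]] by simp
  have hol: "\<bar>p y - p s\<bar> \<le> (4 * G + 2 * C') * norm (y - s) powr a" if s: "norm s = 1" and y: "norm y = 1" for s y
  proof -
    have "y * g y - s * g s = (y - s) * g y + s * (g y - g s)" by (simp add: algebra_simps)
    then have "norm (y * g y - s * g s) \<le> norm (y - s) * norm (g y) + norm (g y - g s)"
      using norm_triangle_ineq[of "(y - s) * g y" "s * (g y - g s)"] s by (simp add: norm_mult)
    also have "\<dots> \<le> (2 * norm (y - s) powr a) * G + C' * norm (y - s) powr a"
      using norm_diff_le_powr[of s y a] G[of y] g(3)[of y s] s y a
      by (intro add_mono mult_mono) auto
    finally have "norm (y * g y - s * g s) \<le> (2 * G + C') * norm (y - s) powr a" by (simp add: algebra_simps)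
    moreover have "p y - p s = 2 * Re (y * g y - s * g s)" by (simp add: p_def)
    then have "\<bar>p y - p s\<bar> = 2 * \<bar>Re (y * g y - s * g s)\<bar>" by (simp only: abs_mult)
    moreover have "(4 * G + 2 * C') * norm (y - s) powr a = 2 * ((2 * G + C') * norm (y - s) powr a)"
      by (simp add: algebra_simps)
    ultimately show ?thesis using abs_Re_le_cmod[of "y * g y - s * g s"] by linarith
  qed
  have cg: "continuous_on A (\<lambda>t. g (cis t))" for A :: "real set"
    by (rule continuous_on_circle[OF continuous_on_subset[OF g(1)]]) auto
  have mv: "avg (\<lambda>t. cis t ^ k * g (cis t)) = 0" if "k \<noteq> 0" for k
  proof -
    have "avg (\<lambda>t. (\<lambda>s. s ^ k * g s) (of_real 1 * cis t)) = (\<lambda>s. s ^ k * g s) 0"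
      by (rule avg_mean_value) (auto intro!: continuous_intros g holomorphic_intros hg)
    then show ?thesis using that by simp
  qed
  have mom0: "avg (\<lambda>t. inverse (cis t) ^ k) = (if k = 0 then 1 else 0)" for k :: nat
  proof -
    have "avg (\<lambda>t. (\<lambda>s. s ^ k) (of_real 1 * cis t)) = (\<lambda>s. s ^ k) 0"
      by (rule avg_mean_value) (auto intro!: continuous_intros holomorphic_intros)
    then have "avg (\<lambda>t. cis t ^ k) = (if k = 0 then 1 else 0)" by (simp add: zero_power)
    then have "cnj (avg (\<lambda>t. cis t ^ k)) = (if k = 0 then 1 else 0)" by simp
    moreover have "cnj (avg (\<lambda>t. cis t ^ k)) = avg (\<lambda>t. inverse (cis t) ^ k)"
      by (subst avg_cnj) (auto intro!: continuous_intros simp: cis_cnj cis_inverse)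
    ultimately show ?thesis by simp
  qed
  \<comment> \<open>\<open>p\<close> is the sum of 1, \<open>s * g s\<close> and its conjugate.
    Multiplied by \<open>inverse s ^ k\<close>, the last part becomes the conjugate of a holomorphic
    function vanishing at 0 and averages to 0.\<close>
  have split: "inverse (cis t) ^ k * of_real (p (cis t)) =
      inverse (cis t) ^ k + (inverse (cis t) ^ k * (cis t * g (cis t)) + cnj (cis t ^ (k + 1) * g (cis t)))" for t k
  proof -
    have "of_real (p (cis t)) = 1 + (cis t * g (cis t) + cnj (cis t * g (cis t)))"
      by (simp add: p_def complex_eq_iff)
    moreover have "cnj (cis t) ^ k = inverse (cis t) ^ k" by (simp add: cis_cnj cis_inverse)
    ultimately show ?thesis by (simp add: algebra_simps)
  qed
  have c3: "continuous_on {0..2*pi} (\<lambda>t. inverse (cis t) ^ k)"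
      "continuous_on {0..2*pi} (\<lambda>t. inverse (cis t) ^ k * (cis t * g (cis t)))"
      "continuous_on {0..2*pi} (\<lambda>t. cnj (cis t ^ (k + 1) * g (cis t)))" for k
    by (auto intro!: continuous_intros cg)
  have mom_p: "avg (\<lambda>t. inverse (cis t) ^ k * of_real (p (cis t))) =
      (if k = 0 then 1 else avg (\<lambda>t. inverse (cis t) ^ k * (cis t * g (cis t))))" for k
  proof -
    have "avg (\<lambda>t. inverse (cis t) ^ k * of_real (p (cis t))) =
       avg (\<lambda>t. inverse (cis t) ^ k) + (avg (\<lambda>t. inverse (cis t) ^ k * (cis t * g (cis t))) + avg (\<lambda>t. cnj (cis t ^ (k + 1) * g (cis t))))"
      unfolding split by (simp only: avg_add continuous_on_add c3)
    also have "avg (\<lambda>t. cnj (cis t ^ (k + 1) * g (cis t))) = cnj (avg (\<lambda>t. cis t ^ (k + 1) * g (cis t)))"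
      by (rule avg_cnj[symmetric]) (intro continuous_intros cg)
    also have "\<dots> = 0" by (simp only: mv) simp
    finally show ?thesis using mom0[of k] mv[of 1] by auto
  qed
  have coeff: "avg (\<lambda>t. inverse (cis t) ^ Suc j * (cis t * g (cis t))) = (deriv ^^ j) c 0 / fact j" for j
  proof -
    have "(deriv ^^ j) g 0 = (deriv ^^ j) c 0"
      by (rule higher_deriv_transform_within_open[OF hg hol_c open_ball]) (use g(2) in auto)
    moreover have "avg (\<lambda>t. (\<lambda>u. g u / (u - 0) ^ Suc j) (of_real 1 * cis t) * (of_real 1 * cis t)) =
       ((2 * pi * \<i>) / fact j * (deriv ^^ j) g 0) / (2 * pi * \<i>)"
      by (rule has_contour_integral_circle[OF Cauchy_has_contour_integral_higher_derivative_circlepath])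
         (use g(1) hg in auto)
    moreover have "(\<lambda>u. g u / (u - 0) ^ Suc j) (of_real 1 * cis t) * (of_real 1 * cis t) = inverse (cis t) ^ Suc j * (cis t * g (cis t))" for t
      by (simp add: divide_inverse mult_ac flip: power_inverse)
    ultimately show ?thesis by (simp add: field_simps)
  qed
  have mom: "(\<lambda>n. avg (\<lambda>t. h n t ^ k)) \<longlonglongrightarrow> avg (\<lambda>t. cis t ^ k * of_real (p (cis t)))" for k
  proof -
    have inv: "cnj s = inverse s" if "norm s = 1" for s :: complex
      using that by (simp add: inverse_complex_def complex_eq_iff cmod_def)
    have "(\<lambda>n. avg (\<lambda>t. inverse (h n t) ^ k)) \<longlonglongrightarrow> avg (\<lambda>t. inverse (cis t) ^ k * of_real (p (cis t)))"
    proof (cases k)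
      case 0 then show ?thesis using mom_p[of 0] by simp
    next
      case (Suc j)
      have "avg (\<lambda>t. 1 / (h n t - 0) ^ Suc j) = avg (\<lambda>t. inverse (h n t) ^ k)" for n
        by (simp add: Suc divide_inverse power_inverse)
      then show ?thesis using higher_deriv_c_tendsto[of 0 j] mom_p[of k] coeff[of j] Suc by simp
    qed
    then have "(\<lambda>n. cnj (avg (\<lambda>t. inverse (h n t) ^ k))) \<longlonglongrightarrow> cnj (avg (\<lambda>t. inverse (cis t) ^ k * of_real (p (cis t))))"
      by (rule tendsto_cnj)
    moreover have "cnj (avg (\<lambda>t. inverse (h n t) ^ k)) = avg (\<lambda>t. h n t ^ k)" for n
    proof -
      have hn: "h n t \<noteq> 0" for t using nh[of n t] by auto
      have "cnj (avg (\<lambda>t. inverse (h n t) ^ k)) = avg (\<lambda>t. cnj (inverse (h n t) ^ k))"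
        by (rule avg_cnj) (use hn in \<open>auto intro!: continuous_intros ch\<close>)
      also have "\<dots> = avg (\<lambda>t. h n t ^ k)"
        by (intro avg_cong) (simp add: inv[OF nh] power_inverse)
      finally show ?thesis .
    qed
    moreover have "cnj (avg (\<lambda>t. inverse (cis t) ^ k * of_real (p (cis t)))) = avg (\<lambda>t. cis t ^ k * of_real (p (cis t)))"
    proof -
      have "cnj (avg (\<lambda>t. inverse (cis t) ^ k * of_real (p (cis t)))) = avg (\<lambda>t. cnj (inverse (cis t) ^ k * of_real (p (cis t))))"
        by (rule avg_cnj) (intro continuous_intros continuous_on_circle[OF cp'], auto)
      also have "\<dots> = avg (\<lambda>t. cis t ^ k * of_real (p (cis t)))"
        by (intro avg_cong) (simp add: inv[of "cis _"] power_inverse del: cis_inverse)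
      finally show ?thesis .
    qed
    ultimately show ?thesis by simp
  qed
  have "avg (\<lambda>t. B (cis t) * of_real (p (cis t))) = L"
    if B: "boundary_limit E B" and E: "r0 < 1" "\<And>r. r0 < r \<Longrightarrow> 0 < r \<Longrightarrow> r < 1 \<Longrightarrow>
           continuous_on {0..2*pi} (\<lambda>t. E (\<phi> (1 / (of_real r * cis t)))) \<and>
           avg (\<lambda>t. E (\<phi> (1 / (of_real r * cis t)))) = L" for E B L r0
  proof (rule LIMSEQ_unique)
    show "(\<lambda>n. avg (\<lambda>t. B (h n t))) \<longlonglongrightarrow> avg (\<lambda>t. B (cis t) * of_real (p (cis t)))"
      by (rule avg_weak_limit[OF ch nh cp' mom]) (use B in \<open>auto simp: boundary_limit_def\<close>)
    have "\<forall>\<^sub>F n in sequentially. r0 < r n" by (rule order_tendstoD(1)[OF r(3) E(1)])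
    then show "(\<lambda>n. avg (\<lambda>t. B (h n t))) \<longlonglongrightarrow> L"
      by (intro avg_boundary_limit[OF B]) (elim eventually_mono, use E(2) r in blast)
  qed
  then have "welding_density p"
    unfolding welding_density_def using pos hol by (auto intro!: exI[of _ "4 * G + 2 * C'"])
  then show ?thesis by blast
qed

end

context conformal_welding
begin

text \<open>Cauchy integrals of probability measures on the circle are bounded by
  \<open>1 / (1 - norm z)\<close>, so Montel's theorem provides the subsequence and the limit
  \<open>c\<close>.\<close>

lemma ex_welding_density: "\<exists>p. welding_density p"
proof -
  have "\<forall>n. \<exists>r h. 1 - inverse (real (Suc n)) < r \<and> 0 < r \<and> r < 1 \<and> continuous_on {0..2*pi} h \<and>
    (\<forall>t. norm (h t) = 1 \<and> norm (f (h t) - \<phi> (1 / (of_real r * cis t))) < inverse (real (Suc n)))"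
    using circle_approx by simp
  then obtain r h where rh: "\<And>n. 1 - inverse (real (Suc n)) < r n" "\<And>n. 0 < r n" "\<And>n. r n < 1"
    "\<And>n. continuous_on {0..2*pi} (h n)" "\<And>n t. norm (h n t) = 1"
    "\<And>n t. norm (f (h n t) - \<phi> (1 / (of_real (r n) * cis t))) < inverse (real (Suc n))"
    by metis
  define F where "F = (\<lambda>n z. avg (\<lambda>t. 1 / (h n t - z)))"
  define \<H> where "\<H> = {g. g holomorphic_on ball 0 1 \<and> (\<forall>z\<in>ball 0 1. norm (g z) \<le> 1 / (1 - norm z))}"
  have FH: "F n \<in> \<H>" for n
  proof -
    have "norm (F n z) \<le> 1 / (1 - norm z)" if z: "norm z < 1" for z
    proof -
      have ne: "1 - norm z \<le> norm (h n t - z)" for t using norm_triangle_ineq2[of "h n t" z] rh(5)[of n t] by simp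
      have nz: "h n t - z \<noteq> 0" for t using ne[of t] z by auto
      show ?thesis unfolding F_def
      proof (rule norm_avg_le_const)
        show "continuous_on {0..2*pi} (\<lambda>t. 1 / (h n t - z))" using nz by (intro continuous_intros rh) auto
        show "norm (1 / (h n t - z)) \<le> 1 / (1 - norm z)" for t
          unfolding norm_divide using ne[of t] z by (intro frac_le) auto
      qed
    qed
    then show ?thesis using cauchy_avg_holomorphic[OF rh(4,5)] by (simp add: \<H>_def F_def)
  qed
  have bounded: "\<exists>B. \<forall>g\<in>\<H>. \<forall>z\<in>C. norm (g z) \<le> B" if C: "compact C" "C \<subseteq> ball 0 1" for C
  proof -
    have "continuous_on C (\<lambda>z. 1 / (1 - norm z))" using C(2) by (intro continuous_intros) auto
    then obtain B where B: "\<forall>z\<in>(\<lambda>z. 1 / (1 - norm z)) ` C. norm z \<le> B"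
      using compact_imp_bounded[OF compact_continuous_image[OF _ C(1)], of "\<lambda>z. 1 / (1 - norm z)"]
      unfolding bounded_iff by blast
    have "norm (g z) \<le> B" if "g \<in> \<H>" "z \<in> C" for g z
    proof -
      have "norm (g z) \<le> 1 / (1 - norm z)" using that C(2) by (auto simp: \<H>_def)
      also have "\<dots> \<le> norm (1 / (1 - norm z))" by (simp only: real_norm_def abs_ge_self)
      also have "\<dots> \<le> B" using B that(2) by blast
      finally show ?thesis .
    qed
    then show ?thesis by blast
  qed
  have H: "\<And>g. g \<in> \<H> \<Longrightarrow> g holomorphic_on ball 0 1" by (simp add: \<H>_def)
  have rng: "range F \<subseteq> \<H>" using FH by auto
  obtain c k where c: "c holomorphic_on ball 0 1" and k: "strict_mono (k :: nat \<Rightarrow> nat)"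
    and conv: "\<And>C. compact C \<Longrightarrow> C \<subseteq> ball 0 1 \<Longrightarrow> uniform_limit C (F \<circ> k) c sequentially"
    by (rule Montel[OF open_ball H bounded rng]) blast+
  have inv0: "(\<lambda>n. inverse (real (Suc (k n)))) \<longlonglongrightarrow> 0"
    using LIMSEQ_subseq_LIMSEQ[OF LIMSEQ_inverse_real_of_nat k] by (simp add: o_def)
  interpret welding_approximation a f \<phi> "r \<circ> k" "h \<circ> k" c
  proof
    show "0 < (r \<circ> k) n" "(r \<circ> k) n < 1" "continuous_on {0..2*pi} ((h \<circ> k) n)" for n using rh by auto
    show "norm ((h \<circ> k) n t) = 1" for n t using rh by simp
    show "(r \<circ> k) \<longlonglongrightarrow> 1"
    proof (rule tendsto_sandwich)
      show "(\<lambda>n. 1 - inverse (real (Suc (k n)))) \<longlonglongrightarrow> 1" using tendsto_diff[OF tendsto_const inv0] by simp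
      show "(\<lambda>n. 1::real) \<longlonglongrightarrow> 1" by simp
    qed (use rh in \<open>auto intro!: always_eventually less_imp_le simp del: of_nat_Suc\<close>)
    show "\<forall>\<^sub>F n in sequentially. \<forall>t. norm (f ((h \<circ> k) n t) - \<phi> (1 / (of_real ((r \<circ> k) n) * cis t))) < e" if "0 < e" for e
      using order_tendstoD(2)[OF inv0 that]
      by (rule eventually_mono) (use rh(6) in \<open>auto intro: less_trans\<close>)
    show "c holomorphic_on ball 0 1" by fact
    show "uniform_limit C (\<lambda>n z. avg (\<lambda>t. 1 / ((h \<circ> k) n t - z))) c sequentially" if "compact C" "C \<subseteq> ball 0 1" for C
      using conv[OF that] by (simp add: F_def o_def)
  qed
  show ?thesis by (rule ex_density)
qed

definition dens :: "complex \<Rightarrow> real" where "dens = (SOME p. welding_density p)"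

lemma welding_density_dens: "welding_density dens"
  unfolding dens_def by (rule someI_ex[OF ex_welding_density])

lemma dens_nonneg: "norm s = 1 \<Longrightarrow> 0 \<le> dens s"
  using welding_density_dens unfolding welding_density_def by blast

lemma dens_holder:
  obtains C where "\<And>s y. norm s = 1 \<Longrightarrow> norm y = 1 \<Longrightarrow> \<bar>dens y - dens s\<bar> \<le> C * norm (y - s) powr a"
  using welding_density_dens unfolding welding_density_def by blast

lemma continuous_on_dens: "continuous_on (sphere 0 1) dens"
proof -
  obtain C where "\<And>s y. norm s = 1 \<Longrightarrow> norm y = 1 \<Longrightarrow> \<bar>dens y - dens s\<bar> \<le> C * norm (y - s) powr a"
    by (rule dens_holder) blast
  then show ?thesis by (intro continuous_on_holder[OF a(1), of _ _ C]) auto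
qed

lemma avg_dens:
  assumes "boundary_limit E B" "r0 < 1" "\<And>r. r0 < r \<Longrightarrow> 0 < r \<Longrightarrow> r < 1 \<Longrightarrow>
           continuous_on {0..2*pi} (\<lambda>t. E (\<phi> (1 / (of_real r * cis t)))) \<and>
           avg (\<lambda>t. E (\<phi> (1 / (of_real r * cis t)))) = L"
  shows "avg (\<lambda>t. B (cis t) * of_real (dens (cis t))) = L"
  using welding_density_dens assms unfolding welding_density_def by blast

lemma avg_dens_holomorphic:
  assumes B: "boundary_limit E B" and E: "E holomorphic_on - K" "(E \<longlongrightarrow> L) at_infinity"
  shows "avg (\<lambda>t. B (cis t) * of_real (dens (cis t))) = L"
proof (rule avg_dens[OF B, of 0])
  fix r :: real assume r: "0 < r" "r < 1"
  have "continuous_on {0..2*pi} (\<lambda>t. E (\<phi> (1 / (of_real r * cis t))))"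
  proof (rule continuous_on_compose2[OF holomorphic_on_imp_continuous_on[OF E(1)] continuous_on_phi_circle[OF r]])
    show "(\<lambda>t. \<phi> (1 / (of_real r * cis t))) ` {0..2 * pi} \<subseteq> - K"
    proof (rule image_subsetI)
      fix t
      show "\<phi> (1 / (of_real r * cis t)) \<in> - K"
        unfolding Compl_iff by (rule phi_inverse_notin[OF circle_in_punctured(1,2)[OF r]])
    qed
  qed
  then show "continuous_on {0..2*pi} (\<lambda>t. E (\<phi> (1 / (of_real r * cis t)))) \<and>
           avg (\<lambda>t. E (\<phi> (1 / (of_real r * cis t)))) = L"
    using avg_phi_circle[OF E r] by simp
qed simp

lemma avg_dens_1: "avg (\<lambda>t. complex_of_real (dens (cis t))) = 1"
  using avg_dens_holomorphic[of "\<lambda>_. 1" "\<lambda>_. 1" 1] by (auto simp: boundary_limit_def intro!: exI[of _ 1])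

text \<open>This is the vanishing interior Cauchy integral that the Plemelj formula requires, for
  the boundary function \<open>Pb\<close> introduced below.\<close>

lemma avg_dens_inside:
  assumes z: "norm z < 1"
  shows "avg (\<lambda>t. of_real (dens (cis t)) / (f (cis t) - f z)) = 0"
proof -
  have "f z \<notin> f ` sphere 0 1" using f_neq[of z] z by force
  then have "boundary_limit (\<lambda>x. 1 / (x - f z)) (\<lambda>s. 1 / (f s - f z))"
    using boundary_limit_inverse[of "f z" 1] by simp
  moreover have "(\<lambda>x. 1 / (x - f z)) holomorphic_on - K"
    using z by (intro holomorphic_intros) force
  ultimately have "avg (\<lambda>t. (\<lambda>s. 1 / (f s - f z)) (cis t) * of_real (dens (cis t))) = 0"
    by (rule avg_dens_holomorphic[OF _ _ tendsto_inverse_shift])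
  then show ?thesis by simp
qed

definition P :: "complex \<Rightarrow> complex" where "P w = deriv \<psi> w / \<psi> w"

text \<open>The kernel \<open>1 / (w - x)\<close> has a pole outside \<open>K\<close>, so its
  averages over level curves are constant only once the level curve separates \<open>w\<close> from
  infinity no more, that is for \<open>r\<close> above \<open>1 / norm (\<psi> w)\<close>; this is
  why the test functions of \<open>welding_density\<close> have a threshold
  \<open>r0\<close>.\<close>

lemma P_eq_avg:
  assumes w: "w \<notin> K"
  shows "P w = avg (\<lambda>t. of_real (dens (cis t)) / (w - f (cis t)))"
proof -
  have B: "boundary_limit (\<lambda>x. 1 / (w - x)) (\<lambda>s. 1 / (w - f s))"
    by (rule boundary_limit_continuous[of "- {w}"]) (use w in \<open>auto intro!: continuous_intros\<close>)
  have "avg (\<lambda>t. (\<lambda>s. 1 / (w - f s)) (cis t) * of_real (dens (cis t))) = P w"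
  proof (rule avg_dens[OF B])
    show "1 / norm (\<psi> w) < 1" using norm_psi[OF w] by (subst divide_less_eq_1_pos) auto
    fix r assume r: "1 / norm (\<psi> w) < r" "0 < r" "r < 1"
    have "w - \<phi> (1 / (of_real r * cis t)) \<noteq> 0" for t
    proof
      assume "w - \<phi> (1 / (of_real r * cis t)) = 0"
      then have "\<psi> w = 1 / (of_real r * cis t)"
        using psi_phi[OF inverse_ext[OF circle_in_punctured(1,2)[OF r(2,3)]], of t] by simp
      then have "norm (\<psi> w) = 1 / r" using r by (simp add: norm_divide norm_mult)
      then show False using r by simp
    qed
    then have "continuous_on {0..2*pi} (\<lambda>t. 1 / (w - \<phi> (1 / (of_real r * cis t))))"
      by (intro continuous_intros continuous_on_phi_circle r) auto
    then show "continuous_on {0..2*pi} (\<lambda>t. 1 / (w - \<phi> (1 / (of_real r * cis t)))) \<and>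
       avg (\<lambda>t. 1 / (w - \<phi> (1 / (of_real r * cis t)))) = P w"
      unfolding P_def using log_deriv_eq_avg[OF w r(1,3)] by blast
  qed
  then show ?thesis by simp
qed

end

subsection \<open>Boundary values of the logarithmic derivative\<close>

lemma holder_onI:
  assumes "\<And>x y. x \<in> S \<Longrightarrow> y \<in> S \<Longrightarrow> norm (g y - g x) \<le> C * norm (y - x) powr a"
  shows "holder_on a (S :: complex set) g"
  unfolding holder_on_def using assms by (intro exI[of _ C]) (auto simp: dist_norm)

lemma holder_onE:
  assumes "holder_on a (S :: complex set) g"
  obtains C where "0 \<le> C" "\<And>x y. x \<in> S \<Longrightarrow> y \<in> S \<Longrightarrow> norm (g y - g x) \<le> C * norm (y - x) powr a"
proof -
  obtain C where C: "\<forall>x\<in>S. \<forall>y\<in>S. norm (g x - g y) \<le> C * dist x y powr a"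
    using assms unfolding holder_on_def by blast
  have "norm (g y - g x) \<le> \<bar>C\<bar> * norm (y - x) powr a" if "x \<in> S" "y \<in> S" for x y
  proof -
    have "norm (g y - g x) \<le> C * norm (y - x) powr a" using C that by (auto simp: dist_norm)
    also have "\<dots> \<le> \<bar>C\<bar> * norm (y - x) powr a" by (intro mult_right_mono) auto
    finally show ?thesis .
  qed
  then show ?thesis using that[of "\<bar>C\<bar>"] by auto
qed

lemma holder_on_continuous:
  assumes "holder_on a S g" "0 < a" shows "continuous_on (S :: complex set) g"
proof -
  obtain C where "0 \<le> C" "\<And>x y. x \<in> S \<Longrightarrow> y \<in> S \<Longrightarrow> norm (g y - g x) \<le> C * norm (y - x) powr a"
    by (rule holder_onE[OF assms(1)]) blast
  then show ?thesis by (intro continuous_on_holder[OF assms(2)])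
qed

lemma holder_on_bounded:
  assumes "holder_on a S g" "0 < a" "compact (S :: complex set)"
  obtains B where "0 \<le> B" "\<And>x. x \<in> S \<Longrightarrow> norm (g x) \<le> B"
proof -
  obtain B where "\<forall>y\<in>g ` S. norm y \<le> B"
    using compact_imp_bounded[OF compact_continuous_image[OF holder_on_continuous[OF assms(1,2)] assms(3)]]
    unfolding bounded_iff by blast
  then show ?thesis by (intro that[of "\<bar>B\<bar>"]) (auto intro: order_trans[OF _ abs_ge_self])
qed

lemma holder_on_mult:
  fixes g h :: "complex \<Rightarrow> complex"
  assumes g: "holder_on a S g" and h: "holder_on a S h" and "0 < a" "compact S"
  shows "holder_on a S (\<lambda>x. g x * h x)"
proof -
  obtain Cg where Cg: "0 \<le> Cg" "\<And>x y. x \<in> S \<Longrightarrow> y \<in> S \<Longrightarrow> norm (g y - g x) \<le> Cg * norm (y - x) powr a"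
    by (rule holder_onE[OF g]) blast
  obtain Ch where Ch: "0 \<le> Ch" "\<And>x y. x \<in> S \<Longrightarrow> y \<in> S \<Longrightarrow> norm (h y - h x) \<le> Ch * norm (y - x) powr a"
    by (rule holder_onE[OF h]) blast
  obtain Bg where Bg: "0 \<le> Bg" "\<And>x. x \<in> S \<Longrightarrow> norm (g x) \<le> Bg"
    by (rule holder_on_bounded[OF g assms(3,4)]) blast
  obtain Bh where Bh: "0 \<le> Bh" "\<And>x. x \<in> S \<Longrightarrow> norm (h x) \<le> Bh"
    by (rule holder_on_bounded[OF h assms(3,4)]) blast
  show ?thesis
  proof (rule holder_onI)
    fix x y assume xy: "x \<in> S" "y \<in> S"
    have "g y * h y - g x * h x = (g y - g x) * h y + g x * (h y - h x)" by (simp add: algebra_simps)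
    then have "norm (g y * h y - g x * h x) \<le> norm (g y - g x) * norm (h y) + norm (g x) * norm (h y - h x)"
      by (metis norm_triangle_ineq norm_mult)
    also have "\<dots> \<le> (Cg * norm (y - x) powr a) * Bh + Bg * (Ch * norm (y - x) powr a)"
      using Cg Ch Bg Bh xy by (intro add_mono mult_mono) auto
    finally show "norm (g y * h y - g x * h x) \<le> (Cg * Bh + Bg * Ch) * norm (y - x) powr a"
      by (simp add: algebra_simps)
  qed
qed

lemma holder_on_inverse:
  fixes g :: "complex \<Rightarrow> 'b::real_normed_field"
  assumes g: "holder_on a S g" and "0 < a" "compact S" and nz: "\<And>x. x \<in> S \<Longrightarrow> g x \<noteq> 0"
  shows "holder_on a S (\<lambda>x. inverse (g x))"
proof (cases "S = {}")
  case True then show ?thesis by (auto simp: holder_on_def)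
next
  case False
  obtain Cg where Cg: "0 \<le> Cg" "\<And>x y. x \<in> S \<Longrightarrow> y \<in> S \<Longrightarrow> norm (g y - g x) \<le> Cg * norm (y - x) powr a"
    by (rule holder_onE[OF g]) blast
  obtain x0 where x0: "x0 \<in> S" "\<And>x. x \<in> S \<Longrightarrow> norm (g x0) \<le> norm (g x)"
    using continuous_attains_inf[OF assms(3) False continuous_on_norm[OF holder_on_continuous[OF g assms(2)]]] by auto
  define m where "m = norm (g x0)"
  have m: "0 < m" using nz[OF x0(1)] by (simp add: m_def)
  show ?thesis
  proof (rule holder_onI)
    fix x y assume xy: "x \<in> S" "y \<in> S"
    have "inverse (g y) - inverse (g x) = - (inverse (g y) * (g y - g x) * inverse (g x))"
      using nz xy by (simp add: inverse_diff_inverse)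
    then have "norm (inverse (g y) - inverse (g x)) = norm (g y - g x) / (norm (g y) * norm (g x))"
      by (simp add: norm_mult norm_inverse divide_inverse mult_ac)
    also have "\<dots> \<le> (Cg * norm (y - x) powr a) / (m * m)"
      using Cg xy x0 m unfolding m_def by (intro frac_le mult_mono) auto
    finally show "norm (inverse (g y) - inverse (g x)) \<le> (Cg / (m * m)) * norm (y - x) powr a" by simp
  qed
qed

context conformal_welding
begin

lemma f_nonzero: "norm s = 1 \<Longrightarrow> f s \<noteq> 0"
  using f_neq[of s 0] f_0 by (cases "s = 0") auto

lemma holder_id: "holder_on a (sphere 0 1) (\<lambda>s::complex. s)"
  by (rule holder_onI[where C = 2]) (use norm_diff_le_powr a in auto)

lemma holder_f: "holder_on a (sphere 0 1) f"
proof -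
  obtain M where M: "1 \<le> M" "\<And>z. norm z \<le> 1 \<Longrightarrow> norm (f1 z) \<le> M"
    "\<And>z w. norm z \<le> 1 \<Longrightarrow> norm w \<le> 1 \<Longrightarrow> norm (f z - f w) \<le> M * norm (z - w)" by (rule f1_bounded) blast
  show ?thesis
  proof (rule holder_onI[where C = "M * 2"])
    fix x y :: complex assume xy: "x \<in> sphere 0 1" "y \<in> sphere 0 1"
    have "norm (f y - f x) \<le> M * norm (y - x)" using M(3) xy by auto
    also have "\<dots> \<le> M * (2 * norm (y - x) powr a)"
      using norm_diff_le_powr[of x y a] xy a M(1) by (intro mult_left_mono) auto
    finally show "norm (f y - f x) \<le> M * 2 * norm (y - x) powr a" by simp
  qed
qed

lemma holder_f1: "holder_on a (sphere 0 1) f1"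
proof -
  obtain C where C: "0 \<le> C" "\<And>s y. norm s = 1 \<Longrightarrow> norm y \<le> 1 \<Longrightarrow> norm (f1 y - f1 s) \<le> C * norm (y - s) powr a"
    by (rule f1_holder) blast
  then show ?thesis by (intro holder_onI[where C = C]) auto
qed

lemma holder_dens: "holder_on a (sphere 0 1) dens"
proof -
  obtain C where "\<And>s y. norm s = 1 \<Longrightarrow> norm y = 1 \<Longrightarrow> \<bar>dens y - dens s\<bar> \<le> C * norm (y - s) powr a"
    by (rule dens_holder) blast
  then show ?thesis by (intro holder_onI[where C = C]) auto
qed

lemma holder_of_real:
  "holder_on a S v \<Longrightarrow> holder_on a S (\<lambda>s. complex_of_real (v s))"
  unfolding holder_on_def by (simp flip: of_real_diff)

text \<open>On the curve \<open>dw = i s f1(s) dt\<close>, so integrating \<open>dens\<close>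
  against \<open>dt / (2 pi)\<close> is integrating \<open>Pb\<close> against
  \<open>dw / (2 pi i)\<close>.\<close>

definition Pb :: "complex \<Rightarrow> complex" where "Pb s = of_real (dens s) / (s * f1 s)"

lemma holder_Pb: "holder_on a (sphere 0 1) Pb"
proof -
  have "holder_on a (sphere 0 1) (\<lambda>s. of_real (dens s) * inverse (s * f1 s))"
    by (intro holder_on_mult holder_on_inverse holder_of_real holder_dens holder_id holder_f1 a compact_sphere)
      (use f1_nonzero in auto)
  then show ?thesis by (simp add: Pb_def[abs_def] divide_inverse)
qed

lemma holder_plemelj:
  assumes h: "holder_on a (sphere 0 1) h"
    and van: "\<And>z. norm z < 1 \<Longrightarrow> avg (\<lambda>t. h (cis t) * f1 (cis t) * cis t / (f (cis t) - f z)) = 0"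
  shows "\<exists>C\<ge>0. \<forall>w s. w \<notin> K \<longrightarrow> norm s = 1 \<longrightarrow> norm (w - f s) \<le> 1 \<longrightarrow>
       norm (avg (\<lambda>t. h (cis t) * f1 (cis t) * cis t / (w - f (cis t))) - h s) \<le> C * norm (w - f s) powr a"
proof -
  obtain C where "0 \<le> C" "\<And>x y. x \<in> sphere 0 1 \<Longrightarrow> y \<in> sphere 0 1 \<Longrightarrow> norm (h y - h x) \<le> C * norm (y - x) powr a"
    by (rule holder_onE[OF h]) blast
  then show ?thesis by (intro plemelj[OF _ holder_on_continuous[OF h a(1)] van, of C]) auto
qed

lemma P_boundary:
  "\<exists>C\<ge>0. \<forall>w s. w \<notin> K \<longrightarrow> norm s = 1 \<longrightarrow> norm (w - f s) \<le> 1 \<longrightarrow> norm (P w - Pb s) \<le> C * norm (w - f s) powr a"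
proof -
  have eq: "Pb (cis t) * f1 (cis t) * cis t = of_real (dens (cis t))" for t
    using f1_nonzero[of "cis t"] by (simp add: Pb_def)
  have "\<exists>C\<ge>0. \<forall>w s. w \<notin> K \<longrightarrow> norm s = 1 \<longrightarrow> norm (w - f s) \<le> 1 \<longrightarrow>
       norm (avg (\<lambda>t. Pb (cis t) * f1 (cis t) * cis t / (w - f (cis t))) - Pb s) \<le> C * norm (w - f s) powr a"
    by (rule holder_plemelj[OF holder_Pb]) (simp only: eq avg_dens_inside)
  then obtain C where "0 \<le> C" "\<forall>w s. w \<notin> K \<longrightarrow> norm s = 1 \<longrightarrow> norm (w - f s) \<le> 1 \<longrightarrow>
       norm (avg (\<lambda>t. of_real (dens (cis t)) / (w - f (cis t))) - Pb s) \<le> C * norm (w - f s) powr a"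
    unfolding eq by blast
  then show ?thesis by (intro exI[of _ C]) (simp add: P_eq_avg del: image_iff)
qed

section \<open>Tangent cones of the boundary curve\<close>

lemma normal_bounds:
  obtains m M where "0 < m" "1 \<le> M" "\<And>s. norm s = 1 \<Longrightarrow> m \<le> norm (s * f1 s)" "\<And>s. norm s = 1 \<Longrightarrow> norm (s * f1 s) \<le> M"
proof -
  obtain M where M: "1 \<le> M" "\<And>z. norm z \<le> 1 \<Longrightarrow> norm (f1 z) \<le> M"
    "\<And>z w. norm z \<le> 1 \<Longrightarrow> norm w \<le> 1 \<Longrightarrow> norm (f z - f w) \<le> M * norm (z - w)" by (rule f1_bounded) blast
  have "continuous_on (sphere 0 1) (\<lambda>s. norm (s * f1 s))"
    by (intro continuous_intros continuous_on_subset[OF cont_f1]) auto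
  moreover have "sphere 0 1 \<noteq> ({} :: complex set)" by simp
  ultimately obtain s0 where s0: "s0 \<in> sphere 0 1" "\<forall>s\<in>sphere 0 1. norm (s0 * f1 s0) \<le> norm (s * f1 s)"
    using continuous_attains_inf[OF compact_sphere] by blast
  have "s0 \<noteq> 0" "f1 s0 \<noteq> 0" using s0(1) f1_nonzero[of s0] by auto
  then show ?thesis using s0(2) M by (intro that[of "norm (s0 * f1 s0)" M]) (auto simp: norm_mult)
qed

text \<open>Dividing by \<open>s * f1 s\<close> turns the outer normal at \<open>f s\<close> into
  the positive real axis. In this coordinate \<open>f\<close> is, uniformly in \<open>s\<close>,
  close to the map \<open>z \<mapsto> (z - s) / s\<close> of the disc.\<close>

lemma tangent_estimate:
  assumes "0 < e"
  obtains \<rho> where "0 < \<rho>" "\<And>s z. norm s = 1 \<Longrightarrow> norm z \<le> 1 \<Longrightarrow> norm (f z - f s) < \<rho> \<Longrightarrow>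
     norm ((f z - f s) / (s * f1 s) - (z - s) / s) \<le> e * norm (z - s) \<and> norm (z - s) < e"
proof -
  obtain m M where mM: "0 < m" "1 \<le> M" "\<And>s. norm s = 1 \<Longrightarrow> m \<le> norm (s * f1 s)" "\<And>s. norm s = 1 \<Longrightarrow> norm (s * f1 s) \<le> M"
    by (rule normal_bounds) blast
  obtain c where c: "0 < c" "c \<le> 1" "\<And>z w. norm z \<le> 1 \<Longrightarrow> norm w \<le> 1 \<Longrightarrow> c * norm (z - w) \<le> norm (f z - f w)"
    by (rule bilip) blast
  obtain d where d: "0 < d" "\<And>y z. norm y \<le> 1 \<Longrightarrow> norm z \<le> 1 \<Longrightarrow> norm (y - z) < d \<Longrightarrow> norm (f1 y - f1 z) < e * m"
    by (rule f1_unif[of "e * m"]) (use assms mM in auto)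
  define \<rho> where "\<rho> = c * min d e"
  have "norm ((f z - f s) / (s * f1 s) - (z - s) / s) \<le> e * norm (z - s) \<and> norm (z - s) < e"
    if s: "norm s = 1" and z: "norm z \<le> 1" and fz: "norm (f z - f s) < \<rho>" for s z
  proof -
    have "c * norm (z - s) < c * min d e" using c(3)[of z s] s z fz by (simp add: \<rho>_def)
    then have zs: "norm (z - s) < min d e" using c(1) by simp
    have "norm (f z - f s - f1 s * (z - s)) \<le> (e * m) * norm (z - s)"
    proof (rule linear_approx)
      fix y assume y: "norm y \<le> 1" "norm (y - s) \<le> norm (z - s)"
      then show "norm (f1 y - f1 s) \<le> e * m" using d(2)[of y s] s zs by simp
    qed (use s z in auto)
    moreover have n0: "s * f1 s \<noteq> 0" using mM(1) mM(3)[OF s] by auto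
    then have eq: "(f z - f s) / (s * f1 s) - (z - s) / s = (f z - f s - f1 s * (z - s)) / (s * f1 s)"
      by (simp add: field_simps)
    ultimately have "norm ((f z - f s) / (s * f1 s) - (z - s) / s) \<le> (e * m * norm (z - s)) / m"
      unfolding eq norm_divide using mM(1) mM(3)[OF s] assms by (intro frac_le) auto
    then show ?thesis using mM(1) zs by simp
  qed
  moreover have "0 < \<rho>" using c d assms by (simp add: \<rho>_def)
  ultimately show ?thesis using that by blast
qed

lemma Re_quotient_le_0:
  assumes "norm s = 1" "norm z \<le> 1" shows "Re ((z - s) / s) \<le> 0"
proof -
  have "s \<noteq> 0" using assms by auto
  then have "(z - s) / s = z / s - 1" by (simp add: diff_divide_distrib)
  moreover have "Re (z / s) \<le> norm (z / s)" by (rule complex_Re_le_cmod)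
  ultimately show ?thesis using assms by (simp add: norm_divide)
qed

text \<open>For \<open>z\<close> in the disc \<open>(z - s) / s\<close> has nonpositive real part,
  so points of \<open>K\<close> near \<open>f s\<close> have normal coordinate of real part at most
  a small multiple of their distance from \<open>f s\<close>, and cannot lie in the cone.\<close>

lemma cone_outside:
  assumes "0 < \<eta>"
  obtains \<rho> where "0 < \<rho>" "\<And>s w. norm s = 1 \<Longrightarrow> 0 < norm (w - f s) \<Longrightarrow> norm (w - f s) < \<rho> \<Longrightarrow>
     \<eta> * norm (w - f s) \<le> Re ((w - f s) / (s * f1 s)) \<Longrightarrow> w \<notin> K"
proof -
  obtain c where c: "0 < c" "c \<le> 1" "\<And>z w. norm z \<le> 1 \<Longrightarrow> norm w \<le> 1 \<Longrightarrow> c * norm (z - w) \<le> norm (f z - f w)"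
    by (rule bilip) blast
  \<comment> \<open>The factor \<open>c\<close> converts the distance of \<open>z\<close> and
    \<open>s\<close> into that of \<open>w\<close> and \<open>f s\<close>; the division by 2 makes
    the comparison strict.\<close>
  define e where "e = \<eta> * c / 2"
  have e: "0 < e" using c assms by (simp add: e_def)
  obtain \<rho> where \<rho>: "0 < \<rho>" "\<And>s z. norm s = 1 \<Longrightarrow> norm z \<le> 1 \<Longrightarrow> norm (f z - f s) < \<rho> \<Longrightarrow>
     norm ((f z - f s) / (s * f1 s) - (z - s) / s) \<le> e * norm (z - s) \<and> norm (z - s) < e"
    by (rule tangent_estimate[OF e]) blast
  have "w \<notin> K" if s: "norm s = 1" and w: "0 < norm (w - f s)" "norm (w - f s) < \<rho>"
    and cone: "\<eta> * norm (w - f s) \<le> Re ((w - f s) / (s * f1 s))" for s w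
  proof
    assume "w \<in> K"
    then obtain z where z: "norm z \<le> 1" "w = f z" by auto
    have "Re ((f z - f s) / (s * f1 s) - (z - s) / s) \<le> e * norm (z - s)"
      using \<rho>(2)[OF s z(1)] w z complex_Re_le_cmod order_trans by blast
    then have "Re ((w - f s) / (s * f1 s)) \<le> e * norm (z - s)" using Re_quotient_le_0[OF s z(1)] z(2) by simp
    also have "\<dots> = \<eta> / 2 * (c * norm (z - s))" by (simp add: e_def)
    also have "\<dots> \<le> \<eta> / 2 * norm (w - f s)" using c(3)[of z s] s z assms by (intro mult_left_mono) auto
    finally have "\<eta> * norm (w - f s) \<le> \<eta> / 2 * norm (w - f s)" using cone by linarith
    then show False using w assms by simp
  qed
  then show ?thesis using that \<rho>(1) by blast
qed

lemma convex_cone: "convex {w :: complex. norm (w - b) < \<rho> \<and> Re ((w - b) / n) < - \<eta> * norm (w - b)}" if "0 < \<eta>"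
proof -
  have "convex_on UNIV (\<lambda>w::complex. \<eta> * norm (w - b))"
    using convex_on_cmul[OF less_imp_le[OF that] convex_on_dist[OF convex_UNIV, of b]] by (simp add: dist_norm norm_minus_commute)
  have "{w :: complex. norm (w - b) < \<rho> \<and> Re ((w - b) / n) < - \<eta> * norm (w - b)} =
      ball b \<rho> \<inter> {w. Re ((w - b) / n) + \<eta> * norm (w - b) < 0}"
    by (auto simp: dist_norm norm_minus_commute)
  moreover have "convex {w. Re ((w - b) / n) + \<eta> * norm (w - b) < 0}"
  proof (rule convexI)
    fix x y :: complex and u v :: real
    assume x: "x \<in> {w. Re ((w - b) / n) + \<eta> * norm (w - b) < 0}" and y: "y \<in> {w. Re ((w - b) / n) + \<eta> * norm (w - b) < 0}"
      and uv: "0 \<le> u" "0 \<le> v" "u + v = 1"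
    have eq: "u *\<^sub>R x + v *\<^sub>R y - b = u *\<^sub>R (x - b) + v *\<^sub>R (y - b)"
    proof -
      have "b = (u + v) *\<^sub>R b" using uv by simp
      then show ?thesis by (simp only: scaleR_diff_right scaleR_add_left) (simp add: algebra_simps)
    qed
    have "Re ((u *\<^sub>R x + v *\<^sub>R y - b) / n) = u * Re ((x - b) / n) + v * Re ((y - b) / n)"
    proof -
      have "(k *\<^sub>R X) / n = k *\<^sub>R (X / n)" for k X by (simp add: scaleR_conv_of_real)
      then show ?thesis unfolding eq add_divide_distrib by simp
    qed
    moreover have "norm (u *\<^sub>R x + v *\<^sub>R y - b) \<le> u * norm (x - b) + v * norm (y - b)"
      unfolding eq using norm_triangle_ineq[of "u *\<^sub>R (x - b)" "v *\<^sub>R (y - b)"] uv by simp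
    then have "\<eta> * norm (u *\<^sub>R x + v *\<^sub>R y - b) \<le> \<eta> * (u * norm (x - b) + v * norm (y - b))"
      using that by (intro mult_left_mono) auto
    ultimately have "Re ((u *\<^sub>R x + v *\<^sub>R y - b) / n) + \<eta> * norm (u *\<^sub>R x + v *\<^sub>R y - b) \<le>
       u * (Re ((x - b) / n) + \<eta> * norm (x - b)) + v * (Re ((y - b) / n) + \<eta> * norm (y - b))"
      by (simp add: algebra_simps)
    also have "\<dots> < 0"
    proof (cases "u = 0")
      case True then show ?thesis using y uv by simp
    next
      case False
      then have "u * (Re ((x - b) / n) + \<eta> * norm (x - b)) < 0" using x uv by (intro mult_pos_neg) auto
      moreover have "v * (Re ((y - b) / n) + \<eta> * norm (y - b)) \<le> 0" using y uv by (intro mult_nonneg_nonpos) auto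
      ultimately show ?thesis by linarith
    qed
    finally show "u *\<^sub>R x + v *\<^sub>R y \<in> {w. Re ((w - b) / n) + \<eta> * norm (w - b) < 0}" by simp
  qed
  ultimately show ?thesis by (simp add: convex_Int)
qed

text \<open>The truncated cone is connected and misses the boundary curve, but it contains \<open>f (r s)\<close> for \<open>r\<close> near 1.\<close>

lemma cone_inside:
  assumes \<eta>: "0 < \<eta>" and M: "\<And>s. norm s = 1 \<Longrightarrow> norm (s * f1 s) * \<eta> \<le> 1/4"
  obtains \<rho> where "0 < \<rho>" "\<And>s w. norm s = 1 \<Longrightarrow> norm (w - f s) < \<rho> \<Longrightarrow>
     Re ((w - f s) / (s * f1 s)) < - \<eta> * norm (w - f s) \<Longrightarrow> w \<in> f ` ball 0 1"
proof -
  obtain c where c: "0 < c" "c \<le> 1" "\<And>z w. norm z \<le> 1 \<Longrightarrow> norm w \<le> 1 \<Longrightarrow> c * norm (z - w) \<le> norm (f z - f w)"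
    by (rule bilip) blast
  \<comment> \<open>The bound \<open>1/4\<close> is for the point \<open>f z\<close> found inside
    the cone, the other bound for keeping the curve out of it.\<close>
  define e where "e = min (1/4) (\<eta> * c / 2)"
  have e: "0 < e" "e \<le> 1/4" "e \<le> \<eta> * c / 2" using c \<eta> by (auto simp: e_def)
  obtain \<rho> where \<rho>: "0 < \<rho>" "\<And>s z. norm s = 1 \<Longrightarrow> norm z \<le> 1 \<Longrightarrow> norm (f z - f s) < \<rho> \<Longrightarrow>
     norm ((f z - f s) / (s * f1 s) - (z - s) / s) \<le> e * norm (z - s) \<and> norm (z - s) < e"
    by (rule tangent_estimate[OF e(1)]) blast
  have "w \<in> f ` ball 0 1" if s: "norm s = 1" and w: "norm (w - f s) < \<rho>"
    and cone: "Re ((w - f s) / (s * f1 s)) < - \<eta> * norm (w - f s)" for s w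
  proof -
    have s0: "s \<noteq> 0" using s by auto
    define C where "C = {w. norm (w - f s) < \<rho> \<and> Re ((w - f s) / (s * f1 s)) < - \<eta> * norm (w - f s)}"
    have wC: "w \<in> C" using w cone by (simp add: C_def)
    have "connected C" unfolding C_def by (rule convex_connected[OF convex_cone[OF \<eta>]])
    moreover have "C \<inter> frontier (f ` ball 0 1) = {}"
    proof -
      have False if z: "norm z = 1" and fz: "f z \<in> C" for z
      proof -
        have z1: "norm z \<le> 1" using z by simp
        have est: "norm ((f z - f s) / (s * f1 s) - (z - s) / s) \<le> e * norm (z - s)" "norm (z - s) < e"
          using \<rho>(2)[OF s z1] fz by (auto simp: C_def)
        define y where "y = (z - s) / s"
        have ny: "norm y = norm (z - s)" using s by (simp add: y_def norm_divide)
        \<comment> \<open>\<open>1 + y\<close> lies on the unit circle, so \<open>Re y\<close>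
          equals minus half the square of \<open>norm y\<close> and is of second order.\<close>
        have "1 + y = z / s" using s0 by (simp add: y_def field_simps)
        then have "norm (1 + y) = 1" using s z by (simp add: norm_divide)
        then have "(norm (1 + y))\<^sup>2 = 1" by simp
        then have "2 * Re y + (norm y)\<^sup>2 = 0" unfolding cmod_power2 by (simp add: power2_eq_square algebra_simps)
        then have "Re y = - (norm (z - s))\<^sup>2 / 2" using ny by simp
        also have "\<dots> \<ge> - (e * norm (z - s))"
        proof -
          have "norm (z - s) * norm (z - s) \<le> e * norm (z - s)" using est(2) by (intro mult_right_mono) auto
          moreover have "0 \<le> e * norm (z - s)" using e by simp
          ultimately show ?thesis by (simp add: power2_eq_square)
        qed
        finally have Rey: "- (e * norm (z - s)) \<le> Re y" .
        have "\<bar>Re ((f z - f s) / (s * f1 s) - y)\<bar> \<le> e * norm (z - s)"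
          using est(1) abs_Re_le_cmod order_trans unfolding y_def by blast
        then have "- (2 * e) * norm (z - s) \<le> Re ((f z - f s) / (s * f1 s))" using Rey by simp
        moreover have "(2 * e) * norm (z - s) \<le> \<eta> * norm (f z - f s)"
        proof -
          have "(2 * e) * norm (z - s) \<le> (\<eta> * c) * norm (z - s)" using e by (intro mult_right_mono) auto
          also have "\<dots> = \<eta> * (c * norm (z - s))" by simp
          also have "\<dots> \<le> \<eta> * norm (f z - f s)" using c(3)[of z s] s z \<eta> by (intro mult_left_mono) auto
          finally show ?thesis .
        qed
        ultimately show False using fz by (simp add: C_def)
      qed
      then show ?thesis unfolding frontier_inside by auto
    qed
    moreover have "C \<inter> f ` ball 0 1 \<noteq> {}"
    proof -
      obtain B where B: "1 \<le> B" "\<And>z. norm z \<le> 1 \<Longrightarrow> norm (f1 z) \<le> B"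
        "\<And>z w. norm z \<le> 1 \<Longrightarrow> norm w \<le> 1 \<Longrightarrow> norm (f z - f w) \<le> B * norm (z - w)" by (rule f1_bounded) blast
      define \<delta> where "\<delta> = min (1/2) (\<rho> / (2 * B))"
      have \<delta>: "0 < \<delta>" "\<delta> \<le> 1/2" "B * \<delta> < \<rho>" using \<rho>(1) B(1) by (auto simp: \<delta>_def min_def field_simps)
      define z where "z = of_real (1 - \<delta>) * s"
      have zs: "z - s = of_real (- \<delta>) * s" by (simp add: z_def algebra_simps)
      have nzs: "norm (z - s) = \<delta>" unfolding zs using s \<delta> by (simp add: norm_mult)
      have nz: "norm z < 1" using s \<delta> by (simp only: z_def norm_mult norm_of_real) simp
      have fz: "norm (f z - f s) < \<rho>" using B(3)[of z s] nz s \<delta>(3) unfolding nzs by simp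
      have est: "norm ((f z - f s) / (s * f1 s) - (z - s) / s) \<le> e * \<delta>"
        using \<rho>(2)[OF s less_imp_le[OF nz] fz] nzs by simp
      have q: "(z - s) / s = of_real (- \<delta>)" unfolding zs using s0 by simp
      \<comment> \<open>The normal coordinate of \<open>f z\<close> is within
        \<open>\<delta> / 4\<close> of \<open>- \<delta>\<close>. Its real part is thus at most
        \<open>- 3/4 * \<delta>\<close>, while \<open>\<eta>\<close> times the distance from
        \<open>f s\<close> is at most \<open>5/16 * \<delta>\<close>.\<close>
      define x where "x = (f z - f s) / (s * f1 s)"
      have xq: "norm (x + of_real \<delta>) \<le> \<delta> / 4"
      proof -
        have "norm (x + of_real \<delta>) \<le> e * \<delta>" using est unfolding q x_def by simp
        also have "e * \<delta> \<le> 1/4 * \<delta>" by (rule mult_right_mono[OF e(2)]) (use \<delta> in simp)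
        finally show ?thesis by simp
      qed
      have 1: "Re x \<le> - \<delta> + \<delta> / 4" using xq complex_Re_le_cmod[of "x + of_real \<delta>"] by simp
      have 2: "norm x \<le> \<delta> + \<delta> / 4"
        using xq norm_triangle_ineq4[of "x + of_real \<delta>" "of_real \<delta>"] \<delta>(1) by simp
      have "s * f1 s \<noteq> 0" using s0 f1_nonzero[of s] s by simp
      then have "f z - f s = x * (s * f1 s)" by (simp add: x_def)
      then have "\<eta> * norm (f z - f s) = norm x * (norm (s * f1 s) * \<eta>)" by (simp add: norm_mult)
      also have "\<dots> \<le> norm x * (1/4)" using M[OF s] by (intro mult_left_mono) auto
      finally have "Re x < - \<eta> * norm (f z - f s)" using 1 2 \<delta>(1) by simp
      then have "f z \<in> C" using fz by (simp add: C_def x_def)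
      then show ?thesis using nz by auto
    qed
    ultimately show ?thesis using connected_Int_frontier[of C "f ` ball 0 1"] wC by blast
  qed
  then show ?thesis using that \<rho>(1) by blast
qed

end

subsection \<open>Positivity of the density\<close>

text \<open>The hypothesis describes the two edges of the sector of half-opening
  \<open>pi / (2 * p)\<close>, on which \<open>x powr p\<close> is purely imaginary.\<close>

lemma cos_powr_sector:
  fixes p :: real and x :: complex
  assumes p: "1 < p" "p < 2" and x: "Re x = cos (pi / (2 * p)) * norm x"
  shows "Re (x powr of_real p) \<le> 0"
proof (cases "x = 0")
  case False
  define \<theta> where "\<theta> = \<bar>Arg x\<bar>"
  have "\<theta> \<le> pi" "0 \<le> \<theta>" using mpi_less_Arg[of x] Arg_le_pi[of x] by (auto simp: \<theta>_def)
  have "Re (rcis (norm x) (Arg x)) = norm x * cos (Arg x)" by (rule Re_rcis)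
  then have "norm x * cos (Arg x) = norm x * cos (pi / (2 * p))" using x by (simp only: rcis_cmod_Arg mult.commute)
  then have "cos (Arg x) = cos (pi / (2 * p))" using False by (simp only: mult_left_cancel norm_eq_zero not_False_eq_True)
  moreover have "cos \<theta> = cos (Arg x)" by (auto simp only: \<theta>_def abs_if cos_minus split: if_split)
  ultimately have "cos \<theta> = cos (pi / (2 * p))" by (simp only:)
  moreover have "pi / (2 * p) \<le> pi" "0 \<le> pi / (2 * p)" using p by (auto simp: field_simps)
  ultimately have "\<theta> = pi / (2 * p)" using \<open>\<theta> \<le> pi\<close> \<open>0 \<le> \<theta>\<close> cos_inj_pi[of \<theta> "pi / (2 * p)"] by blast
  then have "cos (p * \<theta>) = 0" using p by simp
  moreover have "cos (p * \<theta>) = cos (p * Arg x)"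
    by (auto simp only: \<theta>_def abs_if mult_minus_right cos_minus split: if_split)
  moreover have "Re (x powr of_real p) = exp (Re (of_real p * Ln x)) * cos (p * Arg x)"
    using False by (simp add: powr_def Re_exp Arg_eq_Im_Ln)
  ultimately show ?thesis by simp
qed simp

context conformal_welding
begin

lemma frontier_closed_subset:
  "closed S \<Longrightarrow> open T \<Longrightarrow> T \<subseteq> S \<Longrightarrow> x \<in> frontier S \<Longrightarrow> x \<in> S - T"
  using interior_maximal[of T S] by (auto simp: frontier_def)

text \<open>A Hopf-type lower bound, from comparing \<open>log \<bar>\<psi>\<bar>\<close> with \<open>Re x^p\<close> on a sector of opening \<open>\<pi> / p\<close>
  around the outer normal; the sector is shifted by \<open>\<tau>\<close> to keep its vertex off the boundary curve.\<close>

lemma psi_lower_bound: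
  assumes s0: "norm s0 = 1" and p: "1 < p" "p < 2"
  obtains \<kappa> r where "0 < \<kappa>" "0 < r" "\<And>t. 0 < t \<Longrightarrow> t < r \<Longrightarrow> f s0 + of_real t * (s0 * f1 s0) \<notin> K"
    "\<And>t. 0 < t \<Longrightarrow> t < r \<Longrightarrow> exp (\<kappa> * t powr p) \<le> norm (\<psi> (f s0 + of_real t * (s0 * f1 s0)))"
proof -
  define n where "n = s0 * f1 s0"
  have n0: "n \<noteq> 0" using f1_nonzero[of s0] s0 by (auto simp: n_def)
  \<comment> \<open>\<open>k * norm x \<le> Re x\<close> is the sector of half-opening
    \<open>pi / (2 * p)\<close>. This is less than a right angle since \<open>p > 1\<close>, so the
    sector fits outside the curve near \<open>f s0\<close>.\<close>
  define k where "k = cos (pi / (2 * p))"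
  have k: "0 < k" "k \<le> 1" unfolding k_def using p by (auto intro!: cos_gt_zero simp: field_simps)
  obtain \<rho> where \<rho>: "0 < \<rho>" "\<And>s w. norm s = 1 \<Longrightarrow> 0 < norm (w - f s) \<Longrightarrow> norm (w - f s) < \<rho> \<Longrightarrow>
     k / norm n * norm (w - f s) \<le> Re ((w - f s) / (s * f1 s)) \<Longrightarrow> w \<notin> K"
    by (rule cone_outside[of "k / norm n"]) (use k n0 in auto)
  define W where "W = (\<lambda>x. f s0 + x * n)"
  \<comment> \<open>Points \<open>x\<close> of modulus at most \<open>r\<close> are shifted by up to
    \<open>r\<close>, so radius \<open>2 * r\<close> must be allowed.\<close>
  define r where "r = \<rho> / (3 * norm n)"
  have r: "0 < r" "norm n * (2 * r) < \<rho>" using \<rho>(1) n0 by (auto simp: r_def)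
  have WK: "W x \<notin> K" if x: "x \<noteq> 0" "norm x \<le> 2 * r" "k * norm x \<le> Re x" for x
  proof (rule \<rho>(2)[OF s0])
    have d: "W x - f s0 = x * n" by (simp add: W_def)
    show "0 < norm (W x - f s0)" unfolding d using x(1) n0 by simp
    have "norm x * norm n \<le> (2 * r) * norm n" using x(2) by (intro mult_right_mono) auto
    then show "norm (W x - f s0) < \<rho>" unfolding d norm_mult using r(2) by (simp add: mult_ac)
    show "k / norm n * norm (W x - f s0) \<le> Re ((W x - f s0) / (s0 * f1 s0))"
      unfolding d n_def[symmetric] using x(3) n0 by (simp add: norm_mult)
  qed
  define S where "S = {x. norm x \<le> r \<and> k * norm x \<le> Re x}"
  have clS: "closed S" unfolding S_def
    by (intro closed_Collect_conj closed_Collect_le continuous_intros)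
  have bS: "bounded S" unfolding S_def by (rule boundedI[of _ r]) auto
  have shift: "x + of_real \<tau> \<noteq> 0" "norm (x + of_real \<tau>) \<le> 2 * r" "k * norm (x + of_real \<tau>) \<le> Re (x + of_real \<tau>)"
    if "x \<in> S" "0 < \<tau>" "\<tau> \<le> r" for x \<tau>
  proof -
    have x: "norm x \<le> r" "k * norm x \<le> Re x" "0 \<le> Re x"
      using that(1) k order_trans[of 0 "k * norm x" "Re x"] by (auto simp: S_def)
    have "Re (x + of_real \<tau>) > 0" using x that by simp
    then show "x + of_real \<tau> \<noteq> 0" by (metis less_irrefl zero_complex.sel(1))
    show "norm (x + of_real \<tau>) \<le> 2 * r" using norm_triangle_ineq[of x "of_real \<tau>"] x that by simp
    have "k * norm (x + of_real \<tau>) \<le> k * (norm x + \<tau>)"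
      using norm_triangle_ineq[of x "of_real \<tau>"] k that by (intro mult_left_mono) auto
    also have "\<dots> \<le> Re x + 1 * \<tau>" unfolding distrib_left using x k that by (intro add_mono mult_right_mono) auto
    finally show "k * norm (x + of_real \<tau>) \<le> Re (x + of_real \<tau>)" by simp
  qed
  \<comment> \<open>The bound on the arc has to be uniform in the shift, so compactness is used for
    pairs \<open>(x, \<tau>)\<close>, including \<open>\<tau> = 0\<close>.\<close>
  have "\<exists>R>1. \<forall>x \<tau>. x \<in> S \<longrightarrow> norm x = r \<longrightarrow> 0 \<le> \<tau> \<longrightarrow> \<tau> \<le> r \<longrightarrow> R \<le> norm (\<psi> (W (x + of_real \<tau>)))"
  proof -
    define T where "T = (S \<inter> sphere 0 r) \<times> {0..r}"
    have cT: "compact T" unfolding T_def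
      by (intro compact_Times compact_Int_closed compact_sphere compact_Icc closed_sphere)
        (simp add: compact_eq_bounded_closed bS clS)
    have TK: "W (fst q + of_real (snd q)) \<in> - K" if "q \<in> T" for q
    proof (cases "snd q = 0")
      case True
      then show ?thesis using that r(1) WK[of "fst q"] unfolding T_def by (auto simp: S_def simp del: image_iff)
    next
      case False
      then have "fst q \<in> S" "0 < snd q" "snd q \<le> r" using that by (auto simp: T_def)
      from WK[OF shift[OF this]] show ?thesis by simp
    qed
    have ne: "T \<noteq> {}"
    proof -
      have "(of_real r, 0) \<in> T" using r k by (auto simp: T_def S_def)
      then show ?thesis by blast
    qed
    have "continuous_on T (\<lambda>q. norm (\<psi> (W (fst q + of_real (snd q)))))"
      by (intro continuous_on_norm continuous_on_compose2[OF holomorphic_on_imp_continuous_on[OF hol_psi]])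
        (use TK in \<open>auto simp: W_def intro!: continuous_intros\<close>)
    then obtain q where q: "q \<in> T" "\<forall>q'\<in>T. norm (\<psi> (W (fst q + of_real (snd q)))) \<le> norm (\<psi> (W (fst q' + of_real (snd q'))))"
      using continuous_attains_inf[OF cT ne] by blast
    have "1 < norm (\<psi> (W (fst q + of_real (snd q))))" using TK[OF q(1)] by (intro norm_psi) simp
    moreover have "norm (\<psi> (W (fst q + of_real (snd q)))) \<le> norm (\<psi> (W (x + of_real \<tau>)))"
      if "x \<in> S" "norm x = r" "0 \<le> \<tau>" "\<tau> \<le> r" for x \<tau>
      using bspec[OF q(2), of "(x, \<tau>)"] that by (simp add: T_def)
    ultimately show ?thesis by blast
  qed
  then obtain R where R: "1 < R" "\<And>x \<tau>. x \<in> S \<Longrightarrow> norm x = r \<Longrightarrow> 0 \<le> \<tau> \<Longrightarrow> \<tau> \<le> r \<Longrightarrow> R \<le> norm (\<psi> (W (x + of_real \<tau>)))"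
    by blast
  \<comment> \<open>With this choice \<open>exp (\<kappa> * r powr p)\<close> is exactly the lower
    bound \<open>R\<close> on the arc.\<close>
  define \<kappa> where "\<kappa> = ln R / r powr p"
  have \<kappa>: "0 < \<kappa>" using R(1) r(1) by (simp add: \<kappa>_def)
  have ReS: "0 \<le> Re x" if "x \<in> S" for x
    using that k order_trans[of 0 "k * norm x" "Re x"] by (auto simp: S_def)
  have main: "exp (\<kappa> * t powr p) \<le> norm (\<psi> (W (of_real (t + \<tau>))))" if t: "0 < t" "t < r" and \<tau>: "0 < \<tau>" "\<tau> \<le> r" for t \<tau>
  proof -
    \<comment> \<open>The comparison in holomorphic form. On the arc \<open>F\<close> is bounded by
      1 through the choice of \<open>\<kappa>\<close>, on the edges because the exponent has
      nonpositive real part and \<open>\<psi>\<close> has modulus above 1.\<close>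
    define F where "F = (\<lambda>x. exp (of_real \<kappa> * x powr of_real p) / \<psi> (W (x + of_real \<tau>)))"
    have SK: "W (x + of_real \<tau>) \<in> - K" if "x \<in> S" for x using WK[OF shift[OF that \<tau>]] by simp
    have psi0: "\<psi> (W (x + of_real \<tau>)) \<noteq> 0" if "x \<in> S" for x using psi_nonzero SK[OF that] by simp
    have "norm (F (of_real t)) \<le> 1"
    proof (rule maximum_modulus_frontier[of F S])
      have tS: "of_real t \<in> S" using t k by (simp add: S_def)
      show "of_real t \<in> S" by fact
      show "bounded S" by fact
      have "continuous_on S F" unfolding F_def
        using psi0 ReS p
        by (intro continuous_intros continuous_on_compose2[OF holomorphic_on_imp_continuous_on[OF hol_psi]])
           (use SK in \<open>auto simp: W_def intro!: continuous_intros\<close>)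
      then show "continuous_on (closure S) F" using clS by simp
      have int0: "x \<notin> \<real>\<^sub>\<le>\<^sub>0" if x: "x \<in> interior S" for x
      proof
        assume "x \<in> \<real>\<^sub>\<le>\<^sub>0"
        then have "Re x \<le> 0" by (simp add: complex_nonpos_Reals_iff)
        obtain e where e: "0 < e" "cball x e \<subseteq> S" using x mem_interior_cball by blast
        have "x - of_real e \<in> S" using e by (intro subsetD[OF e(2)]) (simp add: dist_norm)
        then show False using ReS[of "x - of_real e"] \<open>Re x \<le> 0\<close> e(1) by simp
      qed
      show "F holomorphic_on interior S" unfolding F_def
      proof (intro holomorphic_intros)
        have "(\<psi> \<circ> (\<lambda>x. W (x + of_real \<tau>))) holomorphic_on interior S"
          by (rule holomorphic_on_compose_gen[OF _ hol_psi])
            (use SK interior_subset in \<open>auto simp: W_def intro!: holomorphic_intros\<close>)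
        then show "(\<lambda>x. \<psi> (W (x + of_real \<tau>))) holomorphic_on interior S" by (simp add: o_def)
      qed (use psi0 interior_subset int0 in auto)
      fix x assume x: "x \<in> frontier S"
      have "open {x. norm x < r \<and> k * norm x < Re x}"
        by (intro open_Collect_conj open_Collect_less continuous_intros)
      then have "x \<in> S - {x. norm x < r \<and> k * norm x < Re x}"
        by (rule frontier_closed_subset[OF clS]) (use x in \<open>auto simp: S_def\<close>)
      then have xS: "x \<in> S" and cases: "norm x = r \<or> Re x = k * norm x" by (auto simp: S_def)
      have nF: "norm (F x) = exp (\<kappa> * Re (x powr of_real p)) / norm (\<psi> (W (x + of_real \<tau>)))"
        unfolding F_def norm_divide by simp
      have "exp (\<kappa> * Re (x powr of_real p)) \<le> norm (\<psi> (W (x + of_real \<tau>)))"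
        using cases
      proof
        assume xr: "norm x = r"
        have "Re (x powr of_real p) \<le> r powr p"
          using complex_Re_le_cmod[of "x powr of_real p"] xr by (simp add: norm_powr_of_real)
        then have "\<kappa> * Re (x powr of_real p) \<le> \<kappa> * r powr p" using \<kappa> by simp
        also have "\<dots> = ln R" using r(1) by (simp add: \<kappa>_def)
        finally have "exp (\<kappa> * Re (x powr of_real p)) \<le> R" using R(1) by (metis exp_le_cancel_iff exp_ln less_trans zero_less_one)
        then show ?thesis using R(2)[OF xS xr] \<tau> by (meson less_imp_le order_trans)
      next
        assume "Re x = k * norm x"
        then have "Re (x powr of_real p) \<le> 0" using cos_powr_sector[OF p] by (simp add: k_def)
        then have "exp (\<kappa> * Re (x powr of_real p)) \<le> 1" using \<kappa> by (simp add: mult_le_0_iff)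
        moreover have "1 < norm (\<psi> (W (x + of_real \<tau>)))" using SK[OF xS] by (intro norm_psi) simp
        ultimately show ?thesis by linarith
      qed
      then show "norm (F x) \<le> 1" unfolding nF using psi0[OF xS] by (simp add: divide_le_eq)
    qed
    moreover have "of_real t \<in> S" using t k by (simp add: S_def)
    then have "\<psi> (W (of_real t + of_real \<tau>)) \<noteq> 0" by (rule psi0)
    moreover have "norm (F (of_real t)) = exp (\<kappa> * t powr p) / norm (\<psi> (W (of_real t + of_real \<tau>)))"
      unfolding F_def norm_divide using t by (simp add: powr_of_real)
    ultimately show ?thesis by (simp add: divide_le_eq)
  qed
  have tK: "W (of_real t) \<notin> K" if "0 < t" "t < 2 * r" for t
    by (rule WK) (use that k in auto)
  have lim: "exp (\<kappa> * t powr p) \<le> norm (\<psi> (W (of_real t)))" if t: "0 < t" "t < r" for t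
  proof (rule tendsto_lowerbound)
    have "isCont \<psi> (W (of_real t))"
      using holomorphic_on_imp_continuous_on[OF hol_psi] tK[of t] t open_outside
      by (simp add: continuous_on_eq_continuous_at)
    moreover have "((\<lambda>\<tau>. W (of_real (t + \<tau>))) \<longlongrightarrow> W (of_real (t + 0))) (at_right 0)"
      unfolding W_def by (intro tendsto_intros)
    ultimately show "((\<lambda>\<tau>. norm (\<psi> (W (of_real (t + \<tau>))))) \<longlongrightarrow> norm (\<psi> (W (of_real t)))) (at_right 0)"
      by (intro tendsto_norm isCont_tendsto_compose[of _ \<psi>]) auto
    show "\<forall>\<^sub>F \<tau> in at_right 0. exp (\<kappa> * t powr p) \<le> norm (\<psi> (W (of_real (t + \<tau>))))"
      unfolding eventually_at_right_field using main[OF t] r(1) by (intro exI[of _ r]) auto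
  qed simp
  show ?thesis
    by (rule that[OF \<kappa> r(1)]) (use tK lim r(1) in \<open>auto simp: W_def n_def simp del: image_iff\<close>)
qed

lemma P_near_boundary:
  obtains B d where "0 \<le> B" "0 < d" "\<And>w s. w \<notin> K \<Longrightarrow> norm s = 1 \<Longrightarrow> norm (w - f s) < d \<Longrightarrow> norm (deriv \<psi> w) \<le> B"
proof -
  obtain C where C: "0 \<le> C" "\<forall>w s. w \<notin> K \<longrightarrow> norm s = 1 \<longrightarrow> norm (w - f s) \<le> 1 \<longrightarrow> norm (P w - Pb s) \<le> C * norm (w - f s) powr a"
    using P_boundary by blast
  obtain B where B: "0 \<le> B" "\<And>s. s \<in> sphere 0 1 \<Longrightarrow> norm (Pb s) \<le> B"
    by (rule holder_on_bounded[OF holder_Pb a(1) compact_sphere]) blast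
  obtain d where d: "0 < d" "\<And>w s. w \<notin> K \<Longrightarrow> norm s \<le> 1 \<Longrightarrow> norm (w - f s) < d \<Longrightarrow> norm (\<psi> w) < 2"
    by (rule psi_near_boundary[of 2], simp, blast)
  have "norm (deriv \<psi> w) \<le> (B + C) * 2" if w: "w \<notin> K" and s: "norm s = 1" "norm (w - f s) < min 1 d" for w s
  proof -
    have "norm (P w - Pb s) \<le> C * norm (w - f s) powr a" using C(2) w s by simp
    also have "\<dots> \<le> C * 1" using s a C(1) by (intro mult_left_mono powr_le1) auto
    finally have "norm (P w) \<le> B + C" using B(2)[of s] s norm_triangle_ineq2[of "P w" "Pb s"] by simp
    moreover have "norm (\<psi> w) < 2" using d(2)[OF w, of s] s by simp
    ultimately have "norm (P w) * norm (\<psi> w) \<le> (B + C) * 2"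
      using C(1) B(1) by (intro mult_mono) auto
    moreover have "deriv \<psi> w = P w * \<psi> w" using psi_nonzero[OF w] by (simp add: P_def)
    ultimately show ?thesis by (simp only: norm_mult)
  qed
  moreover have "0 \<le> (B + C) * 2" "0 < min 1 d" using B(1) C(1) d(1) by auto
  ultimately show ?thesis by (intro that[of "(B + C) * 2" "min 1 d"])
qed

lemma psi_segment:
  assumes seg: "closed_segment w w' \<subseteq> - K" and B: "\<And>x. x \<in> closed_segment w w' \<Longrightarrow> norm (deriv \<psi> x) \<le> B"
  shows "norm (\<psi> w' - \<psi> w) \<le> B * norm (w' - w)"
proof (rule field_differentiable_bound[of "closed_segment w w'" \<psi> "deriv \<psi>"])
  fix x assume "x \<in> closed_segment w w'"
  then have "x \<in> - K" using seg by blast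
  then show "(\<psi> has_field_derivative deriv \<psi> x) (at x within closed_segment w w')"
    by (rule has_field_derivative_at_within[OF holomorphic_derivI[OF hol_psi open_outside]])
qed (use B in auto)

text \<open>If \<open>dens s0\<close> were 0, \<open>P\<close> would be \<open>O(d^a)\<close> at
  distance \<open>d\<close> from \<open>f s0\<close>, and integrating \<open>\<psi>'\<close> along
  the outer normal would give \<open>norm (\<psi> (W t)) \<le> 1 + C3 * t powr (1 + a)\<close>. This
  contradicts the lower bound \<open>1 + \<kappa> * t powr p\<close> for any \<open>p\<close>
  strictly between 1 and \<open>1 + a\<close>.\<close>

lemma dens_pos:
  assumes s0: "norm s0 = 1" shows "0 < dens s0"
proof (rule ccontr)
  assume "\<not> 0 < dens s0"
  then have "Pb s0 = 0" using dens_nonneg[OF s0] by (simp add: Pb_def)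
  obtain C where C: "0 \<le> C" "\<forall>w s. w \<notin> K \<longrightarrow> norm s = 1 \<longrightarrow> norm (w - f s) \<le> 1 \<longrightarrow> norm (P w - Pb s) \<le> C * norm (w - f s) powr a"
    using P_boundary by blast
  define p where "p = 1 + a / 2"
  have p: "1 < p" "p < 2" using a by (auto simp: p_def)
  obtain \<kappa> r where \<kappa>: "0 < \<kappa>" "0 < r" "\<And>t. 0 < t \<Longrightarrow> t < r \<Longrightarrow> f s0 + of_real t * (s0 * f1 s0) \<notin> K"
    "\<And>t. 0 < t \<Longrightarrow> t < r \<Longrightarrow> exp (\<kappa> * t powr p) \<le> norm (\<psi> (f s0 + of_real t * (s0 * f1 s0)))"
    by (rule psi_lower_bound[OF s0 p]) blast
  define n where "n = s0 * f1 s0"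
  define N where "N = norm n"
  have N: "0 < N" using f1_nonzero[of s0] s0 by (auto simp: n_def N_def)
  define W where "W = (\<lambda>t. f s0 + of_real t * n)"
  have Wd: "norm (W t - f s0) = t * N" if "0 \<le> t" for t using that by (simp add: W_def N_def norm_mult)
  obtain d where d: "0 < d" "\<And>w s. w \<notin> K \<Longrightarrow> norm s \<le> 1 \<Longrightarrow> norm (w - f s) < d \<Longrightarrow> norm (\<psi> w) < 2"
    by (rule psi_near_boundary[of 2], simp, blast)
  define r' where "r' = min r (min (1 / N) (d / N))"
  have r': "0 < r'" "r' \<le> r" "r' * N \<le> 1" "r' * N \<le> d" using \<kappa>(2) d N
    by (auto simp: r'_def min_def field_simps)
  define C3 where "C3 = 2 * C * N powr a * N"
  have upper: "norm (\<psi> (W t)) \<le> 1 + C3 * t powr (1 + a)" if t: "0 < t" "t < r'" for t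
  proof -
    have step: "norm (\<psi> (W t)) \<le> norm (\<psi> (W \<sigma>)) + C3 * t powr (1 + a)" if \<sigma>: "0 < \<sigma>" "\<sigma> < t" for \<sigma>
    proof -
      have segW: "\<exists>x. y = W x \<and> \<sigma> \<le> x \<and> x \<le> t" if y: "y \<in> closed_segment (W \<sigma>) (W t)" for y
      proof -
        obtain u where u: "0 \<le> u" "u \<le> 1" "y = (1 - u) *\<^sub>R W \<sigma> + u *\<^sub>R W t"
          using y by (auto simp: closed_segment_def)
        have "y = W (\<sigma> + u * (t - \<sigma>))" unfolding u(3) W_def by (simp add: scaleR_conv_of_real algebra_simps)
        moreover have "0 \<le> u * (t - \<sigma>)" "u * (t - \<sigma>) \<le> 1 * (t - \<sigma>)" using u \<sigma> by (auto intro!: mult_right_mono)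
        ultimately show ?thesis by (intro exI[of _ "\<sigma> + u * (t - \<sigma>)"]) auto
      qed
      have WK: "W x \<notin> K" if "\<sigma> \<le> x" "x \<le> t" for x
        using \<kappa>(3)[of x] that \<sigma> t r' unfolding W_def n_def by simp
      have "norm (\<psi> (W t) - \<psi> (W \<sigma>)) \<le> (2 * C * (N * t) powr a) * norm (W t - W \<sigma>)"
      proof (rule psi_segment)
        show "closed_segment (W \<sigma>) (W t) \<subseteq> - K"
        proof
          fix y assume "y \<in> closed_segment (W \<sigma>) (W t)"
          then obtain x where "y = W x" "\<sigma> \<le> x" "x \<le> t" using segW by blast
          then show "y \<in> - K" using WK by simp
        qed
        fix y assume "y \<in> closed_segment (W \<sigma>) (W t)"
        then obtain x where x: "y = W x" "\<sigma> \<le> x" "x \<le> t" using segW by blast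
        have "x * N < r' * N" using x t N by simp
        then have b: "norm (W x - f s0) < 1" "norm (W x - f s0) < d" using Wd[of x] x \<sigma> r' by auto
        have y: "y \<notin> K" using WK x by simp
        have "norm (P y) \<le> C * norm (W x - f s0) powr a"
          using C(2)[rule_format, OF y s0] b(1) x(1) \<open>Pb s0 = 0\<close> by simp
        also have "\<dots> \<le> C * (N * t) powr a"
          using Wd[of x] x \<sigma> N C(1) a by (intro mult_left_mono powr_mono2) (auto simp: mult.commute)
        finally have "norm (P y) \<le> C * (N * t) powr a" .
        moreover have "norm (\<psi> y) \<le> 2" using d(2)[OF y, of s0] s0 b(2) x(1) by simp
        ultimately have "norm (P y) * norm (\<psi> y) \<le> (C * (N * t) powr a) * 2"
          using C(1) by (intro mult_mono) auto
        moreover have "deriv \<psi> y = P y * \<psi> y" using psi_nonzero[OF y] by (simp add: P_def)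
        ultimately show "norm (deriv \<psi> y) \<le> 2 * C * (N * t) powr a" by (simp add: norm_mult)
      qed
      also have "W t - W \<sigma> = of_real (t - \<sigma>) * n" by (simp add: W_def algebra_simps)
      then have "norm (W t - W \<sigma>) = (t - \<sigma>) * N" using \<sigma> by (simp add: norm_mult N_def flip: of_real_diff)
      also have "(2 * C * (N * t) powr a) * ((t - \<sigma>) * N) \<le> (2 * C * (N * t) powr a) * (t * N)"
        using C(1) \<sigma> N by (intro mult_left_mono mult_right_mono) auto
      also have "\<dots> = C3 * t powr (1 + a)" using N t by (simp add: C3_def powr_mult powr_add)
      finally show ?thesis using norm_triangle_ineq2[of "\<psi> (W t)" "\<psi> (W \<sigma>)"] by linarith
    qed
    show ?thesis
    proof (rule field_le_epsilon)
      fix e :: real assume e: "0 < e"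
      \<comment> \<open>Starting the segment close enough to the curve makes \<open>\<psi>\<close>
        almost unimodular there, which removes \<open>\<sigma>\<close> from the bound.\<close>
      obtain d' where d': "0 < d'" "\<And>w s. w \<notin> K \<Longrightarrow> norm s \<le> 1 \<Longrightarrow> norm (w - f s) < d' \<Longrightarrow> norm (\<psi> w) < 1 + e"
        by (rule psi_near_boundary[of "1 + e"], use e in simp, blast)
      define \<sigma> where "\<sigma> = min (t / 2) (d' / (2 * N))"
      have \<sigma>: "0 < \<sigma>" "\<sigma> < t" "\<sigma> * N < d'" using t d' N by (auto simp: \<sigma>_def min_def field_simps)
      have "W \<sigma> \<notin> K" using \<kappa>(3)[of \<sigma>] \<sigma> t r' unfolding W_def n_def by simp
      then have "norm (\<psi> (W \<sigma>)) < 1 + e" using d'(2)[of "W \<sigma>" s0] s0 Wd[of \<sigma>] \<sigma> by simp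
      then show "norm (\<psi> (W t)) \<le> 1 + C3 * t powr (1 + a) + e" using step[OF \<sigma>(1,2)] by linarith
    qed
  qed
  have C30: "0 \<le> C3" using C(1) N by (simp add: C3_def)
  \<comment> \<open>So small that \<open>C3 * t powr (a / 2)\<close> is at most
    \<open>\<kappa> / 2\<close>; the exponent \<open>a / 2\<close> is the gap between
    \<open>1 + a\<close> and \<open>p\<close>.\<close>
  define t where "t = min (r' / 2) ((\<kappa> / (2 * (C3 + 1))) powr (2 / a))"
  have t: "0 < t" "t < r'" using r'(1) \<kappa>(1) C30 by (auto simp: t_def)
  have "t powr (a / 2) \<le> ((\<kappa> / (2 * (C3 + 1))) powr (2 / a)) powr (a / 2)"
    using t a by (intro powr_mono2) (auto simp: t_def)
  also have "\<dots> = \<kappa> / (2 * (C3 + 1))" using a \<kappa>(1) C30 by (simp add: powr_powr)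
  finally have ta: "C3 * t powr (a / 2) \<le> C3 * (\<kappa> / (2 * (C3 + 1)))" using C30 by (rule mult_left_mono)
  also have "C3 * (\<kappa> / (2 * (C3 + 1))) = (C3 / (C3 + 1)) * (\<kappa> / 2)" by simp
  also have "\<dots> \<le> 1 * (\<kappa> / 2)" using C30 \<kappa>(1) by (intro mult_right_mono) auto
  also have "\<dots> < \<kappa>" using \<kappa>(1) by simp
  finally have lt: "C3 * t powr (a / 2) < \<kappa>" .
  have "1 + \<kappa> * t powr p \<le> exp (\<kappa> * t powr p)" by (rule exp_ge_add_one_self)
  also have "\<dots> \<le> norm (\<psi> (W t))" using \<kappa>(4)[of t] t r' by (simp add: W_def n_def)
  also have "\<dots> \<le> 1 + C3 * t powr (1 + a)" by (rule upper[OF t])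
  also have "t powr (1 + a) = t powr (a / 2) * t powr p" by (simp add: p_def powr_add[symmetric] add.commute)
  finally have "\<kappa> * t powr p \<le> (C3 * t powr (a / 2)) * t powr p" by simp
  moreover have "0 < t powr p" using t by simp
  ultimately have "\<kappa> \<le> C3 * t powr (a / 2)" by (rule mult_right_le_imp_le)
  then show False using lt by simp
qed

end

subsection \<open>The kernel\<close>

text \<open>The maximum principle for the real parts of \<open>\<i> * G\<close> and
  \<open>- \<i> * G\<close> on slightly smaller discs makes \<open>Im G\<close> vanish, and a
  real-valued \<open>G\<close> cannot be open, hence is constant.\<close>

lemma holomorphic_Im_vanishing:
  assumes hol: "G holomorphic_on ball 0 1"
    and Im: "\<And>e. 0 < e \<Longrightarrow> \<exists>r<1. \<forall>\<eta>. r < norm \<eta> \<longrightarrow> norm \<eta> < 1 \<longrightarrow> \<bar>Im (G \<eta>)\<bar> \<le> e"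
  obtains c :: real where "\<And>\<eta>. norm \<eta> < 1 \<Longrightarrow> G \<eta> = of_real c"
proof -
  have Im0: "Im (G \<eta>) = 0" if \<eta>: "norm \<eta> < 1" for \<eta>
  proof -
    have "\<bar>Im (G \<eta>)\<bar> \<le> e" if e: "0 < e" for e
    proof -
      obtain r where r: "r < 1" "\<And>\<eta>. r < norm \<eta> \<Longrightarrow> norm \<eta> < 1 \<Longrightarrow> \<bar>Im (G \<eta>)\<bar> \<le> e" using Im[OF e] by blast
      obtain r' where r': "max r (norm \<eta>) < r'" "r' < 1" using dense[of "max r (norm \<eta>)" 1] r \<eta> by auto
      have "0 < r'" using r'(1) norm_ge_zero[of \<eta>] by linarith
      have hol': "(\<lambda>x. k * G x) holomorphic_on interior (cball 0 r')" for k
        using r' by (intro holomorphic_intros holomorphic_on_subset[OF hol]) (auto simp: subset_ball)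
      have con': "continuous_on (closure (cball 0 r')) (\<lambda>x. k * G x)" for k
        using r' by (intro continuous_intros continuous_on_subset[OF holomorphic_on_imp_continuous_on[OF hol]]) auto
      have fr: "\<bar>Im (G z)\<bar> \<le> e" if "z \<in> frontier (cball 0 r')" for z
        using that r' \<open>0 < r'\<close> by (intro r(2)) auto
      have "Re (\<i> * G \<eta>) \<le> e" 
        by (rule maximum_real_frontier[OF hol' con' bounded_cball]) (use fr r' in \<open>fastforce simp: abs_le_iff\<close>)+
      moreover have "Re (- \<i> * G \<eta>) \<le> e"
        by (rule maximum_real_frontier[OF hol' con' bounded_cball]) (use fr r' in \<open>fastforce simp: abs_le_iff\<close>)+
      ultimately show ?thesis by simp
    qed
    then have "\<bar>Im (G \<eta>)\<bar> \<le> 0" by (rule field_le_epsilon[where y = 0, simplified])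
    then show ?thesis by simp
  qed
  have "G constant_on ball 0 1"
  proof (rule ccontr)
    assume "\<not> G constant_on ball 0 1"
    then have "open (G ` ball 0 1)"
      using open_mapping_thm[OF hol open_ball connected_ball open_ball order_refl] by blast
    moreover have "G 0 \<in> G ` ball 0 1" by simp
    ultimately obtain e where e: "0 < e" "ball (G 0) e \<subseteq> G ` ball 0 1" by (meson openE)
    have "G 0 + \<i> * of_real (e / 2) \<in> ball (G 0) e" using e(1) by (simp add: dist_norm norm_mult)
    then obtain \<eta> where "norm \<eta> < 1" "G \<eta> = G 0 + \<i> * of_real (e / 2)" using e(2) by (auto simp: subset_iff image_iff)
    then show False using Im0[of \<eta>] Im0[of 0] e(1) by simp
  qed
  then obtain c where c: "\<And>\<eta>. \<eta> \<in> ball 0 1 \<Longrightarrow> G \<eta> = c" unfolding constant_on_def by blast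
  have "c = of_real (Re c)" using Im0[of 0] c[of 0] by (simp add: complex_eq_iff)
  then show ?thesis using that[of "Re c"] c by simp
qed

section \<open>Continuity of the inverse exterior map up to the curve\<close>

context conformal_welding
begin

text \<open>Suppose the segment entered \<open>K\<close>, first at \<open>f z\<close>. Just before,
  it runs through points \<open>f z - \<sigma> n\<close>; these lie in \<open>K\<close> already, by
  openness if \<open>z\<close> is interior and by the inner cone at \<open>f z\<close> otherwise,
  against the choice of the first entry.\<close>

lemma outward_segment:
  obtains \<rho> where "0 < \<rho>" "\<And>s w t. norm s = 1 \<Longrightarrow> w \<notin> K \<Longrightarrow> norm (w - f s) < \<rho> \<Longrightarrow> 0 \<le> t \<Longrightarrow> t < \<rho> \<Longrightarrow>
    w + of_real t * (s * f1 s) \<notin> K"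
proof -
  obtain m M where mM: "0 < m" "1 \<le> M" "\<And>s. norm s = 1 \<Longrightarrow> m \<le> norm (s * f1 s)" "\<And>s. norm s = 1 \<Longrightarrow> norm (s * f1 s) \<le> M"
    by (rule normal_bounds) blast
  obtain c where c: "0 < c" "c \<le> 1" "\<And>z w. norm z \<le> 1 \<Longrightarrow> norm w \<le> 1 \<Longrightarrow> c * norm (z - w) \<le> norm (f z - f w)"
    by (rule bilip) blast
  define \<eta> where "\<eta> = 1 / (4 * M)"
  have \<eta>: "0 < \<eta>" "\<And>s. norm s = 1 \<Longrightarrow> norm (s * f1 s) * \<eta> \<le> 1/4" using mM by (auto simp: \<eta>_def field_simps)
  obtain \<rho>1 where \<rho>1: "0 < \<rho>1" "\<And>s w. norm s = 1 \<Longrightarrow> norm (w - f s) < \<rho>1 \<Longrightarrow>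
     Re ((w - f s) / (s * f1 s)) < - \<eta> * norm (w - f s) \<Longrightarrow> w \<in> f ` ball 0 1"
    by (rule cone_inside[OF \<eta>], assumption, rule that, assumption, iprover)
  have "uniformly_continuous_on (sphere 0 1) (\<lambda>s. s * f1 s)"
    by (intro compact_uniformly_continuous continuous_intros continuous_on_subset[OF cont_f1]) auto
  then obtain \<delta> where \<delta>: "0 < \<delta>" "\<And>s s'. norm s = 1 \<Longrightarrow> norm s' = 1 \<Longrightarrow> norm (s' - s) < \<delta> \<Longrightarrow> norm (s' * f1 s' - s * f1 s) < m / 2"
    using mM(1) unfolding uniformly_continuous_on_def dist_norm by (metis half_gt_zero mem_sphere_0)
  \<comment> \<open>The first entry point is within \<open>\<rho> * (1 + M) < c * \<delta>\<close>
    of \<open>f s\<close>, so its parameter is within \<open>\<delta>\<close> of \<open>s\<close>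
    and the two normals differ by less than \<open>m / 2\<close>.\<close>
  define \<rho> where "\<rho> = c * \<delta> / (2 * (1 + M))"
  have \<rho>: "0 < \<rho>" "\<rho> * (1 + M) < c * \<delta>" 
  proof -
    have "0 < c * \<delta>" using c(1) \<delta>(1) by simp
    moreover have "1 + M \<noteq> 0" using mM(2) by simp
    then have "\<rho> * (1 + M) = c * \<delta> / 2" by (simp add: \<rho>_def field_simps)
    ultimately show "\<rho> * (1 + M) < c * \<delta>" by linarith
    show "0 < \<rho>" using mM(2) \<open>0 < c * \<delta>\<close> by (simp add: \<rho>_def)
  qed
  have "w + of_real t * (s * f1 s) \<notin> K"
    if s: "norm s = 1" and w: "w \<notin> K" "norm (w - f s) < \<rho>" and t: "0 \<le> t" "t < \<rho>" for s w t
  proof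
    define n where "n = s * f1 s"
    assume "w + of_real t * (s * f1 s) \<in> K"
    then have tK: "w + of_real t * n \<in> K" by (simp add: n_def)
    define A where "A = {0..t} \<inter> (\<lambda>\<tau>. w + of_real \<tau> * n) -` K"
    have "closed ((\<lambda>\<tau>. w + of_real \<tau> * n) -` K)"
      by (intro closed_vimage compact_imp_closed[OF compact_K] continuous_intros)
    then have "compact A" unfolding A_def by (intro compact_Int_closed) auto
    moreover have "t \<in> A" using tK t by (simp add: A_def)
    ultimately obtain t1 where t1: "t1 \<in> A" "\<And>\<tau>. \<tau> \<in> A \<Longrightarrow> t1 \<le> \<tau>"
      using compact_attains_inf[of A] by blast
    have t1': "0 \<le> t1" "t1 \<le> t" "w + of_real t1 * n \<in> K" using t1(1) by (auto simp: A_def)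
    have t1_pos: "0 < t1" using t1' w(1) by (cases "t1 = 0") auto
    obtain z where z: "norm z \<le> 1" "w + of_real t1 * n = f z" using t1'(3) by auto
    have nM: "norm n \<le> M" "m \<le> norm n" using mM s by (auto simp: n_def)
    \<comment> \<open>On the circle the quotient of the normals has real part at least
      \<open>1/2\<close>, while \<open>norm n * \<eta>\<close> is at most \<open>1/4\<close>, so the
      backward direction lies in the inner cone.\<close>
    have "\<exists>e>0. \<forall>\<sigma>. 0 < \<sigma> \<longrightarrow> \<sigma> * M < e \<longrightarrow> f z - of_real \<sigma> * n \<in> K"
    proof (cases "norm z < 1")
      case True
      then obtain e where e: "0 < e" "ball (f z) e \<subseteq> f ` ball 0 1" using open_inside by (meson imageI mem_ball_0 openE)
      have "f z - of_real \<sigma> * n \<in> K" if "0 < \<sigma>" "\<sigma> * M < e" for \<sigma>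
      proof -
        have "\<sigma> * norm n < e" using that mult_left_mono[OF nM(1), of \<sigma>] by linarith
        then have "f z - of_real \<sigma> * n \<in> ball (f z) e" using that by (simp add: dist_norm norm_mult)
        then show ?thesis using e(2) ball_subset_cball by blast
      qed
      then show ?thesis using e(1) by blast
    next
      case False
      then have z1: "norm z = 1" using z(1) by simp
      define n1 where "n1 = z * f1 z"
      have n1: "m \<le> norm n1" "n1 \<noteq> 0" using mM(3)[OF z1] mM(1) by (auto simp: n1_def)
      have "norm (n - n1) < m / 2"
      proof -
        have "c * norm (z - s) \<le> norm (f z - f s)" using c(3) z s by simp
        also have "f z - f s = (w - f s) + of_real t1 * n" using z(2) by (simp add: algebra_simps)
        also have "norm \<dots> \<le> norm (w - f s) + t1 * norm n"
          using norm_triangle_ineq[of "w - f s" "of_real t1 * n"] t1_pos by (simp add: norm_mult)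
        also have "\<dots> \<le> \<rho> + \<rho> * M" using w(2) t1' t nM by (intro add_mono mult_mono) auto
        also have "\<dots> < c * \<delta>" using \<rho>(2) by (simp add: algebra_simps)
        finally have "norm (s - z) < \<delta>" using c(1) by (simp add: norm_minus_commute)
        then show ?thesis unfolding n_def n1_def by (intro \<delta>(2) z1 s)
      qed
      moreover have "n / n1 - 1 = (n - n1) / n1" using n1 by (simp add: diff_divide_distrib)
      ultimately have "norm (n / n1 - 1) \<le> (m / 2) / m"
        using n1 mM(1) by (simp only: norm_divide) (intro frac_le, auto)
      then have "norm (n / n1 - 1) \<le> 1/2" using mM(1) by simp
      then have Re: "1/2 \<le> Re (n / n1)" using abs_Re_le_cmod[of "n / n1 - 1"] by simp
      have "f z - of_real \<sigma> * n \<in> K" if \<sigma>: "0 < \<sigma>" "\<sigma> * M < \<rho>1" for \<sigma>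
      proof -
        have d: "f z - of_real \<sigma> * n - f z = of_real (- \<sigma>) * n" by simp
        have nd: "norm (f z - of_real \<sigma> * n - f z) = \<sigma> * norm n" unfolding d using \<sigma> by (simp add: norm_mult)
        have "f z - of_real \<sigma> * n \<in> f ` ball 0 1"
        proof (rule \<rho>1(2)[OF z1])
          show "norm (f z - of_real \<sigma> * n - f z) < \<rho>1"
            unfolding nd using \<sigma> mult_left_mono[OF nM(1), of \<sigma>] by linarith
          have eq: "- \<eta> * (\<sigma> * norm n) = - (\<sigma> * (norm n * \<eta>))" by simp
          have "Re ((f z - of_real \<sigma> * n - f z) / (z * f1 z)) = - (\<sigma> * Re (n / n1))"
          proof -
            have "(f z - of_real \<sigma> * n - f z) / (z * f1 z) = of_real (- \<sigma>) * (n / n1)" unfolding d n1_def by simp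
            then show ?thesis by (simp only: Re_complex_of_real Im_complex_of_real times_complex.sel)
          qed
          moreover have "\<sigma> * (1/2) \<le> \<sigma> * Re (n / n1)" using Re \<sigma> by (intro mult_left_mono) auto
          moreover have "\<sigma> * (norm n * \<eta>) \<le> \<sigma> * (1/4)" using \<eta>(2)[OF s] \<sigma> by (intro mult_left_mono) (auto simp: n_def)
          ultimately show "Re ((f z - of_real \<sigma> * n - f z) / (z * f1 z)) < - \<eta> * norm (f z - of_real \<sigma> * n - f z)"
            unfolding nd eq using \<sigma>(1) by linarith
        qed
        then show ?thesis using ball_subset_cball by blast
      qed
      then show ?thesis using \<rho>1(1) by blast
    qed
    then obtain e where e: "e > 0" "\<And>\<sigma>. 0 < \<sigma> \<Longrightarrow> \<sigma> * M < e \<Longrightarrow> f z - of_real \<sigma> * n \<in> K" by blast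
    define \<sigma> where "\<sigma> = min t1 (e / (2 * M))"
    have \<sigma>: "0 < \<sigma>" "\<sigma> \<le> t1" "\<sigma> * M < e" using t1_pos e(1) mM(2) by (auto simp: \<sigma>_def min_def field_simps)
    have "w + of_real (t1 - \<sigma>) * n = f z - of_real \<sigma> * n" using z(2) by (simp add: algebra_simps)
    then have "t1 - \<sigma> \<in> A" using e(2)[OF \<sigma>(1,3)] \<sigma> t1' by (simp add: A_def)
    then show False using t1(2) \<sigma>(1) by force
  qed
  then show ?thesis using that \<rho>(1) by blast
qed

text \<open>Any two outside points within \<open>q\<close> of \<open>f s\<close> are joined outside
  \<open>K\<close> by a path of length \<open>O(q)\<close>: out along the normal, straight across,
  and back in. Since \<open>\<psi>'\<close> is bounded near the curve, \<open>\<psi>\<close> changes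
  by \<open>O(q)\<close>.\<close>

lemma psi_oscillation:
  assumes s: "norm s = 1"
  obtains Q r where "0 \<le> Q" "0 < r" "\<And>w w' q. w \<notin> K \<Longrightarrow> w' \<notin> K \<Longrightarrow> q < r \<Longrightarrow> norm (w - f s) < q \<Longrightarrow> norm (w' - f s) < q \<Longrightarrow>
    norm (\<psi> w - \<psi> w') \<le> Q * q"
proof -
  obtain m M where mM: "0 < m" "1 \<le> M" "\<And>s. norm s = 1 \<Longrightarrow> m \<le> norm (s * f1 s)" "\<And>s. norm s = 1 \<Longrightarrow> norm (s * f1 s) \<le> M"
    by (rule normal_bounds) blast
  define n where "n = s * f1 s"
  have n: "m \<le> norm n" "norm n \<le> M" "n \<noteq> 0" using mM s by (force simp: n_def)+
  obtain B d where B: "0 \<le> B" "0 < d" "\<And>w s. w \<notin> K \<Longrightarrow> norm s = 1 \<Longrightarrow> norm (w - f s) < d \<Longrightarrow> norm (deriv \<psi> w) \<le> B"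
    by (rule P_near_boundary) blast
  obtain \<rho> where \<rho>: "0 < \<rho>" "\<And>s w t. norm s = 1 \<Longrightarrow> w \<notin> K \<Longrightarrow> norm (w - f s) < \<rho> \<Longrightarrow> 0 \<le> t \<Longrightarrow> t < \<rho> \<Longrightarrow>
    w + of_real t * (s * f1 s) \<notin> K" by (rule outward_segment) blast
  have M2: "0 < 1 / (2 * M)" using mM by simp
  obtain \<rho>2 where \<rho>2: "0 < \<rho>2" "\<And>s w. norm s = 1 \<Longrightarrow> 0 < norm (w - f s) \<Longrightarrow> norm (w - f s) < \<rho>2 \<Longrightarrow>
     1 / (2 * M) * norm (w - f s) \<le> Re ((w - f s) / (s * f1 s)) \<Longrightarrow> w \<notin> K"
    by (rule cone_outside[OF M2]) blast
  \<comment> \<open>The whole path stays within \<open>q * k\<close> of \<open>f s\<close>: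
    \<open>q\<close> for the starting point and \<open>4 * q / m * M\<close> for the lift.\<close>
  define k where "k = 1 + 4 * M / m"
  have k: "1 \<le> k" "4 / m \<le> k" using mM by (auto simp: k_def field_simps)
  define r where "r = min \<rho> (min d \<rho>2) / k"
  have r: "0 < r" using \<rho> \<rho>2 B k by (simp add: r_def)
  have main: "norm (\<psi> w - \<psi> w') \<le> (2 * B * k) * q"
    if w: "w \<notin> K" "w' \<notin> K" and q: "q < r" "norm (w - f s) < q" "norm (w' - f s) < q" for w w' q
  proof -
    have q0: "0 < q" using q(2) norm_ge_zero[of "w - f s"] by linarith
    have qk: "q * k < \<rho>" "q * k < d" "q * k < \<rho>2" using q(1) k by (auto simp: r_def field_simps)
    \<comment> \<open>The lift by \<open>R\<close> gives every point of the crossing segment a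
      normal coordinate of real part at least \<open>3 * q / m\<close>, and
      \<open>1 / (2 * M)\<close> times its distance from \<open>f s\<close> is at most this, so it
      lies in the outer cone.\<close>
    define R where "R = 4 * q / m"
    have "q * (4 / m) \<le> q * k" "q * 1 \<le> q * k" by (intro mult_left_mono; use k q0 in simp)+
    moreover have "R = q * (4 / m)" "0 < R" using q0 mM(1) by (simp_all add: R_def)
    ultimately have R: "0 < R" "R < \<rho>" "q < \<rho>" using qk by linarith+
    have RM: "q + R * M = q * k" using mM(1) by (simp add: R_def k_def field_simps)
    have dist: "norm (x + of_real t * n - f s) < q * k" if "norm (x - f s) < q" "0 \<le> t" "t \<le> R" for x t
    proof -
      have e: "x + of_real t * n - f s = (x - f s) + of_real t * n" by simp
      have "norm (x + of_real t * n - f s) \<le> norm (x - f s) + t * norm n"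
        unfolding e using norm_triangle_ineq[of "x - f s" "of_real t * n"] that by (simp add: norm_mult)
      also have "\<dots> < q + R * M" using that n mM by (intro add_less_le_mono mult_mono) auto
      finally show ?thesis using RM by simp
    qed
    have vert: "norm (\<psi> (x + of_real R * n) - \<psi> x) \<le> B * (R * M)" if x: "x \<notin> K" "norm (x - f s) < q" for x
    proof -
      have pt: "y \<notin> K \<and> norm (y - f s) < d" if y: "y \<in> closed_segment x (x + of_real R * n)" for y
      proof -
        obtain u where u: "0 \<le> u" "u \<le> 1" "y = (1 - u) *\<^sub>R x + u *\<^sub>R (x + of_real R * n)"
          using y by (auto simp: closed_segment_def)
        have y': "y = x + of_real (u * R) * n" unfolding u(3) by (simp add: scaleR_conv_of_real algebra_simps)
        have uR: "0 \<le> u * R" "u * R \<le> R" using u R by (auto intro: mult_left_le_one_le)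
        have "y \<notin> K" unfolding y' n_def 
          by (rule \<rho>(2)[OF s x(1) _ uR(1) le_less_trans[OF uR(2) R(2)]]) (use x(2) R in simp)
        moreover have "norm (y - f s) < d" unfolding y' using dist[OF x(2) uR] qk by simp
        ultimately show ?thesis by blast
      qed
      have "norm (\<psi> (x + of_real R * n) - \<psi> x) \<le> B * norm (x + of_real R * n - x)"
        by (rule psi_segment) (use pt B(3) s in auto)
      also have "\<dots> \<le> B * (R * M)" using R n B(1) by (intro mult_left_mono) (auto simp: norm_mult)
      finally show ?thesis .
    qed
    have horiz: "norm (\<psi> (w' + of_real R * n) - \<psi> (w + of_real R * n)) \<le> B * (2 * q)"
    proof -
      have pt: "y \<notin> K \<and> norm (y - f s) < d" if y: "y \<in> closed_segment (w + of_real R * n) (w' + of_real R * n)" for y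
      proof -
        obtain u where u: "0 \<le> u" "u \<le> 1" "y = (1 - u) *\<^sub>R (w + of_real R * n) + u *\<^sub>R (w' + of_real R * n)"
          using y by (auto simp: closed_segment_def)
        define x where "x = (1 - u) *\<^sub>R w + u *\<^sub>R w'"
        have y': "y = x + of_real R * n" unfolding u(3) x_def by (simp add: scaleR_conv_of_real algebra_simps)
        have "x \<in> ball (f s) q" unfolding x_def
          by (rule convexD_alt[OF convex_ball]) (use q u in \<open>auto simp: dist_norm norm_minus_commute\<close>)
        then have xq: "norm (x - f s) < q" by (simp add: dist_norm norm_minus_commute)
        have dy: "norm (y - f s) < q * k" unfolding y' using dist[OF xq, of R] R by simp
        have yd: "(y - f s) / n = (x - f s) / n + of_real R" unfolding y' using n(3) by (simp add: field_simps)
        have "norm ((x - f s) / n) \<le> q / m" unfolding norm_divide using xq n mM(1) q0 by (intro frac_le) auto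
        then have Re: "3 * q / m \<le> Re ((y - f s) / n)"
          unfolding yd using abs_Re_le_cmod[of "(x - f s) / n"] by (simp add: R_def)
        have "1 / (2 * M) * norm (y - f s) \<le> 1 / (2 * M) * (q * k)" using dy mM by (intro mult_left_mono) auto
        also have "\<dots> = q / (2 * M) + 2 * q / m" using mM by (simp add: k_def field_simps)
        also have "q / (2 * M) \<le> q / m" using q0 n mM by (intro divide_left_mono) auto
        finally have "1 / (2 * M) * norm (y - f s) \<le> Re ((y - f s) / (s * f1 s))"
          using Re by (simp add: n_def add_divide_distrib[symmetric])
        moreover have "0 < norm (y - f s)"
        proof -
          have "0 < 3 * q / m" using q0 mM(1) by simp
          then have "0 < Re ((y - f s) / n)" using Re by linarith
          then show ?thesis by (cases "y = f s") auto
        qed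
        ultimately have "y \<notin> K" using \<rho>2(2)[OF s] dy qk by simp
        then show ?thesis using dy qk by simp
      qed
      have "norm (\<psi> (w' + of_real R * n) - \<psi> (w + of_real R * n)) \<le> B * norm ((w' + of_real R * n) - (w + of_real R * n))"
        by (rule psi_segment) (use pt B(3) s in auto)
      also have "\<dots> \<le> B * (2 * q)"
      proof (rule mult_left_mono[OF _ B(1)])
        have "norm (w' - w) \<le> norm (w' - f s) + norm (w - f s)" by norm
        then show "norm ((w' + of_real R * n) - (w + of_real R * n)) \<le> 2 * q" using q by simp
      qed
      finally show ?thesis .
    qed
    have "norm (\<psi> w - \<psi> w') \<le> norm (\<psi> (w + of_real R * n) - \<psi> w) + norm (\<psi> (w' + of_real R * n) - \<psi> (w + of_real R * n))
        + norm (\<psi> (w' + of_real R * n) - \<psi> w')" by norm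
    also have "\<dots> \<le> B * (R * M) + B * (2 * q) + B * (R * M)"
      by (intro add_mono vert horiz w q)
    also have "\<dots> = 2 * B * (q + R * M)" by (simp add: algebra_simps)
    finally show ?thesis unfolding RM by (simp add: mult_ac)
  qed
  show ?thesis by (rule that[of "2 * B * k" r]) (use B k r main in auto)
qed

lemma boundary_accessible:
  assumes s: "norm s = 1"
  obtains X where "\<And>n::nat. X n \<notin> K" "X \<longlonglongrightarrow> f s"
proof -
  obtain \<kappa> r where \<kappa>: "0 < (\<kappa>::real)" "0 < r" "\<And>t. 0 < t \<Longrightarrow> t < r \<Longrightarrow> f s + of_real t * (s * f1 s) \<notin> K"
    "\<And>t. 0 < t \<Longrightarrow> t < r \<Longrightarrow> exp (\<kappa> * t powr (3/2)) \<le> norm (\<psi> (f s + of_real t * (s * f1 s)))"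
    \<comment> \<open>Invoked to have the outer normal outside \<open>K\<close>; \<open>3/2\<close>
      is just an exponent between 1 and 2.\<close>
    by (rule psi_lower_bound[OF s, of "3/2"], simp, simp, blast)
  define X where "X = (\<lambda>n. f s + of_real (r / 2 * inverse (real (Suc n))) * (s * f1 s))"
  have "r / 2 * inverse (real (Suc n)) < r" for n
  proof -
    have "inverse (real (Suc n)) \<le> 1" by (simp add: field_simps)
    then have "r / 2 * inverse (real (Suc n)) \<le> r / 2 * 1" using \<kappa>(2) by (intro mult_left_mono) auto
    then show ?thesis using \<kappa>(2) by simp
  qed
  then have "X n \<notin> K" for n unfolding X_def using \<kappa>(2) by (intro \<kappa>(3)) auto
  moreover have "X \<longlonglongrightarrow> f s"
  proof -
    have "X \<longlonglongrightarrow> f s + of_real (r / 2 * 0) * (s * f1 s)"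
      unfolding X_def by (intro tendsto_intros LIMSEQ_inverse_real_of_nat)
    then show ?thesis by simp
  qed
  ultimately show ?thesis using that by blast
qed

text \<open>The oscillation bound makes \<open>\<psi>\<close> Cauchy along any approach from
  outside, and its modulus above 1 makes the limit nonzero. Nontriviality of the filter belongs to
  the conclusion because \<open>psi_bd\<close> and \<open>dpsi_bd\<close> are defined through
  \<open>Lim\<close>.\<close>

lemma psi_boundary_limit:
  assumes s: "norm s = 1"
  obtains L where "L \<noteq> 0" "(\<psi> \<longlongrightarrow> L) (at (f s) within - K)" "at (f s) within - K \<noteq> bot"
proof -
  obtain Q r where Q: "0 \<le> Q" "0 < r" "\<And>w w' q. w \<notin> K \<Longrightarrow> w' \<notin> K \<Longrightarrow> q < r \<Longrightarrow> norm (w - f s) < q \<Longrightarrow> norm (w' - f s) < q \<Longrightarrow>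
    norm (\<psi> w - \<psi> w') \<le> Q * q" by (rule psi_oscillation[OF s]) blast
  obtain X where X: "\<And>n::nat. X n \<notin> K" "X \<longlonglongrightarrow> f s" by (rule boundary_accessible[OF s]) blast
  have small: "\<exists>q. 0 < q \<and> q < r \<and> Q * q < e" if "0 < e" for e
  proof -
    define q where "q = min (r / 2) (e / (2 * (Q + 1)))"
    have "Q + 1 \<noteq> 0" using Q(1) by simp
    have "0 < q" "q < r" "q \<le> e / (2 * (Q + 1))" using Q that by (auto simp: q_def)
    moreover have "Q * q < e"
    proof -
      have "Q * q \<le> (Q + 1) * q" using \<open>0 < q\<close> by simp
      also have "\<dots> \<le> (Q + 1) * (e / (2 * (Q + 1)))" using \<open>q \<le> _\<close> Q(1) by (intro mult_left_mono) auto
      also have "\<dots> = e / 2" using \<open>Q + 1 \<noteq> 0\<close> by (simp add: field_simps)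
      finally show ?thesis using that by simp
    qed
    ultimately show ?thesis by blast
  qed
  have ev: "\<forall>\<^sub>F n in sequentially. norm (X n - f s) < q" if "0 < q" for q
    using tendstoD[OF X(2) that] by (simp add: dist_norm)
  have "Cauchy (\<lambda>n. \<psi> (X n))"
  proof (rule CauchyI)
    fix e :: real assume "0 < e"
    then obtain q where q: "0 < q" "q < r" "Q * q < e" using small by blast
    obtain N where "\<And>n. n \<ge> N \<Longrightarrow> norm (X n - f s) < q" using ev[OF q(1)] unfolding eventually_sequentially by blast
    then show "\<exists>N. \<forall>m\<ge>N. \<forall>n\<ge>N. norm (\<psi> (X m) - \<psi> (X n)) < e"
      using Q(3)[OF X(1) X(1) q(2)] q(3) by (intro exI[of _ N]) (meson le_less_trans)
  qed
  then obtain L where L: "(\<lambda>n. \<psi> (X n)) \<longlonglongrightarrow> L" using Cauchy_convergent convergent_def by blast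
  have "norm L \<ge> 1"
    by (rule LIMSEQ_le_const[OF tendsto_norm[OF L]]) (use norm_psi[OF X(1)] less_imp_le in blast)
  moreover have "(\<psi> \<longlongrightarrow> L) (at (f s) within - K)"
    unfolding tendsto_iff
  proof (intro allI impI)
    fix e :: real assume "0 < e"
    then obtain q where q: "0 < q" "q < r" "Q * q < e" using small by blast
    have "dist (\<psi> w) L < e" if w: "w \<notin> K" "norm (w - f s) < q" for w
    proof -
      have "norm (\<psi> w - L) \<le> Q * q"
      proof (rule tendsto_upperbound)
        show "(\<lambda>n. norm (\<psi> w - \<psi> (X n))) \<longlonglongrightarrow> norm (\<psi> w - L)" by (intro tendsto_intros L)
        show "\<forall>\<^sub>F n in sequentially. norm (\<psi> w - \<psi> (X n)) \<le> Q * q"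
          using ev[OF q(1)] by (rule eventually_mono) (rule Q(3)[OF w(1) X(1) q(2) w(2)])
      qed simp
      then show ?thesis using q(3) by (simp add: dist_norm)
    qed
    then show "\<forall>\<^sub>F w in at (f s) within - K. dist (\<psi> w) L < e"
      unfolding eventually_at using q(1) by (intro exI[of _ q]) (auto simp: dist_norm simp del: image_iff)
  qed
  moreover have "at (f s) within - K \<noteq> bot"
  proof -
    have "f s \<in> K" using s by simp
    then have "X n \<noteq> f s" for n using X(1)[of n] by metis
    then have "f s islimpt - K" unfolding islimpt_sequential using X by (intro exI[of _ X]) (simp del: image_iff)
    then show ?thesis by (simp add: trivial_limit_within)
  qed
  ultimately show ?thesis using that[of L] by fastforce
qed

lemma P_tendsto:
  assumes s: "norm s = 1" shows "(P \<longlongrightarrow> Pb s) (at (f s) within - K)"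
proof -
  obtain C where C: "0 \<le> C" "\<forall>w s. w \<notin> K \<longrightarrow> norm s = 1 \<longrightarrow> norm (w - f s) \<le> 1 \<longrightarrow> norm (P w - Pb s) \<le> C * norm (w - f s) powr a"
    using P_boundary by blast
  have "((\<lambda>w. C * norm (w - f s) powr a) \<longlongrightarrow> C * norm (f s - f s) powr a) (at (f s) within - K)"
    using a by (intro tendsto_intros tendsto_powr') auto
  then have *: "((\<lambda>w. C * norm (w - f s) powr a) \<longlongrightarrow> 0) (at (f s) within - K)" by simp
  have "((\<lambda>w. P w - Pb s) \<longlongrightarrow> 0) (at (f s) within - K)"
  proof (rule Lim_null_comparison[OF _ *])
    show "\<forall>\<^sub>F w in at (f s) within - K. norm (P w - Pb s) \<le> C * norm (w - f s) powr a"
      unfolding eventually_at using C(2) s by (intro exI[of _ 1]) (auto simp: dist_norm simp del: image_iff)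
  qed
  then show ?thesis using Lim_null by blast
qed

text \<open>As \<open>\<psi>' = P \<psi>\<close>, the limit \<open>L\<close> cancels from the
  quotient, leaving \<open>1 / (s * f1 s * Pb s)\<close>.\<close>

lemma v0_eq:
  assumes s: "norm s = 1" shows "v0 f \<phi> s = of_real (1 / dens s)"
proof -
  obtain L where L: "L \<noteq> 0" "(\<psi> \<longlongrightarrow> L) (at (f s) within - K)" "at (f s) within - K \<noteq> bot"
    by (rule psi_boundary_limit[OF s]) blast
  have 1: "psi_bd \<phi> (f s) = L"
    unfolding psi_bd_def ext_image by (rule tendsto_Lim[OF L(3,2)])
  have "((\<lambda>w. P w * \<psi> w) \<longlongrightarrow> Pb s * L) (at (f s) within - K)" by (intro tendsto_mult P_tendsto s L)
  moreover have "\<forall>\<^sub>F w in at (f s) within - K. P w * \<psi> w = deriv \<psi> w"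
    using psi_nonzero by (auto simp: eventually_at_filter P_def simp del: image_iff)
  ultimately have "(deriv \<psi> \<longlongrightarrow> Pb s * L) (at (f s) within - K)" by (rule Lim_transform_eventually)
  then have 2: "dpsi_bd \<phi> (f s) = Pb s * L"
    unfolding dpsi_bd_def ext_image by (rule tendsto_Lim[OF L(3)])
  have "bderiv f s = f1 s" using s by (simp add: f1_def)
  moreover have "s \<noteq> 0" "f1 s \<noteq> 0" "dens s \<noteq> 0" using s f1_nonzero[of s] dens_pos[OF s] by auto
  ultimately show ?thesis using L(1) by (simp add: v0_def 1 2 Pb_def)
qed

lemma Pb_nonzero: "norm s = 1 \<Longrightarrow> Pb s \<noteq> 0"
  using dens_pos[of s] f1_nonzero[of s] by (auto simp: Pb_def)

section \<open>Calculus of uniform boundary limits\<close>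

lemma boundary_limit_mult:
  assumes "boundary_limit E1 B1" "boundary_limit E2 B2"
  shows "boundary_limit (\<lambda>x. E1 x * E2 x) (\<lambda>s. B1 s * B2 s)"
  unfolding boundary_limit_def
proof (intro conjI allI impI)
  have cB: "continuous_on (sphere 0 1) B1" "continuous_on (sphere 0 1) B2" using assms unfolding boundary_limit_def by auto
  then show "continuous_on (sphere 0 1) (\<lambda>s. B1 s * B2 s)" by (intro continuous_intros)
  have ex: "\<exists>M. \<forall>s. norm s = 1 \<longrightarrow> norm (B s) \<le> M" if cB: "continuous_on (sphere 0 1) B" for B :: "complex \<Rightarrow> complex"
  proof -
    obtain M where "\<forall>y\<in>B ` sphere 0 1. norm y \<le> M"
      using compact_imp_bounded[OF compact_continuous_image[OF cB compact_sphere]] unfolding bounded_iff by blast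
    then show ?thesis by (intro exI[of _ M]) auto
  qed
  obtain M1 where M1: "\<And>s. norm s = 1 \<Longrightarrow> norm (B1 s) \<le> M1" using ex[OF cB(1)] by blast
  obtain M2 where M2: "\<And>s. norm s = 1 \<Longrightarrow> norm (B2 s) \<le> M2" using ex[OF cB(2)] by blast
  have M0: "0 \<le> M1" "0 \<le> M2" using order_trans[OF norm_ge_zero M1[of 1]] order_trans[OF norm_ge_zero M2[of 1]] by simp_all
  fix e :: real assume e: "0 < e"
  define \<epsilon> where "\<epsilon> = min 1 (e / (M1 + M2 + 2))"
  have \<epsilon>: "0 < \<epsilon>" "\<epsilon> \<le> 1" "\<epsilon> \<le> e / (M1 + M2 + 2)" using e M0 by (auto simp: \<epsilon>_def)
  obtain d1 where d1: "d1 > 0" "\<forall>x s. x \<notin> K \<longrightarrow> norm s = 1 \<longrightarrow> norm (x - f s) < d1 \<longrightarrow> norm (E1 x - B1 s) < \<epsilon>"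
    using assms(1) \<epsilon>(1) unfolding boundary_limit_def by blast
  obtain d2 where d2: "d2 > 0" "\<forall>x s. x \<notin> K \<longrightarrow> norm s = 1 \<longrightarrow> norm (x - f s) < d2 \<longrightarrow> norm (E2 x - B2 s) < \<epsilon>"
    using assms(2) \<epsilon>(1) unfolding boundary_limit_def by blast
  have "norm (E1 x * E2 x - B1 s * B2 s) < e" if "x \<notin> K" "norm s = 1" "norm (x - f s) < min d1 d2" for x s
  proof -
    have 1: "norm (E1 x - B1 s) < \<epsilon>" "norm (E2 x - B2 s) < \<epsilon>" using d1(2) d2(2) that by auto
    then have 2: "norm (E2 x) \<le> M2 + 1" using M2[OF that(2)] \<epsilon>(2) norm_triangle_ineq2[of "E2 x" "B2 s"] by linarith
    have e: "E1 x * E2 x - B1 s * B2 s = (E1 x - B1 s) * E2 x + B1 s * (E2 x - B2 s)" by (simp add: algebra_simps)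
    have "norm (E1 x * E2 x - B1 s * B2 s) \<le> norm (E1 x - B1 s) * norm (E2 x) + norm (B1 s) * norm (E2 x - B2 s)"
      unfolding e norm_mult[symmetric] by (rule norm_triangle_ineq)
    also have "\<dots> \<le> \<epsilon> * (M2 + 1) + M1 * \<epsilon>"
      using 1 2 M1[OF that(2)] M0 \<epsilon>(1) by (intro add_mono mult_mono) auto
    also have "\<dots> = \<epsilon> * (M1 + M2 + 1)" by (simp add: algebra_simps)
    also have "\<dots> < \<epsilon> * (M1 + M2 + 2)" using \<epsilon>(1) by simp
    also have "\<dots> \<le> e / (M1 + M2 + 2) * (M1 + M2 + 2)" using \<epsilon>(3) M0 by (intro mult_right_mono) auto
    also have "\<dots> = e" using M0 by simp
    finally show ?thesis .
  qed
  then show "\<exists>d>0. \<forall>x s. x \<notin> K \<longrightarrow> norm s = 1 \<longrightarrow> norm (x - f s) < d \<longrightarrow> norm (E1 x * E2 x - B1 s * B2 s) < e"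
    using d1(1) d2(1) by (intro exI[of _ "min d1 d2"]) auto
qed

lemma boundary_limit_recip:
  assumes EB: "boundary_limit E B" and nz: "\<And>s. norm s = 1 \<Longrightarrow> B s \<noteq> 0"
  shows "boundary_limit (\<lambda>x. inverse (E x)) (\<lambda>s. inverse (B s))"
  unfolding boundary_limit_def
proof (intro conjI allI impI)
  have cB: "continuous_on (sphere 0 1) B" using EB unfolding boundary_limit_def by auto
  then show "continuous_on (sphere 0 1) (\<lambda>s. inverse (B s))" using nz by (intro continuous_intros) auto
  obtain s0 where s0: "s0 \<in> sphere 0 1" "\<forall>s\<in>sphere 0 1. norm (B s0) \<le> norm (B s)"
    using continuous_attains_inf[OF compact_sphere _ continuous_on_norm[OF cB]] by auto
  define m where "m = norm (B s0)"
  have m: "0 < m" "\<And>s. norm s = 1 \<Longrightarrow> m \<le> norm (B s)" using s0 nz[of s0] by (auto simp: m_def)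
  fix e :: real assume e: "0 < e"
  define \<epsilon> where "\<epsilon> = min (m / 2) (e * m * m / 4)"
  have \<epsilon>: "0 < \<epsilon>" "\<epsilon> \<le> m / 2" "\<epsilon> \<le> e * m * m / 4" using e m by (auto simp: \<epsilon>_def)
  obtain d where d: "d > 0" "\<forall>x s. x \<notin> K \<longrightarrow> norm s = 1 \<longrightarrow> norm (x - f s) < d \<longrightarrow> norm (E x - B s) < \<epsilon>"
    using EB \<epsilon>(1) unfolding boundary_limit_def by blast
  have "norm (inverse (E x) - inverse (B s)) < e" if "x \<notin> K" "norm s = 1" "norm (x - f s) < d" for x s
  proof -
    have 1: "norm (E x - B s) < \<epsilon>" using d(2) that by auto
    have 2: "m / 2 \<le> norm (E x)" using m(2)[OF that(2)] 1 \<epsilon>(2) norm_triangle_ineq2[of "B s" "E x"] by (simp add: norm_minus_commute)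
    then have nE: "E x \<noteq> 0" using m(1) by auto
    have "norm (inverse (E x) - inverse (B s)) = norm (E x - B s) / (norm (E x) * norm (B s))"
      using nE nz[OF that(2)] by (simp add: inverse_diff_inverse norm_mult norm_inverse divide_inverse mult_ac)
    also have "\<dots> \<le> (e * m * m / 4) / (m / 2 * m)"
      using 1 2 \<epsilon>(3) m that(2) e by (intro frac_le mult_mono) auto
    also have "\<dots> < e" using m(1) e by simp
    finally show ?thesis .
  qed
  then show "\<exists>d>0. \<forall>x s. x \<notin> K \<longrightarrow> norm s = 1 \<longrightarrow> norm (x - f s) < d \<longrightarrow> norm (inverse (E x) - inverse (B s)) < e"
    using d(1) by blast
qed

lemma boundary_limit_of_holder:
  assumes "continuous_on (sphere 0 1) B"
    and "\<exists>C\<ge>0. \<forall>w s. w \<notin> K \<longrightarrow> norm s = 1 \<longrightarrow> norm (w - f s) \<le> 1 \<longrightarrow> norm (E w - B s) \<le> C * norm (w - f s) powr a"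
  shows "boundary_limit E B"
  unfolding boundary_limit_def
proof (intro conjI allI impI assms(1))
  fix e :: real assume e: "0 < e"
  obtain C where C: "0 \<le> C" "\<forall>w s. w \<notin> K \<longrightarrow> norm s = 1 \<longrightarrow> norm (w - f s) \<le> 1 \<longrightarrow> norm (E w - B s) \<le> C * norm (w - f s) powr a"
    using assms(2) by blast
  define d where "d = min 1 ((e / (C + 1)) powr (1 / a))"
  have d: "0 < d" "d \<le> 1" using e C(1) by (auto simp: d_def)
  have da: "C * d powr a < e"
  proof -
    have "d powr a \<le> ((e / (C + 1)) powr (1 / a)) powr a" using d a by (intro powr_mono2) (auto simp: d_def)
    also have "\<dots> = e / (C + 1)" using a e C(1) by (simp add: powr_powr)
    finally have "C * d powr a \<le> C * (e / (C + 1))" using C(1) by (rule mult_left_mono)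
    also have "\<dots> < e" using e C(1) by (simp add: field_simps)
    finally show ?thesis .
  qed
  have "norm (E x - B s) < e" if "x \<notin> K" "norm s = 1" "norm (x - f s) < d" for x s
  proof -
    have "norm (E x - B s) \<le> C * norm (x - f s) powr a" using C(2) that d by auto
    also have "\<dots> \<le> C * d powr a" using that C(1) a by (intro mult_left_mono powr_mono2) auto
    finally show ?thesis using da by simp
  qed
  then show "\<exists>d>0. \<forall>x s. x \<notin> K \<longrightarrow> norm s = 1 \<longrightarrow> norm (x - f s) < d \<longrightarrow> norm (E x - B s) < e"
    using d(1) by blast
qed

lemma boundary_limit_P: "boundary_limit P Pb"
  by (rule boundary_limit_of_holder[OF holder_on_continuous[OF holder_Pb a(1)] P_boundary])

lemma boundary_limit_id: "boundary_limit (\<lambda>x. x) f"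
  using boundary_limit_continuous[of UNIV "\<lambda>x. x"] by simp

section \<open>Cauchy transforms outside the curve\<close>

lemma cauchy_transform_at_infinity:
  assumes cg: "continuous_on {0..2*pi} g"
  shows "((\<lambda>w. w * avg (\<lambda>t. g t / (w - f (cis t)))) \<longlongrightarrow> avg g) at_infinity"
proof -
  obtain B where B0: "\<forall>y\<in>g ` {0..2*pi}. norm y \<le> B"
    using compact_imp_bounded[OF compact_continuous_image[OF cg compact_Icc]] unfolding bounded_iff by blast
  obtain F where F0: "\<forall>y\<in>K. norm y \<le> F" using compact_imp_bounded[OF compact_K] unfolding bounded_iff by blast
  have B: "norm (g t) \<le> B" if "t \<in> {0..2*pi}" for t using B0 that by blast
  have F: "norm (f (cis t)) \<le> F" for t using F0 by simp
  have BF: "0 \<le> B" "0 \<le> F" using order_trans[OF norm_ge_zero B[of 0]] order_trans[OF norm_ge_zero F[of 0]] by auto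
  have cf: "continuous_on {0..2*pi} (\<lambda>t. f (cis t))"
    by (rule continuous_on_circle[OF continuous_on_subset[OF cont_f]]) auto
  have bd: "norm (w * avg (\<lambda>t. g t / (w - f (cis t))) - avg g) \<le> B * F / (norm w - F)" if w: "F < norm w" for w
  proof -
    have ne: "norm w - F \<le> norm (w - f (cis t))" for t using norm_triangle_ineq2[of w "f (cis t)"] F[of t] by linarith
    have nz: "w - f (cis t) \<noteq> 0" for t using ne[of t] w by auto
    have c: "continuous_on {0..2*pi} (\<lambda>t. w * (g t / (w - f (cis t))))" 
      by (intro continuous_on_mult continuous_on_divide continuous_on_diff continuous_on_const cf cg ballI nz)
    have "w * avg (\<lambda>t. g t / (w - f (cis t))) - avg g = avg (\<lambda>t. w * (g t / (w - f (cis t))) - g t)"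
      by (simp only: avg_diff[OF c cg] avg_mult_right)
    also have "norm \<dots> \<le> B * F / (norm w - F)"
    proof (rule norm_avg_le_const)
      show "continuous_on {0..2*pi} (\<lambda>t. w * (g t / (w - f (cis t))) - g t)" by (intro continuous_on_diff c cg)
      fix t assume t: "t \<in> {0..2*pi}"
      have "u \<noteq> 0 \<Longrightarrow> (u + b) * (c / u) - c = c * b / u" for u b c :: complex by (simp add: field_simps)
      from this[OF nz[of t], of "f (cis t)" "g t"]
      have e: "w * (g t / (w - f (cis t))) - g t = g t * f (cis t) / (w - f (cis t))" by (simp only: diff_add_cancel)
      have "norm (w * (g t / (w - f (cis t))) - g t) = norm (g t) * norm (f (cis t)) / norm (w - f (cis t))"
        unfolding e by (simp only: norm_mult norm_divide)
      also have "\<dots> \<le> B * F / (norm w - F)" using B[OF t] F[of t] ne[of t] w BF by (intro frac_le mult_mono) auto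
      finally show "norm (w * (g t / (w - f (cis t))) - g t) \<le> B * F / (norm w - F)" .
    qed
    finally show ?thesis .
  qed
  have "filterlim (\<lambda>w::complex. - F + norm w) at_top at_infinity"
    by (rule filterlim_tendsto_add_at_top[OF tendsto_const filterlim_norm_at_top])
  then have "filterlim (\<lambda>w::complex. norm w - F) at_infinity at_infinity" by (simp add: filterlim_at_top_imp_at_infinity)
  then have "((\<lambda>w::complex. B * F / (norm w - F)) \<longlongrightarrow> 0) at_infinity" by (rule tendsto_divide_0[OF tendsto_const])
  moreover have "\<forall>\<^sub>F w in at_infinity. norm (w * avg (\<lambda>t. g t / (w - f (cis t))) - avg g) \<le> B * F / (norm w - F)"
    unfolding eventually_at_infinity using bd by (intro exI[of _ "F + 1"]) auto
  ultimately have "((\<lambda>w. w * avg (\<lambda>t. g t / (w - f (cis t))) - avg g) \<longlongrightarrow> 0) at_infinity"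
    by (rule Lim_null_comparison[rotated])
  then show ?thesis by (rule Lim_null[THEN iffD2])
qed

lemma cauchy_transform_holomorphic:
  assumes cg: "continuous_on {0..2*pi} g"
  shows "(\<lambda>w. avg (\<lambda>t. g t / (w - f (cis t)))) holomorphic_on - K"
  unfolding holomorphic_on_open[OF open_outside]
proof
  fix w assume w: "w \<in> - K"
  then obtain e where e: "0 < e" "ball w e \<subseteq> - K" using open_outside by (meson openE)
  have cf: "continuous_on {0..2*pi} (\<lambda>t. f (cis t))"
    by (rule continuous_on_circle[OF continuous_on_subset[OF cont_f]]) auto
  have ne: "x - f (cis t) \<noteq> 0" if "x \<in> ball w e" for x t
  proof -
    have "f (cis t) \<in> K" by simp
    moreover have "x \<in> - K" by (rule subsetD[OF e(2) that])
    ultimately have "x \<noteq> f (cis t)" by (metis ComplD)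
    then show ?thesis by simp
  qed
  have "(\<lambda>x. integral (cbox 0 (2*pi)) (\<lambda>t. g t / (x - f (cis t)))) holomorphic_on ball w e"
  proof (rule leibniz_rule_holomorphic)
    fix x t assume x: "x \<in> ball w e"
    have "((\<lambda>x. g t / (x - f (cis t))) has_field_derivative - g t / (x - f (cis t))\<^sup>2) (at x)"
      by (rule DERIV_cong[OF DERIV_divide[OF DERIV_const DERIV_diff[OF DERIV_ident DERIV_const] ne[OF x]]])
        (simp add: power2_eq_square)
    then show "((\<lambda>x. g t / (x - f (cis t))) has_field_derivative - g t / (x - f (cis t))\<^sup>2) (at x within ball w e)"
      by (rule has_field_derivative_at_within)
  next
    fix x assume x: "x \<in> ball w e"
    show "(\<lambda>t. g t / (x - f (cis t))) integrable_on cbox 0 (2*pi)"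
      unfolding cbox_interval
      by (intro integrable_continuous_interval continuous_on_divide continuous_on_diff continuous_on_const cf cg ballI ne x)
  next
    have "continuous_on (ball w e \<times> {0..2*pi}) (\<lambda>p. g (snd p))"
      by (rule continuous_on_compose2[OF cg continuous_on_snd[OF continuous_on_id]]) auto
    moreover have "continuous_on (ball w e \<times> {0..2*pi}) (\<lambda>p. f (cis (snd p)))"
      by (rule continuous_on_compose2[OF cf continuous_on_snd[OF continuous_on_id]]) auto
    ultimately show "continuous_on (ball w e \<times> cbox 0 (2*pi)) (\<lambda>(x, t). - g t / (x - f (cis t))\<^sup>2)"
      unfolding split_beta cbox_interval
    proof (intro continuous_on_divide continuous_on_minus continuous_on_power continuous_on_diff continuous_on_fst continuous_on_id ballI)
      fix p assume "p \<in> ball w e \<times> {0..2*pi}"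
      then have "fst p \<in> ball w e" by (rule mem_Times_iff[THEN iffD1, THEN conjunct1])
      then show "(fst p - f (cis (snd p)))\<^sup>2 \<noteq> 0" by (intro power_not_zero ne)
    qed
  qed auto
  then have "(\<lambda>x. of_real (1 / (2 * pi)) * integral {0..2*pi} (\<lambda>t. g t / (x - f (cis t)))) holomorphic_on ball w e"
    unfolding cbox_interval by (rule holomorphic_on_mult[OF holomorphic_on_const])
  then have "(\<lambda>w. avg (\<lambda>t. g t / (w - f (cis t)))) holomorphic_on ball w e"
    by (simp only: avg_def scaleR_conv_of_real)
  then have "((\<lambda>w. avg (\<lambda>t. g t / (w - f (cis t)))) has_field_derivative deriv (\<lambda>w. avg (\<lambda>t. g t / (w - f (cis t)))) w) (at w)"
    by (rule holomorphic_derivI[OF _ open_ball]) (use e in simp)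
  then show "\<exists>f'. ((\<lambda>w. avg (\<lambda>t. g t / (w - f (cis t)))) has_field_derivative f') (at w)" by blast
qed

lemma hol_P: "P holomorphic_on - K"
  unfolding P_def[abs_def] using psi_nonzero
  by (intro holomorphic_on_divide holomorphic_deriv hol_psi open_outside) (simp only: Compl_iff)

lemma P_nonzero: "w \<notin> K \<Longrightarrow> P w \<noteq> 0"
  using psi_nonzero deriv_psi_nonzero by (simp add: P_def)

lemma outside_at_infinity: "\<forall>\<^sub>F w in at_infinity. w \<notin> K"
proof -
  obtain F where "\<forall>y\<in>K. norm y \<le> F" using compact_imp_bounded[OF compact_K] unfolding bounded_iff by blast
  then have "w \<notin> K" if "F + 1 \<le> norm w" for w
    using that by (meson less_add_one less_le_trans not_le)
  then show ?thesis unfolding eventually_at_infinity by blast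
qed

lemma P_at_infinity: "((\<lambda>w. w * P w) \<longlongrightarrow> 1) at_infinity"
proof -
  have "continuous_on {0..2*pi} (\<lambda>t. complex_of_real (dens (cis t)))"
    by (intro continuous_on_of_real continuous_on_circle continuous_on_dens)
  from cauchy_transform_at_infinity[OF this]
  have "((\<lambda>w. w * avg (\<lambda>t. of_real (dens (cis t)) / (w - f (cis t)))) \<longlongrightarrow> 1) at_infinity" unfolding avg_dens_1 .
  moreover have "\<forall>\<^sub>F w in at_infinity. w * avg (\<lambda>t. of_real (dens (cis t)) / (w - f (cis t))) = w * P w"
    using outside_at_infinity by (rule eventually_mono) (simp add: P_eq_avg)
  ultimately show ?thesis by (rule Lim_transform_eventually)
qed

text \<open>Of the two factors \<open>s f'(s)\<close> in the square one becomes the line element of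
  the curve; the remaining \<open>s f'(s) v(s) / f(s)^2\<close> is the function to which the Plemelj
  formula applies.\<close>

lemma I_op_eq:
  assumes v: "continuous_on (sphere 0 1) v" and z: "norm z < 1"
  shows "I_op f v z = - avg (\<lambda>t. (cis t * f1 (cis t) * of_real (v (cis t)) / (f (cis t))\<^sup>2) * f1 (cis t) * cis t / (f (cis t) - f z))"
proof -
  define q where "q = (\<lambda>s. (s * bderiv f s / f s)\<^sup>2 * of_real (v s) / (f s - f z) / s)"
  have fz: "f s - f z \<noteq> 0" if "norm s = 1" for s
  proof -
    have "s \<noteq> z" using that z by auto
    then show ?thesis using f_neq[of s z] that z by simp
  qed
  have q_eq: "q s = (s * f1 s / f s)\<^sup>2 * of_real (v s) / (f s - f z) / s" if "norm s = 1" for s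
    using that by (simp add: q_def f1_def)
  have "continuous_on (sphere 0 1) (\<lambda>s. (s * f1 s / f s)\<^sup>2 * of_real (v s) / (f s - f z) / s)"
    using fz f_nonzero by (intro continuous_intros v continuous_on_subset[OF cont_f1] continuous_on_subset[OF cont_f]) auto
  then have "continuous_on (sphere 0 1) q" 
    by (rule continuous_on_eq) (simp only: q_eq mem_sphere_0)
  then have "contour_integral (circlepath 0 1) q = 2 * pi * \<i> * avg (\<lambda>t. q (cis t) * cis t)"
    by (rule contour_integral_circle)
  moreover have "q (cis t) * cis t = (cis t * f1 (cis t) * of_real (v (cis t)) / (f (cis t))\<^sup>2) * f1 (cis t) * cis t / (f (cis t) - f z)" for t
  proof -
    have "F\<noteq>0 \<Longrightarrow> s \<noteq> 0 \<Longrightarrow> W \<noteq> 0 \<Longrightarrow> (s * n / F)\<^sup>2 * V / W / s * s = s * n * V / F\<^sup>2 * n * s / W" for F s n V W :: complex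
      by (simp add: field_simps power2_eq_square)
    then show ?thesis unfolding q_eq[OF norm_cis] using f_nonzero fz by simp
  qed
  ultimately show ?thesis unfolding I_op_def q_def[symmetric] by simp
qed

text \<open>\<open>Pb\<close> contains \<open>dens\<close> once, so two factors \<open>Pb\<close> in
  the denominator against one \<open>dens\<close> of the measure leave \<open>1 / dens\<close>. At
  infinity \<open>w * P w\<close> tends to 1, and the remaining factor tends to 0.\<close>

lemma kernel_converse:
  assumes z: "norm z < 1"
  shows "avg (\<lambda>t. (cis t * f1 (cis t) * of_real (1 / dens (cis t)) / (f (cis t))\<^sup>2) * f1 (cis t) * cis t / (f (cis t) - f z)) = 0"
proof -
  define E where "E = (\<lambda>w. inverse ((w * P w) * (w * P w) * (w - f z)))"
  define B where "B = (\<lambda>s. inverse ((f s * Pb s) * (f s * Pb s) * (f s - f z)))"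
  have fz: "f s - f z \<noteq> 0" if "norm s = 1" for s
  proof -
    have "s \<noteq> z" using that z by auto
    then show ?thesis using f_neq[of s z] that z by simp
  qed
  have "boundary_limit (\<lambda>w. w - f z) (\<lambda>s. f s - f z)"
    by (rule boundary_limit_continuous[of UNIV]) (auto intro!: continuous_intros)
  then have EB: "boundary_limit E B" unfolding E_def B_def
    by (intro boundary_limit_recip boundary_limit_mult boundary_limit_id boundary_limit_P)
      (use fz f_nonzero Pb_nonzero in auto)
  have wz: "w - f z \<noteq> 0" "w \<noteq> 0" if "w \<notin> K" for w using that z zero_in_K by force+
  have hE: "E holomorphic_on - K" unfolding E_def using wz P_nonzero
    by (intro holomorphic_intros hol_P) (auto simp del: image_iff)
  have "((\<lambda>w. inverse ((w * P w) * (w * P w)) * (1 / (w - f z))) \<longlongrightarrow> inverse (1 * 1) * 0) at_infinity"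
    by (intro tendsto_mult tendsto_inverse P_at_infinity tendsto_inverse_shift) simp
  then have "(E \<longlongrightarrow> 0) at_infinity" by (simp add: E_def divide_inverse)
  from avg_dens_holomorphic[OF EB hE this]
  have "avg (\<lambda>t. B (cis t) * of_real (dens (cis t))) = 0" .
  moreover have "B (cis t) * of_real (dens (cis t)) =
     (cis t * f1 (cis t) * of_real (1 / dens (cis t)) / (f (cis t))\<^sup>2) * f1 (cis t) * cis t / (f (cis t) - f z)" for t
  proof -
    have alg: "F \<noteq> 0 \<Longrightarrow> n \<noteq> 0 \<Longrightarrow> W \<noteq> 0 \<Longrightarrow> d \<noteq> 0 \<Longrightarrow>
        inverse (F * (d / (s * n)) * (F * (d / (s * n))) * W) * d = s * n * (1 / d) / F\<^sup>2 * n * s / W" for F s n d W :: complex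
      by (simp add: divide_simps power2_eq_square)
    have "f1 (cis t) \<noteq> 0" "complex_of_real (dens (cis t)) \<noteq> 0"
      using dens_pos[of "cis t"] f1_nonzero[of "cis t"] by auto
    then show ?thesis unfolding B_def Pb_def of_real_divide of_real_1
      by (rule alg[OF f_nonzero[OF norm_cis] _ fz[OF norm_cis]])
  qed
  ultimately show ?thesis by (simp only:)
qed

lemma kernel_direct:
  assumes v: "holder_on a (sphere 0 1) v"
    and van: "\<And>z. norm z < 1 \<Longrightarrow> avg (\<lambda>t. (cis t * f1 (cis t) * of_real (v (cis t)) / (f (cis t))\<^sup>2) * f1 (cis t) * cis t / (f (cis t) - f z)) = 0"
  obtains c :: real where "\<And>s. norm s = 1 \<Longrightarrow> v s * dens s = c"
proof -
  define h where "h = (\<lambda>s. s * f1 s * of_real (v s) / (f s)\<^sup>2)"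
  have hh: "holder_on a (sphere 0 1) h"
  proof -
    have "holder_on a (sphere 0 1) (\<lambda>s. (s * f1 s * of_real (v s)) * inverse (f s * f s))"
      by (intro holder_on_mult holder_on_inverse holder_of_real v holder_id holder_f1 holder_f a compact_sphere)
        (use f_nonzero in auto)
    then show ?thesis unfolding h_def divide_inverse power2_eq_square .
  qed
  define g where "g = (\<lambda>t. h (cis t) * f1 (cis t) * cis t)"
  define H where "H = (\<lambda>w. avg (\<lambda>t. g t / (w - f (cis t))))"
  have "continuous_on (sphere 0 1) f1" by (rule continuous_on_subset[OF cont_f1]) auto
  then have "continuous_on (sphere 0 1) (\<lambda>s. h s * f1 s * s)"
    by (intro continuous_on_mult continuous_on_id holder_on_continuous[OF hh a(1)])
  then have cg: "continuous_on {0..2*pi} g" unfolding g_def by (rule continuous_on_circle)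
  have van': "avg (\<lambda>t. h (cis t) * f1 (cis t) * cis t / (f (cis t) - f z)) = 0" if "norm z < 1" for z
    using van[OF that] unfolding h_def .
  have BH: "boundary_limit H h" unfolding H_def g_def
    by (rule boundary_limit_of_holder[OF holder_on_continuous[OF hh a(1)] holder_plemelj[OF hh van']])
  define N where "N = (\<lambda>w. (w * H w) * (w * P w))"
  have BN: "boundary_limit N (\<lambda>s. (f s * h s) * (f s * Pb s))"
    unfolding N_def by (intro boundary_limit_mult boundary_limit_id BH boundary_limit_P)
  have real: "(f s * h s) * (f s * Pb s) = of_real (v s * dens s)" if "norm s = 1" for s
  proof -
    have alg: "F \<noteq> 0 \<Longrightarrow> n \<noteq> 0 \<Longrightarrow> F * (n * V / F\<^sup>2) * (F * (D / n)) = V * D" for F n V D :: complex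
      by (simp add: field_simps power2_eq_square)
    have "s * f1 s \<noteq> 0" using that f1_nonzero[of s] by auto
    then show ?thesis unfolding h_def Pb_def of_real_mult by (rule alg[OF f_nonzero[OF that]])
  qed
  have near: "\<exists>d>0. \<forall>x s. x \<notin> K \<longrightarrow> norm s = 1 \<longrightarrow> norm (x - f s) < d \<longrightarrow> norm (N x - of_real (v s * dens s)) < e" if e: "0 < e" for e
  proof -
    obtain d where d: "d > 0" "\<forall>x s. x \<notin> K \<longrightarrow> norm s = 1 \<longrightarrow> norm (x - f s) < d \<longrightarrow> norm (N x - (f s * h s) * (f s * Pb s)) < e"
      using BN e unfolding boundary_limit_def by blast
    have "norm (N x - of_real (v s * dens s)) < e" if "x \<notin> K" "norm s = 1" "norm (x - f s) < d" for x s
      unfolding real[OF that(2), symmetric] by (rule d(2)[rule_format, OF that])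
    then show ?thesis using d(1) by blast
  qed
  have hN: "N holomorphic_on - K" unfolding N_def H_def
    by (intro holomorphic_on_mult holomorphic_on_ident hol_P cauchy_transform_holomorphic[OF cg])
  have lN: "(N \<longlongrightarrow> avg g * 1) at_infinity" unfolding N_def H_def
    by (rule tendsto_mult[OF cauchy_transform_at_infinity[OF cg] P_at_infinity])
  \<comment> \<open>In the variable \<open>\<eta>\<close> infinity becomes the centre of the disc,
    and the real boundary values of \<open>N\<close> make \<open>Im G\<close> uniformly small near
    the circle, because \<open>\<phi> (1 / \<eta>)\<close> is then near the curve.\<close>
  define G where "G = (\<lambda>\<eta>. if \<eta> = 0 then avg g * 1 else N (\<phi> (1 / \<eta>)))"
  have pK: "(\<lambda>\<eta>. \<phi> (1 / \<eta>)) ` (ball 0 1 - {0}) \<subseteq> - K"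
  proof (rule image_subsetI)
    fix \<eta> :: complex assume "\<eta> \<in> ball 0 1 - {0}"
    then show "\<phi> (1 / \<eta>) \<in> - K" using phi_inverse_notin[of \<eta>] by (simp only: Compl_iff Diff_iff mem_ball_0 singleton_iff) blast
  qed
  have "(N \<circ> (\<lambda>\<eta>. \<phi> (1 / \<eta>))) holomorphic_on ball 0 1 - {0}"
    by (rule holomorphic_on_compose_gen[OF hol_phi_inverse hN pK])
  then have "(\<lambda>\<eta>. N (\<phi> (1 / \<eta>))) holomorphic_on ball 0 1 - {0}" by (simp add: o_def)
  then have hG: "G holomorphic_on ball 0 1" unfolding G_def
    by (rule removable_singularity[OF _ open_ball filterlim_compose[OF lN phi_inverse_at_0]])
  obtain c :: real where c: "\<And>\<eta>. norm \<eta> < 1 \<Longrightarrow> G \<eta> = of_real c"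
  proof (rule holomorphic_Im_vanishing[OF hG])
    fix e :: real assume e: "0 < e"
    obtain d where d: "d > 0" "\<forall>x s. x \<notin> K \<longrightarrow> norm s = 1 \<longrightarrow> norm (x - f s) < d \<longrightarrow> norm (N x - of_real (v s * dens s)) < e"
      using near[OF e] by blast
    obtain r where r: "0 < r" "r < 1" "\<And>\<eta>. r < norm \<eta> \<Longrightarrow> norm \<eta> < 1 \<Longrightarrow> \<exists>s. norm s = 1 \<and> norm (\<phi> (1 / \<eta>) - f s) < d"
      by (rule phi_near_boundary[OF d(1)]) blast
    have "\<bar>Im (G \<eta>)\<bar> \<le> e" if eta: "r < norm \<eta>" "norm \<eta> < 1" for \<eta>
    proof -
      have e0: "\<eta> \<noteq> 0" using eta r by auto
      obtain s where s: "norm s = 1" "norm (\<phi> (1 / \<eta>) - f s) < d" using r(3)[OF eta] by blast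
      have "norm (N (\<phi> (1 / \<eta>)) - of_real (v s * dens s)) < e" 
        by (rule d(2)[rule_format, OF phi_inverse_notin[OF e0 eta(2)] s])
      then have "\<bar>Im (N (\<phi> (1 / \<eta>)) - of_real (v s * dens s))\<bar> < e" by (rule le_less_trans[OF abs_Im_le_cmod])
      then show ?thesis using e0 by (simp add: G_def)
    qed
    then show "\<exists>r<1. \<forall>\<eta>. r < norm \<eta> \<longrightarrow> norm \<eta> < 1 \<longrightarrow> \<bar>Im (G \<eta>)\<bar> \<le> e" using r(2) by blast
  qed blast
  have Nc: "N w = of_real c" if w: "w \<notin> K" for w
  proof -
    have n: "norm (1 / \<psi> w) < 1" using norm_psi[OF w] by (simp add: norm_divide divide_less_eq)
    have "1 / \<psi> w \<noteq> 0" using psi_nonzero[OF w] by simp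
    then show ?thesis using c[OF n] phi_psi[OF w] by (simp add: G_def)
  qed
  \<comment> \<open>The constant is carried back to each boundary point along a sequence of outside
    points that converges to it.\<close>
  have "v s * dens s = c" if s: "norm s = 1" for s
  proof -
    have "\<bar>v s * dens s - c\<bar> \<le> e" if e: "0 < e" for e
    proof -
      obtain d where d: "d > 0" "\<forall>x s. x \<notin> K \<longrightarrow> norm s = 1 \<longrightarrow> norm (x - f s) < d \<longrightarrow> norm (N x - of_real (v s * dens s)) < e"
        using near[OF e] by blast
      obtain X where X: "\<And>n::nat. X n \<notin> K" "X \<longlonglongrightarrow> f s" by (rule boundary_accessible[OF s]) blast
      obtain n where "norm (X n - f s) < d" using LIMSEQ_D[OF X(2) d(1)] by blast
      then have "norm (N (X n) - of_real (v s * dens s)) < e" by (rule d(2)[rule_format, OF X(1) s])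
      then have "\<bar>c - v s * dens s\<bar> < e" unfolding Nc[OF X(1)] of_real_diff[symmetric] norm_of_real .
      then show ?thesis by linarith
    qed
    then have "\<bar>v s * dens s - c\<bar> \<le> 0" by (rule field_le_epsilon[where y = 0, simplified])
    then show ?thesis by simp
  qed
  then show ?thesis using that by blast
qed

end

text \<open>The first conjunct places \<open>v0\<close> in the space whose kernel is computed. As
  \<open>v0\<close> is complex-valued by definition, the real span is written with \<open>Re\<close>
  and reality is recorded as a vanishing imaginary part.\<close>

theorem theorem1:
  fixes \<alpha> :: real and f \<phi> :: "complex \<Rightarrow> complex"
  assumes "0 < \<alpha>" "\<alpha> < 1"
    and "S1alpha \<alpha> f"
    and "univalent_ext_inf \<phi>"
    and "matching f \<phi>"
  shows "holder_on \<alpha> (sphere 0 1) (\<lambda>z. Re (v0 f \<phi> z))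
    \<and> (\<forall>v :: complex \<Rightarrow> real. holder_on \<alpha> (sphere 0 1) v \<longrightarrow>
          ((\<forall>z\<in>ball 0 1. I_op f v z = 0) \<longleftrightarrow>
           (\<exists>c::real. \<forall>s\<in>sphere 0 1. v s = c * Re (v0 f \<phi> s))))
    \<and> (\<forall>z\<in>sphere 0 1. Im (v0 f \<phi> z) = 0 \<and> Re (v0 f \<phi> z) > 0)
    \<and> ((\<lambda>t. 1 / v0 f \<phi> (cis t)) has_integral (2 * pi)) {0..2*pi}"
proof -
  interpret conformal_welding \<alpha> f \<phi> by unfold_locales (use assms in auto)
  have Re_v0: "Re (v0 f \<phi> s) = inverse (dens s)" and Im_v0: "Im (v0 f \<phi> s) = 0" if "norm s = 1" for s
    by (simp_all only: v0_eq[OF that] Re_complex_of_real Im_complex_of_real inverse_eq_divide)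
  have "holder_on \<alpha> (sphere 0 1) (\<lambda>s. inverse (dens s))"
    by (rule holder_on_inverse[OF holder_dens a(1) compact_sphere]) (use dens_pos in force)
  then have 1: "holder_on \<alpha> (sphere 0 1) (\<lambda>z. Re (v0 f \<phi> z))"
    using Re_v0 unfolding holder_on_def by simp
  have 2: "(\<forall>z\<in>ball 0 1. I_op f v z = 0) \<longleftrightarrow> (\<exists>c::real. \<forall>s\<in>sphere 0 1. v s = c * Re (v0 f \<phi> s))"
    if v: "holder_on \<alpha> (sphere 0 1) v" for v
  proof
    have cv: "continuous_on (sphere 0 1) v" by (rule holder_on_continuous[OF v a(1)])
    assume 0: "\<forall>z\<in>ball 0 1. I_op f v z = 0"
    obtain c where c: "\<And>s. norm s = 1 \<Longrightarrow> v s * dens s = c"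
      by (rule kernel_direct[OF v]) (use 0 I_op_eq[OF cv] in auto)
    have "v s = c * Re (v0 f \<phi> s)" if "norm s = 1" for s
      unfolding Re_v0[OF that] c[OF that, symmetric] using dens_pos[OF that] by simp
    then show "\<exists>c::real. \<forall>s\<in>sphere 0 1. v s = c * Re (v0 f \<phi> s)" by auto
  next
    have cv: "continuous_on (sphere 0 1) v" by (rule holder_on_continuous[OF v a(1)])
    assume "\<exists>c::real. \<forall>s\<in>sphere 0 1. v s = c * Re (v0 f \<phi> s)"
    then obtain c where c0: "\<forall>s\<in>sphere 0 1. v s = c * Re (v0 f \<phi> s)" by blast
    have c: "v s = c * (1 / dens s)" if "norm s = 1" for s
      using c0 that by (simp only: Re_v0 inverse_eq_divide mem_sphere_0)
    have "I_op f v z = 0" if z: "norm z < 1" for z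
    proof -
      have "(cis t * f1 (cis t) * of_real (v (cis t)) / (f (cis t))\<^sup>2) * f1 (cis t) * cis t / (f (cis t) - f z) =
        of_real c * ((cis t * f1 (cis t) * of_real (1 / dens (cis t)) / (f (cis t))\<^sup>2) * f1 (cis t) * cis t / (f (cis t) - f z))" for t
        by (simp add: c)
      then show ?thesis using kernel_converse[OF z] by (simp only: I_op_eq[OF cv z] avg_mult_right) simp
    qed
    then show "\<forall>z\<in>ball 0 1. I_op f v z = 0" by simp
  qed
  have 3: "\<forall>z\<in>sphere 0 1. Im (v0 f \<phi> z) = 0 \<and> Re (v0 f \<phi> z) > 0"
    using Re_v0 Im_v0 dens_pos by simp
  have 4: "((\<lambda>t. 1 / v0 f \<phi> (cis t)) has_integral (2 * pi)) {0..2*pi}"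
  proof -
    have "continuous_on {0..2*pi} (\<lambda>t. complex_of_real (dens (cis t)))"
      by (intro continuous_on_of_real continuous_on_circle continuous_on_dens)
    then have "((\<lambda>t. complex_of_real (dens (cis t))) has_integral integral {0..2*pi} (\<lambda>t. complex_of_real (dens (cis t)))) {0..2*pi}"
      by (intro integrable_integral cont_integrable)
    \<comment> \<open>The normalisation comes from testing the harmonic measure on the constant
      function 1; \<open>avg\<close> carries the factor \<open>1 / (2 * pi)\<close>.\<close>
    moreover have "integral {0..2*pi} (\<lambda>t. complex_of_real (dens (cis t))) = 2 * pi"
      using avg_dens_1 unfolding avg_def by (simp add: scaleR_conv_of_real field_simps)
    moreover have "1 / v0 f \<phi> (cis t) = of_real (dens (cis t))" for t using v0_eq[of "cis t"] by simp
    ultimately show ?thesis by simp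
  qed
  show ?thesis using 1 2 3 4 by blast
qed

end
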